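(* Let $(X,d,\mu)$, $L$ and $T_t=\exp(-tL)$ be as in the context, and let $h:X\to(0,\infty)$ be a function such that: (i) for all $t>0$, $T_th(x)=h(x)$ for a.e. $x\in X$; (ii) the metric measure space $(X,d,\mu_{h^2})$ is doubling, where $d\mu_{h^2}(x)=h^2(x)\,d\mu(x)$; (iii) there exist $c_1,c_2,C>0$ such that for all $x,y\in X$ and $t>0$, $$\frac{C^{-1}}{\mu_{h^2}(B(x,\sqrt t))}\exp\left(-\frac{d(x,y)^2}{c_1t}\right)\le \frac{T_t(x,y)}{h(x)h(y)}\le \frac{C}{\mu_{h^2}(B(x,\sqrt t))}\exp\left(-\frac{d(x,y)^2}{c_2t}\right).$$ Then there exists $p_0\in(1,2]$ such that if $h^{-1}\in A_{p_0}(\mu_{h^2})$, then $BMO[\mu,h]$ is the dual to the Hardy space $H^1_{at}[\mu,h]$.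
   Context: **Setting.** $(X,d,\mu)$ is a metric measure space with a nonnegative Borel measure $\mu$ that is doubling: there is $C>0$ with $\mu(B(x,2r))\le C\mu(B(x,r))$ for all $x\in X$, $r>0$, where $B(x,r)=\{y\in X: d(x,y)<r\}$ and balls have finite positive measure. Moreover $\mu(X)=\infty$. $L$ is a non-negative self-adjoint operator with domain in $L^2(\mu)$ whose semigroup $T_t=\exp(-tL)$ has a nonnegative integral kernel, $T_tf(x)=\int_X T_t(x,y)f(y)\,d\mu(y)$, satisfying for some $c,C>0$ $$0\le T_t(x,y)\le C\mu(B(x,\sqrt t))^{-1}\exp\left(-\frac{d(x,y)^2}{ct}\right),\quad x,y\in X,\ t>0.$$ **Atomic space.** Write $\mu_w(A)=\int_A w\,d\mu$. A function $a$ is an $[\mu,h]$-atom if there is a ball $B$ with $\operatorname{supp}a\subseteq B$, $\left(\int |a|^2h^{-1}\,d\mu\right)^{1/2}\le \mu_h(B)^{-1/2}$ and $\int a(x)h(x)\,d\mu(x)=0$. The space $H^1_{at}[\mu,h]$ consists of all $f=\sum_k\lambda_ka_k$ (convergence in $L^1(\mu)$ and a.e.) with $a_k$ being $[\mu,h]$-atoms and $\sum_k|\lambda_k|<\infty$; $\|f\|_{H^1_{at}[\mu,h]}=\inf\sum_k|\lambda_k|$ over all such representations. **BMO space.** A function $g$ is in $BMO[\mu,h]$ if $$\|g\|_{BMO[\mu,h]}:=\sup_B\inf_{c\in\mathbb C}\left(\mu_h(B)^{-1}\int_B|g(x)-c\,h(x)|^2h(x)\,d\mu(x)\right)^{1/2}<\infty,$$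 the supremum being over all balls $B$. Elements of $BMO[\mu,h]$ are classes $\{g+c\,h: c\in\mathbb C\}$. **Meaning of duality.** The identification is through the pairing $\langle f,g\rangle$ given by $\int_X f(x)g(x)\,d\mu(x)$ for $f$ a finite linear combination of $[\mu,h]$-atoms: for each $g\in BMO[\mu,h]$ this extends to a bounded linear functional on $H^1_{at}[\mu,h]$ with norm at most $C\|g\|_{BMO[\mu,h]}$, and conversely each bounded linear functional $l$ on $H^1_{at}[\mu,h]$ is of this form for some $g\in BMO[\mu,h]$ with $\|g\|_{BMO[\mu,h]}\le C\|l\|$. **Muckenhoupt classes.** A weight is a nonnegative locally integrable function. For a doubling measure $\nu$ on $(X,d)$ and $p>1$, $w\in A_p(\nu)$ if there is $C$ such that for every ball $B$, $\left(\frac1{\nu(B)}\int_B w\,d\nu\right)\left(\frac1{\nu(B)}\int_B w^{-1/(p-1)}\,d\nu\right)^{p-1}\le C$. *)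

theory Defs
  imports "HOL-Analysis.Analysis"
begin

section \<open>Metric measure spaces and weights\<close>

text \<open>A metric measure space is a type of class \<open>metric_space\<close> together with a measure on its
  Borel sets.\<close>

definition doubling_measure :: "'a::metric_space measure \<Rightarrow> bool" where
  "doubling_measure M \<longleftrightarrow>
     sets M = sets borel \<and>
     (\<forall>x r. 0 < r \<longrightarrow> 0 < emeasure M (ball x r) \<and> emeasure M (ball x r) < \<infinity>) \<and>
     (\<exists>C>0. \<forall>x r. 0 < r \<longrightarrow> measure M (ball x (2 * r)) \<le> C * measure M (ball x r))"

definition weighted :: "'a measure \<Rightarrow> ('a \<Rightarrow> real) \<Rightarrow> 'a measure" where
  "weighted M w = density M (\<lambda>x. ennreal (w x))"

text \<open>Positivity almost everywhere is required because the real-valued \<open>0 powr _\<close> is \<open>0\<close>,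
  whereas the negative power of \<open>w\<close> is infinite where \<open>w = 0\<close>. It only excludes
  the zero weight: for any other weight vanishing on a set of positive measure the second average
  is infinite on large balls, while the first is positive.\<close>

definition muckenhoupt :: "real \<Rightarrow> 'a::metric_space measure \<Rightarrow> ('a \<Rightarrow> real) \<Rightarrow> bool" where
  "muckenhoupt p \<nu> w \<longleftrightarrow>
     w \<in> borel_measurable \<nu> \<and> (\<forall>x. 0 \<le> w x) \<and> (AE x in \<nu>. 0 < w x) \<and>
     (\<forall>z r. 0 < r \<longrightarrow>
        set_integrable \<nu> (ball z r) w \<and>
        set_integrable \<nu> (ball z r) (\<lambda>x. w x powr (- 1 / (p - 1)))) \<and>
     (\<exists>C. \<forall>z r. 0 < r \<longrightarrow>
        (1 / measure \<nu> (ball z r) * (LINT x:ball z r|\<nu>. w x)) *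
        (1 / measure \<nu> (ball z r) * (LINT x:ball z r|\<nu>. w x powr (- 1 / (p - 1)))) powr (p - 1)
        \<le> C)"


section \<open>Operators on the complex space \<open>L\<^sup>2\<close>\<close>

text \<open>Elements of \<open>L\<^sup>2\<close> are handled through representatives; all identities between them are
  required almost everywhere.\<close>

definition L2 :: "'a measure \<Rightarrow> ('a \<Rightarrow> complex) set" where
  "L2 M = {f \<in> borel_measurable M. integrable M (\<lambda>x. (norm (f x))\<^sup>2)}"

definition L2_inner :: "'a measure \<Rightarrow> ('a \<Rightarrow> complex) \<Rightarrow> ('a \<Rightarrow> complex) \<Rightarrow> complex" where
  "L2_inner M f g = (LINT x|M. f x * cnj (g x))"

definition L2_norm :: "'a measure \<Rightarrow> ('a \<Rightarrow> complex) \<Rightarrow> real" where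
  "L2_norm M f = sqrt (LINT x|M. (norm (f x))\<^sup>2)"

text \<open>A linear operator \<open>L\<close> with domain \<open>D\<close>; the last clause says that both are well defined on
  classes of functions that agree almost everywhere.\<close>

definition L2_operator ::
    "'a measure \<Rightarrow> ('a \<Rightarrow> complex) set \<Rightarrow> (('a \<Rightarrow> complex) \<Rightarrow> ('a \<Rightarrow> complex)) \<Rightarrow> bool" where
  "L2_operator M D L \<longleftrightarrow>
     D \<subseteq> L2 M \<and> (\<forall>f\<in>D. L f \<in> L2 M) \<and>
     (\<forall>f\<in>D. \<forall>g\<in>D. (\<lambda>x. f x + g x) \<in> D \<and> (AE x in M. L (\<lambda>x. f x + g x) x = L f x + L g x)) \<and>
     (\<forall>f\<in>D. \<forall>c. (\<lambda>x. c * f x) \<in> D \<and> (AE x in M. L (\<lambda>x. c * f x) x = c * L f x)) \<and>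
     (\<forall>f\<in>D. \<forall>f'\<in>borel_measurable M. (AE x in M. f' x = f x) \<longrightarrow>
        f' \<in> D \<and> (AE x in M. L f' x = L f x))"

definition dense_in_L2 :: "'a measure \<Rightarrow> ('a \<Rightarrow> complex) set \<Rightarrow> bool" where
  "dense_in_L2 M D \<longleftrightarrow> (\<forall>f\<in>L2 M. \<forall>e>0. \<exists>g\<in>D. L2_norm M (\<lambda>x. f x - g x) < e)"

text \<open>The left-hand side of the last equivalence says that \<open>g\<close> lies in the domain of the adjoint of
  \<open>L\<close> and that the adjoint maps \<open>g\<close> to \<open>u\<close>.\<close>

definition self_adjoint ::
    "'a measure \<Rightarrow> ('a \<Rightarrow> complex) set \<Rightarrow> (('a \<Rightarrow> complex) \<Rightarrow> ('a \<Rightarrow> complex)) \<Rightarrow> bool" where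
  "self_adjoint M D L \<longleftrightarrow>
     L2_operator M D L \<and> dense_in_L2 M D \<and>
     (\<forall>g\<in>L2 M. \<forall>u\<in>L2 M.
        (\<forall>f\<in>D. L2_inner M (L f) g = L2_inner M f u) \<longleftrightarrow> (g \<in> D \<and> (AE x in M. u x = L g x)))"

definition nonnegative_operator ::
    "'a measure \<Rightarrow> ('a \<Rightarrow> complex) set \<Rightarrow> (('a \<Rightarrow> complex) \<Rightarrow> ('a \<Rightarrow> complex)) \<Rightarrow> bool" where
  "nonnegative_operator M D L \<longleftrightarrow> (\<forall>f\<in>D. 0 \<le> Re (L2_inner M (L f) f))"

text \<open>\<open>T t = exp (- t L)\<close> for \<open>t > 0\<close>: the operators \<open>T t\<close> form the strongly continuous
  semigroup of bounded operators on \<open>L\<^sup>2\<close> whose generator is \<open>- L\<close>, with equality of domains.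
  The operator at \<open>t = 0\<close> is the identity and is left implicit.\<close>

definition exp_semigroup ::
    "'a measure \<Rightarrow> ('a \<Rightarrow> complex) set \<Rightarrow> (('a \<Rightarrow> complex) \<Rightarrow> ('a \<Rightarrow> complex)) \<Rightarrow>
     (real \<Rightarrow> ('a \<Rightarrow> complex) \<Rightarrow> ('a \<Rightarrow> complex)) \<Rightarrow> bool" where
  "exp_semigroup M D L T \<longleftrightarrow>
     (\<forall>t>0. L2_operator M (L2 M) (T t) \<and>
            (\<exists>K. \<forall>f\<in>L2 M. L2_norm M (T t f) \<le> K * L2_norm M f)) \<and>
     (\<forall>s>0. \<forall>t>0. \<forall>f\<in>L2 M. AE x in M. T (s + t) f x = T s (T t f) x) \<and>
     (\<forall>f\<in>L2 M. ((\<lambda>t. L2_norm M (\<lambda>x. T t f x - f x)) \<longlongrightarrow> 0) (at_right 0)) \<and>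
     (\<forall>f\<in>L2 M. \<forall>u\<in>L2 M.
        (f \<in> D \<and> (AE x in M. u x = L f x)) \<longleftrightarrow>
        ((\<lambda>t. L2_norm M (\<lambda>x. (T t f x - f x) / of_real t - (- u x))) \<longlongrightarrow> 0) (at_right 0))"

definition kernel_op ::
    "'a measure \<Rightarrow> ('a \<Rightarrow> 'a \<Rightarrow> real) \<Rightarrow> ('a \<Rightarrow> 'b::{banach,second_countable_topology}) \<Rightarrow> 'a \<Rightarrow> 'b"
  where
  "kernel_op M k f x = (LINT y|M. k x y *\<^sub>R f y)"

definition has_integral_kernel ::
    "'a measure \<Rightarrow> (('a \<Rightarrow> complex) \<Rightarrow> ('a \<Rightarrow> complex)) \<Rightarrow> ('a \<Rightarrow> 'a \<Rightarrow> real) \<Rightarrow> bool" where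
  "has_integral_kernel M S k \<longleftrightarrow>
     (\<lambda>(x, y). k x y) \<in> borel_measurable (M \<Otimes>\<^sub>M M) \<and>
     (\<forall>f\<in>L2 M. AE x in M. S f x = kernel_op M k f x)"


section \<open>The atomic Hardy space\<close>

definition atom :: "'a::metric_space measure \<Rightarrow> ('a \<Rightarrow> real) \<Rightarrow> ('a \<Rightarrow> complex) \<Rightarrow> bool" where
  "atom M h a \<longleftrightarrow>
     a \<in> borel_measurable M \<and>
     (\<exists>z r. 0 < r \<and>
        (AE x in M. x \<notin> ball z r \<longrightarrow> a x = 0) \<and>
        integrable M (\<lambda>x. (norm (a x))\<^sup>2 / h x) \<and>
        sqrt (LINT x|M. (norm (a x))\<^sup>2 / h x) \<le> measure (weighted M h) (ball z r) powr (- 1 / 2)) \<and>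
     has_bochner_integral M (\<lambda>x. a x * of_real (h x)) 0"

definition atomic_representation ::
    "'a::metric_space measure \<Rightarrow> ('a \<Rightarrow> real) \<Rightarrow> ('a \<Rightarrow> complex) \<Rightarrow>
     (nat \<Rightarrow> complex) \<Rightarrow> (nat \<Rightarrow> 'a \<Rightarrow> complex) \<Rightarrow> bool" where
  "atomic_representation M h f lam a \<longleftrightarrow>
     integrable M f \<and> (\<forall>k. atom M h (a k)) \<and> summable (\<lambda>k. norm (lam k)) \<and>
     ((\<lambda>n. \<integral>\<^sup>+x. ennreal (norm (f x - (\<Sum>k<n. lam k * a k x))) \<partial>M) \<longlonglongrightarrow> 0) \<and>
     (AE x in M. (\<lambda>k. lam k * a k x) sums f x)"

definition H1_at :: "'a::metric_space measure \<Rightarrow> ('a \<Rightarrow> real) \<Rightarrow> ('a \<Rightarrow> complex) set" where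
  "H1_at M h = {f. \<exists>lam a. atomic_representation M h f lam a}"

definition H1_norm :: "'a::metric_space measure \<Rightarrow> ('a \<Rightarrow> real) \<Rightarrow> ('a \<Rightarrow> complex) \<Rightarrow> real" where
  "H1_norm M h f = Inf {(\<Sum>k. norm (lam k)) | lam a. atomic_representation M h f lam a}"

definition finite_atomic :: "'a::metric_space measure \<Rightarrow> ('a \<Rightarrow> real) \<Rightarrow> ('a \<Rightarrow> complex) set" where
  "finite_atomic M h =
     {(\<lambda>x. \<Sum>k<n. lam k * a k x) | (n::nat) lam a. \<forall>k<n. atom M h (a k)}"

text \<open>Only the values of a functional on \<open>H1_at M h\<close> matter. Boundedness makes it invariant under
  changes on null sets, since a function vanishing almost everywhere has norm \<open>0\<close>.\<close>

definition H1_functional ::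
    "'a::metric_space measure \<Rightarrow> ('a \<Rightarrow> real) \<Rightarrow> (('a \<Rightarrow> complex) \<Rightarrow> complex) \<Rightarrow> bool" where
  "H1_functional M h l \<longleftrightarrow>
     (\<forall>f\<in>H1_at M h. \<forall>g\<in>H1_at M h. l (\<lambda>x. f x + g x) = l f + l g) \<and>
     (\<forall>f\<in>H1_at M h. \<forall>c. l (\<lambda>x. c * f x) = c * l f) \<and>
     (\<exists>K. \<forall>f\<in>H1_at M h. norm (l f) \<le> K * H1_norm M h f)"

definition H1_functional_norm ::
    "'a::metric_space measure \<Rightarrow> ('a \<Rightarrow> real) \<Rightarrow> (('a \<Rightarrow> complex) \<Rightarrow> complex) \<Rightarrow> real" where
  "H1_functional_norm M h l = Sup {norm (l f) | f. f \<in> H1_at M h \<and> H1_norm M h f \<le> 1}"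


section \<open>The space BMO and duality\<close>

definition ennsqrt :: "ennreal \<Rightarrow> ennreal" where
  "ennsqrt s = (if s = \<infinity> then \<infinity> else ennreal (sqrt (enn2real s)))"

definition bmo_norm :: "'a::metric_space measure \<Rightarrow> ('a \<Rightarrow> real) \<Rightarrow> ('a \<Rightarrow> complex) \<Rightarrow> ennreal" where
  "bmo_norm M h g =
     (SUP (z, r) \<in> UNIV \<times> {0<..}. INF c.
        ennsqrt ((\<integral>\<^sup>+x\<in>ball z r. ennreal ((norm (g x - c * of_real (h x)))\<^sup>2 * h x) \<partial>M)
                 / emeasure (weighted M h) (ball z r)))"

definition BMO :: "'a::metric_space measure \<Rightarrow> ('a \<Rightarrow> real) \<Rightarrow> ('a \<Rightarrow> complex) set" where
  "BMO M h = {g \<in> borel_measurable M. bmo_norm M h g < \<infinity>}"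

definition represents ::
    "'a::metric_space measure \<Rightarrow> ('a \<Rightarrow> real) \<Rightarrow> ('a \<Rightarrow> complex) \<Rightarrow>
     (('a \<Rightarrow> complex) \<Rightarrow> complex) \<Rightarrow> bool" where
  "represents M h g l \<longleftrightarrow>
     (\<forall>f\<in>finite_atomic M h. has_bochner_integral M (\<lambda>x. f x * g x) (l f))"

text \<open>Elements of \<open>BMO M h\<close> are representatives of classes modulo multiples of \<open>h\<close>, so the
  representing element of a functional is unique up to adding \<open>c * h\<close>.\<close>

definition BMO_is_dual_of_H1 :: "'a::metric_space measure \<Rightarrow> ('a \<Rightarrow> real) \<Rightarrow> bool" where
  "BMO_is_dual_of_H1 M h \<longleftrightarrow>
     (\<exists>C>0.
        (\<forall>g\<in>BMO M h. \<exists>l. H1_functional M h l \<and> represents M h g l \<and>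
            H1_functional_norm M h l \<le> C * enn2real (bmo_norm M h g)) \<and>
        (\<forall>l. H1_functional M h l \<longrightarrow>
            (\<exists>g\<in>BMO M h. represents M h g l \<and>
               enn2real (bmo_norm M h g) \<le> C * H1_functional_norm M h l \<and>
               (\<forall>g'\<in>BMO M h. represents M h g' l \<longrightarrow>
                  (\<exists>c. AE x in M. g' x = g x + c * of_real (h x))))))"

end

theory Submission
  imports Defs
begin

text \<open>Write \<open>\<nu> = h\<^sup>2 \<mu>\<close>, \<open>\<sigma> = h \<mu>\<close> and \<open>K(B) = sup\<^sub>B h\<close>. On the diagonal, the upper
bound of the kernel with respect to \<open>\<mu>\<close> and the lower bound with respect to \<open>\<nu>\<close> combine to
\<open>h(x)\<^sup>2 \<mu>(B(x,r)) \<le> C \<nu>(B(x,r))\<close>. As \<open>\<nu>\<close> is doubling, \<open>K(B)\<^sup>2\<close> is at most a constant times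
the \<open>\<mu>\<close>-average of \<open>h\<^sup>2\<close> over \<open>B\<close>: the function \<open>h\<^sup>2\<close> satisfies the reverse Hoelder inequality with
exponent infinity (\<open>reverse_holder_weight_of_kernel_bounds\<close>). It follows that the numbers
\<open>K(B)\<^sup>2 \<mu>(B)\<close>, \<open>K(B) \<sigma>(B)\<close> and \<open>\<nu>(B)\<close> are comparable, that \<open>\<sigma>\<close> is doubling, and that \<open>1/h\<close>
is an \<open>A\<^sub>1\<close> weight for \<open>\<nu>\<close>. The exponent is \<open>p\<^sub>0 = 2\<close>. The duality follows from
the reverse Hoelder inequality and the two doubling properties.

On a single ball \<open>B\<close> the duality is that of a Hilbert space. The atoms are the functions \<open>h v\<close> with
\<open>v\<close> in the unit ball, up to normalisation, of the orthogonal complement of \<open>h\<close> in \<open>L\<^sup>2(\<sigma>|B)\<close>; pairing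
with \<open>g\<close> is the inner product of \<open>v\<close> and \<open>cnj g\<close>; and the condition that defines \<open>BMO\<close> bounds the distance
of \<open>g\<close> from the line spanned by \<open>h\<close>. Hence a bounded functional yields a function \<open>g\<close> on each
ball by the Riesz representation theorem, uniquely up to a multiple of \<open>h\<close>, and these functions can
be glued once the multiples are normalised (\<open>functional_BMO\<close>). Both norm inequalities hold with
constant \<open>1\<close>.

The converse is delicate because an infinite atomic series converges only in \<open>L\<^sup>1(\<mu>)\<close>, while \<open>g\<close> is
unbounded: it has to be shown that \<open>\<Sum>\<^sub>k \<lambda>\<^sub>k \<integral> a\<^sub>k g\<close> depends only on the sum \<open>f\<close> of the series.
For a bounded function \<open>u\<close> in place of \<open>g\<close> the sum is \<open>\<integral> f u\<close>. So \<open>g\<close> is approximated by bounded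
functions \<open>u\<^sub>j\<close> of uniformly bounded \<open>BMO\<close> norm with \<open>\<integral> a u\<^sub>j \<rightarrow> \<integral> a g\<close> for every atom
(\<open>bounded_approximation\<close>), and dominated convergence for series gives
\<open>\<Sum>\<^sub>k \<lambda>\<^sub>k \<integral> a\<^sub>k g = lim\<^sub>j \<integral> f u\<^sub>j\<close> (\<open>functional_of_osc_le\<close>). To obtain \<open>u\<^sub>j\<close>, project \<open>g/h\<close> radially
to the disc of radius \<open>j\<close>, multiply by \<open>h\<close>, subtract the multiple of \<open>h\<close> that is optimal on a large ball, and multiply by a
Lipschitz cutoff at the scale \<open>R\<close> of that ball. The result is bounded because \<open>h\<close> is bounded on balls. The cutoff
increases the \<open>BMO\<close> norm by a constant factor only, since the optimal multiples on \<open>B\<close> of radius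
\<open>r \<le> R\<close> and on the large ball differ by at most \<open>C (R/r) / K(B)\<close> (\<open>const_diff_concentric\<close>), which the
oscillation \<open>r/R\<close> of the cutoff on \<open>B\<close> compensates.\<close>

section \<open>Riesz representation on closed subspaces of square-integrable functions\<close>

lemma L2_D:
  assumes "f \<in> L2 M"
  shows "f \<in> borel_measurable M" "integrable M (\<lambda>x. (norm (f x))\<^sup>2)"
  using assms by (auto simp: L2_def)

lemma norm_add_power2_le: "(norm (a + b))\<^sup>2 \<le> 2 * (norm a)\<^sup>2 + 2 * (norm b)\<^sup>2"
  for a b :: "'b::real_normed_vector"
proof -
  have "(norm (a + b))\<^sup>2 \<le> (norm a + norm b)\<^sup>2"
    by (simp add: norm_triangle_ineq power_mono)
  also have "\<dots> \<le> 2 * (norm a)\<^sup>2 + 2 * (norm b)\<^sup>2"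
    using zero_le_power2[of "norm a - norm b"] by (simp add: power2_sum power2_diff)
  finally show ?thesis .
qed

lemma L2_add:
  assumes "f \<in> L2 M" "g \<in> L2 M"
  shows "(\<lambda>x. f x + g x) \<in> L2 M"
proof -
  have [measurable]: "f \<in> borel_measurable M" "g \<in> borel_measurable M"
    using assms by (auto simp: L2_def)
  have "integrable M (\<lambda>x. (norm (f x + g x))\<^sup>2)"
  proof (rule Bochner_Integration.integrable_bound)
    show "integrable M (\<lambda>x. 2 * (norm (f x))\<^sup>2 + 2 * (norm (g x))\<^sup>2)"
      using assms by (auto simp: L2_def)
  qed (auto simp: norm_add_power2_le)
  then show ?thesis by (simp add: L2_def)
qed

lemma L2_scale:
  assumes "f \<in> L2 M"
  shows "(\<lambda>x. c * f x) \<in> L2 M"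
  using assms by (auto simp: L2_def norm_mult power_mult_distrib)

lemma L2_diff:
  assumes "f \<in> L2 M" "g \<in> L2 M"
  shows "(\<lambda>x. f x - g x) \<in> L2 M"
  using L2_add[OF assms(1) L2_scale[OF assms(2), of "-1"]] by simp

lemma integrable_mult_L2:
  assumes "f \<in> L2 M" "g \<in> L2 M"
  shows "integrable M (\<lambda>x. f x * g x)"
proof (rule Bochner_Integration.integrable_bound)
  have [measurable]: "f \<in> borel_measurable M" "g \<in> borel_measurable M"
    using assms by (auto simp: L2_def)
  show "(\<lambda>x. f x * g x) \<in> borel_measurable M" by measurable
  show "integrable M (\<lambda>x. (norm (f x))\<^sup>2 + (norm (g x))\<^sup>2)"
    using assms by (auto simp: L2_def)
  have "norm (f x * g x) \<le> (norm (f x))\<^sup>2 + (norm (g x))\<^sup>2" for x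
    using zero_le_power2[of "norm (f x) - norm (g x)"]
      mult_nonneg_nonneg[OF norm_ge_zero[of "f x"] norm_ge_zero[of "g x"]]
    unfolding norm_mult power2_diff by linarith
  then show "AE x in M. norm (f x * g x) \<le> norm ((norm (f x))\<^sup>2 + (norm (g x))\<^sup>2)"
    by (auto intro!: AE_I2 order_trans[OF _ abs_ge_self])
qed

lemma L2_cnj: "f \<in> L2 M \<Longrightarrow> (\<lambda>x. cnj (f x)) \<in> L2 M"
  by (auto simp: L2_def intro: borel_measurable_continuous_on[of cnj] continuous_intros)

lemma young_ineq:
  fixes a b s :: real
  assumes "0 < s"
  shows "a * b \<le> s / 2 * a\<^sup>2 + b\<^sup>2 / (2 * s)"
proof -
  have "0 \<le> (s * a - b)\<^sup>2 / (2 * s)" using assms by simp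
  also have "\<dots> = s / 2 * a\<^sup>2 + b\<^sup>2 / (2 * s) - a * b"
    using assms by (simp add: power2_diff field_simps power2_eq_square)
  finally show ?thesis by simp
qed

lemma norm_L2_inner_le:
  assumes "f \<in> L2 M" "g \<in> L2 M" "0 < s"
  shows "norm (L2_inner M f g)
    \<le> s / 2 * (LINT x|M. (norm (f x))\<^sup>2) + (LINT x|M. (norm (g x))\<^sup>2) / (2 * s)"
proof -
  note int = L2_D(2)[OF assms(1)] L2_D(2)[OF assms(2)]
  have "norm (L2_inner M f g) \<le> (LINT x|M. norm (f x * cnj (g x)))"
    unfolding L2_inner_def by simp
  also have "\<dots> \<le> (LINT x|M. s / 2 * (norm (f x))\<^sup>2 + (norm (g x))\<^sup>2 / (2 * s))"
  proof (rule integral_mono)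
    show "integrable M (\<lambda>x. norm (f x * cnj (g x)))"
      using integrable_mult_L2[OF assms(1) L2_cnj[OF assms(2)]] by simp
    show "norm (f x * cnj (g x)) \<le> s / 2 * (norm (f x))\<^sup>2 + (norm (g x))\<^sup>2 / (2 * s)" for x
      using young_ineq[OF assms(3), of "norm (f x)" "norm (g x)"] by (simp add: norm_mult)
  qed (use int in auto)
  also have "\<dots> = s / 2 * (LINT x|M. (norm (f x))\<^sup>2) + (LINT x|M. (norm (g x))\<^sup>2) / (2 * s)"
    using int by simp
  finally show ?thesis .
qed

text \<open>The series of increments converges almost everywhere: \<open>\<Sum>\<^sub>n 2\<^sup>n |b\<^sub>n\<^sub>+\<^sub>1 - b\<^sub>n|\<^sup>2\<close> is integrable, and
\<open>t \<le> 2\<^sup>-\<^sup>n + 2\<^sup>n t\<^sup>2\<close>. Fatou's lemma turns the pointwise limit into a limit in norm.\<close>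

lemma L2_complete:
  assumes b: "\<And>n. b n \<in> L2 M"
    and cauchy: "\<And>m n. n \<le> m \<Longrightarrow> (LINT x|M. (norm (b m x - b n x))\<^sup>2) \<le> (1/4) ^ n"
  shows "\<exists>u\<in>L2 M. \<forall>n. (LINT x|M. (norm (u x - b n x))\<^sup>2) \<le> (1/4) ^ n"
proof -
  have [measurable]: "b n \<in> borel_measurable M" for n using b[of n] by (simp add: L2_def)
  have intd: "integrable M (\<lambda>x. (norm (b m x - b n x))\<^sup>2)" for m n
    using L2_diff[OF b b] by (simp add: L2_def)
  have nn: "(\<integral>\<^sup>+x. ennreal ((norm (b m x - b n x))\<^sup>2) \<partial>M) \<le> ennreal ((1/4) ^ n)" if "n \<le> m" for m n
    using cauchy[OF that] nn_integral_eq_integral[OF intd[of m n]] by simp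
  \<comment> \<open>The factor \<open>2 ^ n\<close> is small enough for the integrals, at most \<open>(1/2) ^ n\<close>, to be summable,
    and large enough to control the first power of the increments.\<close>
  define d where "d n x = 2 ^ n * (norm (b (Suc n) x - b n x))\<^sup>2" for n x
  have [measurable]: "d n \<in> borel_measurable M" for n unfolding d_def by measurable
  have "(\<integral>\<^sup>+x. (\<Sum>n. ennreal (d n x)) \<partial>M) = (\<Sum>n. \<integral>\<^sup>+x. ennreal (d n x) \<partial>M)"
    by (rule nn_integral_suminf) simp
  also have "\<dots> \<le> (\<Sum>n. ennreal ((1/2) ^ n))"
  proof (rule suminf_le)
    fix n
    have "(\<integral>\<^sup>+x. ennreal (d n x) \<partial>M)
        = ennreal (2 ^ n) * (\<integral>\<^sup>+x. ennreal ((norm (b (Suc n) x - b n x))\<^sup>2) \<partial>M)"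
      unfolding d_def by (subst nn_integral_cmult[symmetric]) (auto simp: ennreal_mult)
    also have "\<dots> \<le> ennreal (2 ^ n) * ennreal ((1/4) ^ n)"
      by (intro mult_left_mono nn) auto
    also have "\<dots> = ennreal ((1/2) ^ n)"
      by (simp add: ennreal_mult[symmetric] power_mult_distrib[symmetric])
    finally show "(\<integral>\<^sup>+x. ennreal (d n x) \<partial>M) \<le> ennreal ((1/2) ^ n)" .
  qed auto
  also have "\<dots> < \<infinity>"
    by (subst suminf_ennreal2) (auto simp: summable_geometric)
  finally have "AE x in M. (\<Sum>n. ennreal (d n x)) \<noteq> \<infinity>"
    by (intro nn_integral_PInf_AE) auto
  then have conv: "AE x in M. convergent (\<lambda>n. b n x)"
  proof (rule AE_mp, intro AE_I2 impI)
    fix x assume "(\<Sum>n. ennreal (d n x)) \<noteq> \<infinity>"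
    then have "summable (\<lambda>n. d n x)"
      by (intro summable_suminf_not_top) (auto simp: d_def)
    then have "summable (\<lambda>n. (1/2) ^ n + d n x)"
      by (intro summable_add summable_geometric) auto
    then have "summable (\<lambda>n. b (Suc n) x - b n x)"
    proof (rule summable_comparison_test[rotated], intro exI allI impI)
      fix n :: nat
      let ?t = "norm (b (Suc n) x - b n x)"
      have "?t * 1 \<le> 2 * 2 ^ n / 2 * ?t\<^sup>2 + 1\<^sup>2 / (2 * (2 * 2 ^ n))"
        by (rule young_ineq) simp
      also have "\<dots> \<le> (1/2) ^ n + d n x"
        by (simp add: d_def power_divide field_simps)
      finally show "?t \<le> (1/2) ^ n + d n x" by simp
    qed
    then have "convergent (\<lambda>n. \<Sum>k<n. b (Suc k) x - b k x)"
      by (simp add: summable_iff_convergent)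
    moreover have "(\<Sum>k<n. b (Suc k) x - b k x) = b n x - b 0 x" for n
      by (induction n) auto
    ultimately have "convergent (\<lambda>n. b n x - b 0 x)" by simp
    then show "convergent (\<lambda>n. b n x)"
      using convergent_add[OF _ convergent_const[of "b 0 x"]] by fastforce
  qed
  define u where "u x = lim (\<lambda>n. b n x)" for x
  have [measurable]: "u \<in> borel_measurable M"
    unfolding u_def by (rule borel_measurable_lim_metric) simp
  have fatou: "(\<integral>\<^sup>+x. ennreal ((norm (u x - b n x))\<^sup>2) \<partial>M) \<le> ennreal ((1/4) ^ n)" for n
  proof -
    have "(\<integral>\<^sup>+x. ennreal ((norm (u x - b n x))\<^sup>2) \<partial>M)
        = (\<integral>\<^sup>+x. liminf (\<lambda>m. ennreal ((norm (b m x - b n x))\<^sup>2)) \<partial>M)"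
    proof (rule nn_integral_cong_AE, rule AE_mp[OF conv], intro AE_I2 impI)
      fix x assume "convergent (\<lambda>n. b n x)"
      then have "(\<lambda>n. b n x) \<longlonglongrightarrow> u x" by (simp add: u_def convergent_LIMSEQ_iff)
      then have "(\<lambda>m. ennreal ((norm (b m x - b n x))\<^sup>2)) \<longlonglongrightarrow> ennreal ((norm (u x - b n x))\<^sup>2)"
        by (intro tendsto_ennrealI tendsto_intros)
      then show "ennreal ((norm (u x - b n x))\<^sup>2)
          = liminf (\<lambda>m. ennreal ((norm (b m x - b n x))\<^sup>2))"
        by (rule lim_imp_Liminf[symmetric, rotated]) simp
    qed
    also have "\<dots> \<le> liminf (\<lambda>m. \<integral>\<^sup>+x. ennreal ((norm (b m x - b n x))\<^sup>2) \<partial>M)"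
      by (rule nn_integral_liminf) simp
    also have "\<dots> \<le> liminf (\<lambda>m. ennreal ((1/4) ^ n))"
      by (intro Liminf_mono eventually_sequentiallyI[of n] nn)
    also have "\<dots> = ennreal ((1/4) ^ n)" by (simp add: Liminf_const)
    finally show ?thesis .
  qed
  have ub: "integrable M (\<lambda>x. (norm (u x - b n x))\<^sup>2)" for n
    using fatou[of n] by (intro integrableI_bounded) (auto simp: le_less_trans)
  then have "(\<lambda>x. u x - b 0 x) \<in> L2 M" by (simp add: L2_def)
  from L2_add[OF this b[of 0]] have "u \<in> L2 M" by simp
  moreover have "(LINT x|M. (norm (u x - b n x))\<^sup>2) \<le> (1/4) ^ n" for n
    using fatou[of n] nn_integral_eq_integral[OF ub[of n]] by simp
  ultimately show ?thesis by blast
qed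

lemma L2_expand:
  assumes "f \<in> L2 M" "g \<in> L2 M"
  shows "(LINT x|M. (norm (f x + t * g x))\<^sup>2)
    = (LINT x|M. (norm (f x))\<^sup>2) + 2 * Re (t * L2_inner M g f) + (norm t)\<^sup>2 * (LINT x|M. (norm (g x))\<^sup>2)"
proof -
  note int = L2_D(2)[OF assms(1)] L2_D(2)[OF assms(2)]
    and gf = integrable_mult_L2[OF assms(2) L2_cnj[OF assms(1)]]
  have *: "(norm (f x + t * g x))\<^sup>2
      = (norm (f x))\<^sup>2 + 2 * Re (t * (g x * cnj (f x))) + (norm t)\<^sup>2 * (norm (g x))\<^sup>2" for x
    by (simp only: cmod_power2 plus_complex.simps times_complex.simps complex_cnj)
      (simp add: power2_eq_square algebra_simps)
  have "(LINT x|M. Re (t * (g x * cnj (f x)))) = Re (LINT x|M. t * (g x * cnj (f x)))"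
    using gf by (intro integral_Re) auto
  also have "\<dots> = Re (t * L2_inner M g f)" by (simp add: L2_inner_def)
  finally have re: "(LINT x|M. Re (t * (g x * cnj (f x)))) = Re (t * L2_inner M g f)" .
  have int_re: "integrable M (\<lambda>x. Re (t * (g x * cnj (f x))))"
    using gf by (intro integrable_Re) auto
  define R where "R x = Re (t * (g x * cnj (f x)))" for x
  have "(LINT x|M. (norm (f x))\<^sup>2 + 2 * R x + (norm t)\<^sup>2 * (norm (g x))\<^sup>2)
      = (LINT x|M. (norm (f x))\<^sup>2) + 2 * (LINT x|M. R x) + (norm t)\<^sup>2 * (LINT x|M. (norm (g x))\<^sup>2)"
    using int int_re[folded R_def] by simp
  then show ?thesis
    unfolding * R_def re .
qed

text \<open>The representing element maximises \<open>2 Re (F v) - \<parallel>v\<parallel>\<^sup>2\<close> over \<open>V\<close>. Near-maximisers form a Cauchy sequence,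
and the first-order condition, which holds up to a small error at each of them, passes to the limit.\<close>

lemma riesz_L2:
  fixes F :: "('a \<Rightarrow> complex) \<Rightarrow> complex"
  assumes sub: "V \<subseteq> L2 M" and zero: "(\<lambda>x. 0) \<in> V"
    and add: "\<And>v w. v \<in> V \<Longrightarrow> w \<in> V \<Longrightarrow> (\<lambda>x. v x + w x) \<in> V"
    and scale: "\<And>v c. v \<in> V \<Longrightarrow> (\<lambda>x. c * v x) \<in> V"
    and closed: "\<And>u b. u \<in> L2 M \<Longrightarrow> (\<And>n. b n \<in> V) \<Longrightarrow>
        (\<And>n. (LINT x|M. (norm (u x - b n x))\<^sup>2) \<le> (1/4) ^ n) \<Longrightarrow> u \<in> V"
    and F_add: "\<And>v w. v \<in> V \<Longrightarrow> w \<in> V \<Longrightarrow> F (\<lambda>x. v x + w x) = F v + F w"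
    and F_scale: "\<And>v c. v \<in> V \<Longrightarrow> F (\<lambda>x. c * v x) = c * F v"
    and bound: "\<And>v. v \<in> V \<Longrightarrow> (norm (F v))\<^sup>2 \<le> B\<^sup>2 * (LINT x|M. (norm (v x))\<^sup>2)"
  shows "\<exists>u\<in>V. \<forall>v\<in>V. F v = L2_inner M v u"
proof -
  define q where "q v = (LINT x|M. (norm (v x))\<^sup>2)" for v :: "'a \<Rightarrow> complex"
  define \<Phi> where "\<Phi> v = 2 * Re (F v) - q v" for v
  have q_nonneg: "0 \<le> q v" for v by (simp add: q_def)
  have inL2: "v \<in> L2 M" if "v \<in> V" for v using that sub by auto
  have expand: "\<Phi> (\<lambda>x. v x + t * w x)
      = \<Phi> v + 2 * Re (t * (F w - L2_inner M w v)) - (norm t)\<^sup>2 * q w" if "v \<in> V" "w \<in> V" for v w t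
    using F_add[OF that(1) scale[OF that(2)], of t] F_scale[OF that(2), of t]
      L2_expand[OF inL2[OF that(1)] inL2[OF that(2)], of t]
    by (simp add: \<Phi>_def q_def algebra_simps)
  have upper: "\<Phi> v \<le> B\<^sup>2 + 1" if "v \<in> V" for v
  proof -
    have F2: "(norm (F v))\<^sup>2 \<le> B\<^sup>2 * q v" using bound[OF that] by (simp add: q_def)
    define P where "P = B\<^sup>2 + 1"
    have pos: "0 < P" by (simp add: P_def add_nonneg_pos)
    have "2 * Re (F v) \<le> 2 * (1 * norm (F v))" using complex_Re_le_cmod[of "F v"] by simp
    also have "\<dots> \<le> 2 * (P / 2 * 1\<^sup>2 + (norm (F v))\<^sup>2 / (2 * P))"
      by (intro mult_left_mono young_ineq pos) simp
    also have "\<dots> = P + (norm (F v))\<^sup>2 / P" using pos by (simp add: field_simps)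
    finally have "2 * Re (F v) \<le> P + (norm (F v))\<^sup>2 / P" .
    moreover have "(norm (F v))\<^sup>2 / P \<le> q v"
      using F2 q_nonneg[of v] pos by (simp add: P_def field_simps)
    ultimately show ?thesis by (simp add: \<Phi>_def P_def)
  qed
  define S where "S = Sup (\<Phi> ` V)"
  have bdd: "bdd_above (\<Phi> ` V)" using upper by (auto simp: bdd_above_def)
  have le_S: "\<Phi> v \<le> S" if "v \<in> V" for v
    unfolding S_def using bdd that by (simp add: cSup_upper)
  have "\<exists>v\<in>V. S - (1/4) ^ n / 4 < \<Phi> v" for n
    using less_cSupD[of "\<Phi> ` V" "S - (1/4) ^ n / 4"] zero by (auto simp: S_def)
  then obtain b where bV: "\<And>n. b n \<in> V" and bS: "\<And>n. S - (1/4) ^ n / 4 < \<Phi> (b n)" by metis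
  \<comment> \<open>Near-maximisers are close to each other, because the functional is uniformly concave.\<close>
  have close: "q (\<lambda>x. b m x - b n x) \<le> (1/4) ^ n" if "n \<le> m" for m n
  proof -
    \<comment> \<open>Compare the values at \<open>b n\<close>, at \<open>b m\<close> and at their midpoint, where the value is at most \<open>S\<close>.\<close>
    let ?w = "\<lambda>x. b m x + (-1) * b n x"
    have wV: "?w \<in> V" by (intro add bV scale)
    have 1: "\<Phi> (\<lambda>x. b n x + 1 * ?w x)
        = \<Phi> (b n) + 2 * Re (1 * (F ?w - L2_inner M ?w (b n))) - (norm (1::complex))\<^sup>2 * q ?w"
      by (rule expand[OF bV wV])
    have 2: "\<Phi> (\<lambda>x. b n x + (1/2) * ?w x)
        = \<Phi> (b n) + 2 * Re ((1/2) * (F ?w - L2_inner M ?w (b n))) - (norm (1/2::complex))\<^sup>2 * q ?w"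
      by (rule expand[OF bV wV])
    have 3: "\<Phi> (\<lambda>x. b n x + (1/2) * ?w x) \<le> S" by (intro le_S add bV scale wV)
    define X where "X = Re (F ?w - L2_inner M ?w (b n))"
    have "\<Phi> (b m) = \<Phi> (b n) + 2 * X - q ?w" using 1 by (simp add: X_def)
    moreover have "\<Phi> (b n) + X - q ?w / 4 \<le> S"
      using 2 3 by (simp add: X_def power2_eq_square diff_divide_distrib)
    moreover have "(1/4::real) ^ m \<le> (1/4) ^ n" using that by (simp add: power_decreasing)
    ultimately have "q ?w \<le> (1/4) ^ n" using bS[of n] bS[of m] by linarith
    then show ?thesis by simp
  qed
  obtain u where uL2: "u \<in> L2 M" and ub: "\<And>n. q (\<lambda>x. u x - b n x) \<le> (1/4) ^ n"
    using L2_complete[of b M] close inL2[OF bV] unfolding q_def by blast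
  have uV: "u \<in> V" using closed[OF uL2, of b] bV ub by (simp add: q_def)
  have "F v = L2_inner M v u" if vV: "v \<in> V" for v
  proof -
    have est1: "norm (F v - L2_inner M v (b n)) \<le> (1/2) ^ n * (1 + q v)" for n
    proof -
      define w where "w = F v - L2_inner M v (b n)"
      \<comment> \<open>The phase of \<open>t\<close> makes \<open>t * w\<close> positive; its size balances the linear term, of order \<open>|t| |w|\<close>,
        against the defect of the near-maximiser, at most \<open>4\<^sup>-\<^sup>n\<close>, and the quadratic term.\<close>
      define t where "t = (1/2) ^ n * (if w = 0 then 0 else cnj w / norm w)"
      have "cnj w * w = of_real (norm w) * of_real (norm w)"
        using complex_norm_square[of w] by (simp add: power2_eq_square mult.commute)
      then have tw: "t * w = of_real ((1/2) ^ n * norm w)"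
        by (simp add: t_def mult.assoc)
      have nt: "norm t \<le> (1/2) ^ n" by (simp add: t_def norm_mult norm_divide norm_power)
      have "\<Phi> (b n) + 2 * Re (t * w) - (norm t)\<^sup>2 * q v \<le> S"
        using expand[OF bV vV, of n t] le_S[OF add[OF bV scale[OF vV]], of n t] by (simp add: w_def)
      then have "2 * ((1/2) ^ n * norm w) \<le> (1/4) ^ n / 4 + (norm t)\<^sup>2 * q v"
        using bS[of n] unfolding tw by simp
      also have "\<dots> \<le> (1/4) ^ n + ((1/2) ^ n)\<^sup>2 * q v"
        using nt q_nonneg[of v] by (intro add_mono mult_right_mono power_mono) auto
      also have "\<dots> = (1/2) ^ n * ((1/2) ^ n * (1 + q v))"
        by (simp add: power_mult_distrib[symmetric] power2_eq_square algebra_simps)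
      finally have "(1/2) ^ n * (2 * norm w) \<le> (1/2) ^ n * ((1/2) ^ n * (1 + q v))" by simp
      then have "2 * norm w \<le> (1/2) ^ n * (1 + q v)"
        by (subst (asm) mult_le_cancel_left_pos) auto
      then show ?thesis unfolding w_def using norm_ge_zero[of "F v - L2_inner M v (b n)"] by linarith
    qed
    have est2: "norm (L2_inner M v (b n) - L2_inner M v u) \<le> (1/2) ^ n * (1 + q v)" for n
    proof -
      have diff: "L2_inner M v u - L2_inner M v (b n) = L2_inner M v (\<lambda>x. u x - b n x)"
        unfolding L2_inner_def
        using integrable_mult_L2[OF inL2[OF vV] L2_cnj[OF uL2]]
          integrable_mult_L2[OF inL2[OF vV] L2_cnj[OF inL2[OF bV[of n]]]]
        by (simp add: right_diff_distrib)
      have "norm (L2_inner M v (\<lambda>x. u x - b n x))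
          \<le> (1/2) ^ n / 2 * q v + q (\<lambda>x. u x - b n x) / (2 * (1/2) ^ n)"
        unfolding q_def by (rule norm_L2_inner_le[OF inL2[OF vV] L2_diff[OF uL2 inL2[OF bV]]]) simp
      moreover have "q (\<lambda>x. u x - b n x) / (2 * (1/2) ^ n) \<le> (1/4) ^ n / (2 * (1/2) ^ n)"
        by (intro divide_right_mono ub) auto
      moreover have "(1/4::real) ^ n / (2 * (1/2) ^ n) = (1/2) ^ n / 2"
        by (simp add: power_divide[symmetric] field_simps power_mult_distrib[symmetric])
      moreover have "(0::real) \<le> (1/2) ^ n" "0 \<le> (1/2) ^ n * q v" using q_nonneg[of v] by auto
      ultimately have "norm (L2_inner M v (\<lambda>x. u x - b n x)) \<le> (1/2) ^ n + (1/2) ^ n * q v"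
        by linarith
      then show ?thesis by (simp add: diff[symmetric] norm_minus_commute distrib_left)
    qed
    have bnd: "norm (F v - L2_inner M v u) \<le> 2 * ((1/2) ^ n * (1 + q v))" for n
      using norm_triangle_ineq[of "F v - L2_inner M v (b n)" "L2_inner M v (b n) - L2_inner M v u"]
        est1[of n] est2[of n] by simp
    have "(\<lambda>n. 2 * ((1/2) ^ n * (1 + q v))) \<longlonglongrightarrow> 2 * (0 * (1 + q v))"
      by (intro tendsto_intros LIMSEQ_power_zero) auto
    from LIMSEQ_le_const[OF this] bnd have "norm (F v - L2_inner M v u) \<le> 2 * (0 * (1 + q v))"
      by blast
    then show ?thesis by simp
  qed
  with uV show ?thesis by blast
qed

text \<open>The case of interest: the subspace is the orthogonal complement of one function.\<close>

lemma riesz_L2_orthogonal: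
  fixes F :: "('a \<Rightarrow> complex) \<Rightarrow> complex"
  assumes w: "w \<in> L2 N"
    and F_add: "\<And>v v'. v \<in> L2 N \<Longrightarrow> L2_inner N v w = 0 \<Longrightarrow> v' \<in> L2 N \<Longrightarrow> L2_inner N v' w = 0 \<Longrightarrow>
        F (\<lambda>x. v x + v' x) = F v + F v'"
    and F_scale: "\<And>v c. v \<in> L2 N \<Longrightarrow> L2_inner N v w = 0 \<Longrightarrow> F (\<lambda>x. c * v x) = c * F v"
    and bound: "\<And>v. v \<in> L2 N \<Longrightarrow> L2_inner N v w = 0 \<Longrightarrow> (norm (F v))\<^sup>2 \<le> B\<^sup>2 * (LINT x|N. (norm (v x))\<^sup>2)"
  shows "\<exists>u\<in>L2 N. \<forall>v\<in>L2 N. L2_inner N v w = 0 \<longrightarrow> F v = L2_inner N v u"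
proof -
  define V where "V = {v \<in> L2 N. L2_inner N v w = 0}"
  have inner_int: "integrable N (\<lambda>x. v x * cnj (w x))" if "v \<in> L2 N" for v
    by (rule integrable_mult_L2[OF that L2_cnj[OF w]])
  have "\<exists>u\<in>V. \<forall>v\<in>V. F v = L2_inner N v u"
  proof (rule riesz_L2)
    show "V \<subseteq> L2 N" by (auto simp: V_def)
    show "(\<lambda>x. 0) \<in> V" by (simp add: V_def L2_def L2_inner_def)
    show "(\<lambda>x. v x + v' x) \<in> V" if "v \<in> V" "v' \<in> V" for v v'
      using that inner_int by (simp add: V_def L2_add L2_inner_def distrib_right)
    show "(\<lambda>x. c * v x) \<in> V" if "v \<in> V" for v c
      using that by (simp add: V_def L2_scale L2_inner_def mult.assoc)
    show "F (\<lambda>x. v x + v' x) = F v + F v'" if "v \<in> V" "v' \<in> V" for v v'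
      using that F_add by (simp add: V_def)
    show "F (\<lambda>x. c * v x) = c * F v" if "v \<in> V" for v c
      using that F_scale by (simp add: V_def)
    show "(norm (F v))\<^sup>2 \<le> B\<^sup>2 * (LINT x|N. (norm (v x))\<^sup>2)" if "v \<in> V" for v
      using that bound by (simp add: V_def)
    fix u b assume u: "u \<in> L2 N" and b: "\<And>n. b n \<in> V"
      and conv: "\<And>n. (LINT x|N. (norm (u x - b n x))\<^sup>2) \<le> (1/4) ^ n"
    define Q where "Q = (LINT x|N. (norm (w x))\<^sup>2)"
    have Q: "0 \<le> Q" by (simp add: Q_def)
    have le: "norm (L2_inner N u w) \<le> (1 + Q) * (1/2) ^ n" for n
    proof -
      have bn: "b n \<in> L2 N" "L2_inner N (b n) w = 0" using b[of n] by (auto simp: V_def)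
      have "L2_inner N (\<lambda>x. u x - b n x) w = L2_inner N u w"
        using inner_int[OF u] inner_int[OF bn(1)] bn(2) by (simp add: L2_inner_def left_diff_distrib)
      then have "norm (L2_inner N u w) \<le> 2 ^ n / 2 * (LINT x|N. (norm (u x - b n x))\<^sup>2) + Q / (2 * 2 ^ n)"
        using norm_L2_inner_le[OF L2_diff[OF u bn(1)] w, of "2 ^ n"] by (simp add: Q_def)
      also have "\<dots> \<le> 2 ^ n / 2 * (1/4) ^ n + Q / (2 * 2 ^ n)"
        using conv[of n] by (intro add_mono mult_left_mono) auto
      also have "2 ^ n / 2 * (1/4) ^ n = (1/2) ^ n / (2::real)"
        by (simp add: power_mult_distrib[symmetric])
      also have "(1/2) ^ n / 2 + Q / (2 * 2 ^ n) = (1 + Q) * (1/2) ^ n / 2"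
        by (simp add: power_divide add_divide_distrib distrib_right)
      also have "\<dots> \<le> (1 + Q) * (1/2) ^ n" using Q by simp
      finally show ?thesis .
    qed
    have "(\<lambda>n. (1 + Q) * (1/2) ^ n) \<longlonglongrightarrow> (1 + Q) * 0"
      by (intro tendsto_intros LIMSEQ_power_zero) auto
    from LIMSEQ_le_const[OF this] le have "norm (L2_inner N u w) \<le> (1 + Q) * 0" by blast
    then show "u \<in> V" using u by (simp add: V_def)
  qed
  then show ?thesis by (auto simp: V_def)
qed

section \<open>Weights satisfying a reverse Hoelder inequality\<close>

text \<open>The last condition is the reverse Hoelder inequality with exponent infinity for \<open>h\<^sup>2\<close>. It is stated for every point
rather than almost every point, so that suprema over balls can be used.\<close>

locale reverse_holder_weight =
  fixes M :: "'a::metric_space measure" and h :: "'a \<Rightarrow> real" and A D :: real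
  assumes sets_M: "sets M = sets borel"
    and h_meas [measurable]: "h \<in> borel_measurable M"
    and h_pos: "\<And>x. 0 < h x"
    and ball_finite: "\<And>z r. emeasure M (ball z r) < \<infinity>"
    and ball_pos: "\<And>z r. 0 < r \<Longrightarrow> 0 < measure M (ball z r)"
    and doubling_M: "\<And>z r. 0 < r \<Longrightarrow> measure M (ball z (2 * r)) \<le> D * measure M (ball z r)"
    and doubling_h2: "\<And>z r. 0 < r \<Longrightarrow>
      (LINT x:ball z (2 * r)|M. (h x)\<^sup>2) \<le> D * (LINT x:ball z r|M. (h x)\<^sup>2)"
    and h2_le_average: "\<And>z r x. x \<in> ball z r \<Longrightarrow>
      (h x)\<^sup>2 * measure M (ball z r) \<le> A * (LINT x:ball z r|M. (h x)\<^sup>2)"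
begin

lemma space_M: "space M = UNIV"
  using sets_eq_imp_space_eq[OF sets_M] by simp

lemma ball_meas [measurable, simp]: "ball z r \<in> sets M"
  by (simp add: sets_M)

text \<open>The powers \<open>0, 1, 2\<close> give the masses of \<open>\<mu>\<close>, \<open>\<sigma>\<close> and \<open>\<nu>\<close>; the power \<open>3\<close> gives the squared norm of \<open>h\<close>
in \<open>L\<^sup>2(\<sigma>)\<close>.\<close>

definition moment :: "nat \<Rightarrow> 'a \<Rightarrow> real \<Rightarrow> real" where
  "moment p z r = (LINT x:ball z r|M. h x ^ p)"

definition sup_ball :: "'a \<Rightarrow> real \<Rightarrow> real" where
  "sup_ball z r = Sup (h ` ball z r)"

lemma moment_0: "moment 0 z r = measure M (ball z r)"
  by (simp add: moment_def set_lebesgue_integral_def)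

lemma bdd_above_h_ball: "bdd_above (h ` ball z r)"
proof (cases "r > 0")
  case True
  define c where "c = A * (LINT x:ball z r|M. (h x)\<^sup>2) / measure M (ball z r)"
  have "h x \<le> 1 + c" if "x \<in> ball z r" for x
  proof -
    have "(h x)\<^sup>2 \<le> c"
      using h2_le_average[OF that] ball_pos[OF True, of z] by (simp add: c_def field_simps)
    moreover have "h x \<le> 1 + (h x)\<^sup>2"
    proof -
      have "h x \<le> (h x)\<^sup>2 / 2 + 1 / 2" using young_ineq[of 1 "h x" 1] by simp
      then show ?thesis using zero_le_power2[of "h x"] by linarith
    qed
    ultimately show ?thesis by simp
  qed
  then show ?thesis by (intro bdd_aboveI2[where M = "1 + c"]) auto
qed (simp add: ball_empty)

lemma h_le_sup_ball: "x \<in> ball z r \<Longrightarrow> h x \<le> sup_ball z r"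
  unfolding sup_ball_def using bdd_above_h_ball by (auto intro: cSup_upper)

lemma sup_ball_pos: "0 < r \<Longrightarrow> 0 < sup_ball z r"
  using h_le_sup_ball[of z z r] h_pos[of z] by simp

lemma sup_ball_mono:
  assumes "0 < r" "ball z r \<subseteq> ball z' r'"
  shows "sup_ball z r \<le> sup_ball z' r'"
  unfolding sup_ball_def
  by (rule cSup_subset_mono) (use assms bdd_above_h_ball in auto)

lemma integrable_h_power: "set_integrable M (ball z r) (\<lambda>x. h x ^ p)"
  unfolding set_integrable_def
proof (rule Bochner_Integration.integrable_bound)
  show "integrable M (\<lambda>x. indicator (ball z r) x * sup_ball z r ^ p)"
    using ball_finite[of z r] by (intro integrable_mult_left integrable_real_indicator) auto
  have "norm (indicator (ball z r) x *\<^sub>R h x ^ p) \<le> norm (indicator (ball z r) x * sup_ball z r ^ p)" for x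
    using h_le_sup_ball[of x z r] h_pos[of x]
    by (auto simp: indicator_def intro!: power_mono)
  then show "AE x in M. norm (indicator (ball z r) x *\<^sub>R h x ^ p)
      \<le> norm (indicator (ball z r) x * sup_ball z r ^ p)" by simp
qed measurable

lemma nn_integral_h_power:
  assumes "0 \<le> c"
  shows "(\<integral>\<^sup>+x\<in>ball z r. ennreal (c * h x ^ p) \<partial>M) = ennreal (c * moment p z r)"
proof -
  have "(\<integral>\<^sup>+x\<in>ball z r. ennreal (c * h x ^ p) \<partial>M)
      = (\<integral>\<^sup>+x. ennreal (c * (indicator (ball z r) x *\<^sub>R h x ^ p)) \<partial>M)"
    by (intro nn_integral_cong) (auto simp: indicator_def)
  also have "\<dots> = ennreal (LINT x|M. c * (indicator (ball z r) x *\<^sub>R h x ^ p))"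
    using integrable_h_power[of z r p] assms h_pos
    by (intro nn_integral_eq_integral) (auto simp: set_integrable_def less_imp_le)
  finally show ?thesis
    by (simp add: moment_def set_lebesgue_integral_def)
qed

lemma moment_mono: "ball z r \<subseteq> ball z' r' \<Longrightarrow> moment p z r \<le> moment p z' r'"
  unfolding moment_def set_lebesgue_integral_def
  using integrable_h_power h_pos
  by (intro integral_mono) (auto simp: set_integrable_def indicator_def less_imp_le)

lemma moment_nonneg: "0 \<le> moment p z r"
  unfolding moment_def set_lebesgue_integral_def
  using h_pos by (intro integral_nonneg_AE AE_I2) (auto simp: less_imp_le)

lemma moment_Suc_le: "moment (Suc p) z r \<le> sup_ball z r * moment p z r"
proof -
  have "moment (Suc p) z r \<le> (LINT x:ball z r|M. sup_ball z r * h x ^ p)"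
    unfolding moment_def
    using integrable_h_power[of z r "Suc p"] integrable_h_power[of z r p] h_le_sup_ball h_pos
    by (intro set_integral_mono) (auto intro!: mult_right_mono simp: less_imp_le)
  then show ?thesis by (simp add: moment_def)
qed

lemma sup_ball_square_moment_0_le:
  assumes "0 < r"
  shows "(sup_ball z r)\<^sup>2 * moment 0 z r \<le> A * moment 2 z r"
proof -
  have m0: "0 < moment 0 z r" using ball_pos[OF assms] by (simp add: moment_0)
  have le: "(h x)\<^sup>2 \<le> A * moment 2 z r / moment 0 z r" if "x \<in> ball z r" for x
    using h2_le_average[OF that] m0 unfolding moment_0 by (simp add: moment_def field_simps)
  have "sup_ball z r \<le> sqrt (A * moment 2 z r / moment 0 z r)"
    unfolding sup_ball_def
  proof (rule cSup_least)
    fix y assume "y \<in> h ` ball z r"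
    then obtain x where "x \<in> ball z r" "y = h x" by blast
    then show "y \<le> sqrt (A * moment 2 z r / moment 0 z r)" using le by (auto intro: real_le_rsqrt)
  qed (use assms in auto)
  then have "(sup_ball z r)\<^sup>2 \<le> (sqrt (A * moment 2 z r / moment 0 z r))\<^sup>2"
    using sup_ball_pos[OF assms, of z] by (intro power_mono) auto
  also have "\<dots> = A * moment 2 z r / moment 0 z r"
    using order_trans[OF zero_le_power2 le[of z]] assms by (intro real_sqrt_pow2) simp
  finally show ?thesis using m0 by (simp add: field_simps)
qed

lemma moment_2_pos: "0 < r \<Longrightarrow> 0 < A * moment 2 z r"
  using sup_ball_square_moment_0_le[of r z]
    mult_pos_pos[OF zero_less_power[OF sup_ball_pos[of r z], of 2] ball_pos[of r z]]
  by (simp add: moment_0)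

lemma A_pos: "0 < A"
  using moment_2_pos[of 1 undefined] moment_nonneg[of 2 undefined 1] by (simp add: zero_less_mult_iff)

lemma sup_ball_moment_0_le:
  assumes "0 < r"
  shows "sup_ball z r * moment 0 z r \<le> A * moment 1 z r"
proof -
  have "sup_ball z r * (sup_ball z r * moment 0 z r) \<le> A * moment 2 z r"
    using sup_ball_square_moment_0_le[OF assms] by (simp add: power2_eq_square mult.assoc)
  also have "\<dots> \<le> A * (sup_ball z r * moment 1 z r)"
    using moment_Suc_le[of 1 z r] A_pos by (simp add: numeral_2_eq_2)
  finally show ?thesis using sup_ball_pos[OF assms, of z] by (simp add: mult.left_commute)
qed

lemma moment_1_pos: "0 < r \<Longrightarrow> 0 < moment 1 z r"
proof -
  assume "0 < r"
  then have "0 < A * moment 1 z r"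
    using sup_ball_moment_0_le[of r z] mult_pos_pos[OF sup_ball_pos[of r z] ball_pos[of r z]]
    by (simp add: moment_0)
  then show ?thesis using A_pos by (simp add: zero_less_mult_iff)
qed

lemma sup_ball_moment_1_le:
  assumes "0 < r"
  shows "sup_ball z r * moment 1 z r \<le> A * moment 2 z r"
proof -
  have "sup_ball z r * moment 1 z r \<le> sup_ball z r * (sup_ball z r * moment 0 z r)"
    using moment_Suc_le[of 0 z r] sup_ball_pos[OF assms, of z] by (intro mult_left_mono) auto
  then show ?thesis
    using sup_ball_square_moment_0_le[OF assms, of z] by (simp add: power2_eq_square mult.assoc)
qed

text \<open>The norm of \<open>h\<close> in \<open>L\<^sup>2(\<sigma>)\<close> over a ball is comparable with its supremum norm: by Cauchy-Schwarz
\<open>\<nu>(B)\<^sup>2 \<le> \<sigma>(B) \<integral>\<^sub>B h\<^sup>3 d\<mu>\<close>, while \<open>\<nu>(B)\<close> is at least a multiple of \<open>K(B) \<sigma>(B)\<close>. The inequality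
of Cauchy-Schwarz is replaced by that of Young with a suitable parameter.\<close>

lemma sup_ball_square_moment_1_le:
  assumes "0 < r"
  shows "(sup_ball z r)\<^sup>2 * moment 1 z r \<le> A\<^sup>2 * moment 3 z r"
proof -
  note K = sup_ball_pos[OF assms, of z]
  \<comment> \<open>With this \<open>s\<close> the integral of the last term is at most half of \<open>moment 2 z r\<close> and can be absorbed.\<close>
  define s where "s = A / sup_ball z r"
  have s: "0 < s" using K A_pos by (simp add: s_def)
  have *: "h x ^ 2 \<le> s / 2 * h x ^ 3 + 1 / (2 * s) * h x ^ 1" for x
  proof -
    have "h x * (h x * 1) \<le> h x * (s / 2 * (h x)\<^sup>2 + 1\<^sup>2 / (2 * s))"
      using h_pos[of x] by (intro mult_left_mono young_ineq s) auto
    then show ?thesis by (simp add: power2_eq_square power3_eq_cube algebra_simps)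
  qed
  have i3: "set_integrable M (ball z r) (\<lambda>x. s / 2 * h x ^ 3)"
    and i1: "set_integrable M (ball z r) (\<lambda>x. 1 / (2 * s) * h x ^ 1)"
    by (intro set_integrable_mult_right impI integrable_h_power)+
  have "moment 2 z r \<le> (LINT x:ball z r|M. s / 2 * h x ^ 3 + 1 / (2 * s) * h x ^ 1)"
    unfolding moment_def using integrable_h_power * set_integral_add(1)[OF i3 i1]
    by (intro set_integral_mono) auto
  also have "\<dots> = s / 2 * moment 3 z r + 1 / (2 * s) * moment 1 z r"
    using set_integral_add(2)[OF i3 i1] by (simp add: moment_def)
  also have "1 / (2 * s) * moment 1 z r \<le> moment 2 z r / 2"
    using sup_ball_moment_1_le[OF assms, of z] A_pos K by (simp add: s_def field_simps)
  finally have "moment 2 z r \<le> s * moment 3 z r" by simp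
  then have "sup_ball z r * moment 2 z r \<le> A * moment 3 z r"
    using K by (simp add: s_def field_simps)
  then have "A * (sup_ball z r * moment 2 z r) \<le> A * (A * moment 3 z r)"
    using A_pos by simp
  moreover have "sup_ball z r * (sup_ball z r * moment 1 z r) \<le> sup_ball z r * (A * moment 2 z r)"
    using sup_ball_moment_1_le[OF assms, of z] K by (intro mult_left_mono) auto
  ultimately show ?thesis by (simp add: power2_eq_square mult_ac)
qed

definition sup_const :: real where "sup_const = sqrt (A * D)"

definition mass_const :: real where "mass_const = sup_const * D * A"

lemma D_pos: "0 < D"
proof -
  have "0 < D * measure M (ball undefined 1)"
    using doubling_M[of 1 undefined] ball_pos[of 2 undefined] by simp
  then show ?thesis using ball_pos[of 1 undefined] by (simp add: zero_less_mult_iff)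
qed

text \<open>\<open>K(2B)\<^sup>2 \<mu>(2B) \<le> A \<nu>(2B) \<le> A D \<nu>(B) \<le> A D K(B)\<^sup>2 \<mu>(2B)\<close>.\<close>

lemma sup_ball_double:
  assumes "0 < r"
  shows "sup_ball z (2 * r) \<le> sup_const * sup_ball z r"
proof -
  have m0: "0 < moment 0 z (2 * r)" using ball_pos[of "2 * r"] assms by (simp add: moment_0)
  have "moment 2 z r \<le> sup_ball z r * (sup_ball z r * moment 0 z r)"
    using order_trans[OF moment_Suc_le[of "Suc 0" z r]
      mult_left_mono[OF moment_Suc_le[of 0 z r] less_imp_le[OF sup_ball_pos[OF assms, of z]]]]
    by (simp only: numeral_2_eq_2)
  also have "\<dots> \<le> sup_ball z r * (sup_ball z r * moment 0 z (2 * r))"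
    using sup_ball_pos[OF assms, of z] assms
    by (intro mult_left_mono moment_mono subset_ball) auto
  finally have m2: "moment 2 z r \<le> (sup_ball z r)\<^sup>2 * moment 0 z (2 * r)"
    by (simp add: power2_eq_square mult.assoc)
  have "(sup_ball z (2 * r))\<^sup>2 * moment 0 z (2 * r) \<le> A * moment 2 z (2 * r)"
    using assms by (intro sup_ball_square_moment_0_le) auto
  also have "\<dots> \<le> A * (D * moment 2 z r)"
    using doubling_h2[OF assms, of z] A_pos by (simp add: moment_def)
  also have "\<dots> \<le> A * (D * ((sup_ball z r)\<^sup>2 * moment 0 z (2 * r)))"
    using A_pos D_pos m2 by (intro mult_left_mono) auto
  finally have "(sup_ball z (2 * r))\<^sup>2 * moment 0 z (2 * r)
      \<le> (A * D * (sup_ball z r)\<^sup>2) * moment 0 z (2 * r)"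
    by (simp add: mult.assoc)
  then have "(sup_ball z (2 * r))\<^sup>2 \<le> A * D * (sup_ball z r)\<^sup>2"
    by (rule mult_right_le_imp_le[OF _ m0])
  also have "\<dots> = (sup_const * sup_ball z r)\<^sup>2"
  proof -
    have "sup_const\<^sup>2 = A * D"
      unfolding sup_const_def using A_pos D_pos by (intro real_sqrt_pow2) simp
    then show ?thesis by (simp only: power_mult_distrib)
  qed
  finally show ?thesis
  proof (rule power2_le_imp_le)
    have "0 \<le> sup_const" unfolding sup_const_def using A_pos D_pos by simp
    then show "0 \<le> sup_const * sup_ball z r"
      using sup_ball_pos[OF assms, of z] by simp
  qed
qed

lemma moment_1_double:
  assumes "0 < r"
  shows "moment 1 z (2 * r) \<le> mass_const * moment 1 z r"
proof -
  have sc: "0 \<le> sup_const" using A_pos D_pos by (simp add: sup_const_def)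
  have "moment 1 z (2 * r) \<le> sup_ball z (2 * r) * moment 0 z (2 * r)"
    using moment_Suc_le[of 0 z "2 * r"] by simp
  also have "\<dots> \<le> (sup_const * sup_ball z r) * (D * moment 0 z r)"
    using doubling_M[OF assms, of z] sup_ball_double[OF assms, of z] sup_ball_pos[of "2 * r" z] assms
    by (intro mult_mono) (auto simp: moment_0)
  also have "\<dots> = sup_const * D * (sup_ball z r * moment 0 z r)" by simp
  also have "\<dots> \<le> sup_const * D * (A * moment 1 z r)"
    using sc D_pos by (intro mult_left_mono sup_ball_moment_0_le assms) auto
  finally show ?thesis by (simp add: mass_const_def)
qed

lemma sup_const_ge_1: "1 \<le> sup_const"
proof -
  have "sup_ball undefined 1 \<le> sup_ball undefined (2 * 1)"
    by (intro sup_ball_mono subset_ball) auto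
  then have "1 * sup_ball undefined 1 \<le> sup_const * sup_ball undefined 1"
    using sup_ball_double[of 1 undefined] by simp
  then show ?thesis using sup_ball_pos[of 1 undefined] by simp
qed

lemma mass_const_ge_1: "1 \<le> mass_const"
proof -
  have "moment 1 undefined 1 \<le> moment 1 undefined (2 * 1)"
    by (intro moment_mono subset_ball) auto
  then have "1 * moment 1 undefined 1 \<le> mass_const * moment 1 undefined 1"
    using moment_1_double[of 1 undefined] by simp
  then show ?thesis using moment_1_pos[of 1 undefined] by simp
qed

lemma ball_eight:
  assumes "0 < r"
  shows "sup_ball z (8 * r) \<le> sup_const ^ 3 * sup_ball z r"
    and "moment 1 z (8 * r) \<le> mass_const ^ 3 * moment 1 z r"
proof -
  have "sup_ball z (8 * r) \<le> sup_const * sup_ball z (4 * r)"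
    using sup_ball_double[of "4 * r" z] assms by simp
  also have "\<dots> \<le> sup_const * (sup_const * sup_ball z (2 * r))"
    using sup_ball_double[of "2 * r" z] assms sup_const_ge_1 by simp
  also have "\<dots> \<le> sup_const * (sup_const * (sup_const * sup_ball z r))"
    using sup_ball_double[of r z] assms sup_const_ge_1 by simp
  finally show "sup_ball z (8 * r) \<le> sup_const ^ 3 * sup_ball z r"
    by (simp add: power3_eq_cube mult.assoc)
  have "moment 1 z (8 * r) \<le> mass_const * moment 1 z (4 * r)"
    using moment_1_double[of "4 * r" z] assms by simp
  also have "\<dots> \<le> mass_const * (mass_const * moment 1 z (2 * r))"
    using moment_1_double[of "2 * r" z] assms mass_const_ge_1 by simp
  also have "\<dots> \<le> mass_const * (mass_const * (mass_const * moment 1 z r))"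
    using moment_1_double[of r z] assms mass_const_ge_1 by simp
  finally show "moment 1 z (8 * r) \<le> mass_const ^ 3 * moment 1 z r"
    by (simp add: power3_eq_cube mult.assoc)
qed

section \<open>Mean oscillation with respect to a weight\<close>

text \<open>The numerator of the mean oscillation of \<open>g\<close> over a ball, for a given multiple \<open>c\<close> of \<open>h\<close>.\<close>

definition osc :: "('a \<Rightarrow> complex) \<Rightarrow> complex \<Rightarrow> 'a \<Rightarrow> real \<Rightarrow> ennreal" where
  "osc g c z r = (\<integral>\<^sup>+x\<in>ball z r. ennreal ((norm (g x - c * of_real (h x)))\<^sup>2 * h x) \<partial>M)"

text \<open>For \<open>N \<ge> 0\<close> this implies that the \<open>BMO\<close> norm is at most \<open>N\<close>, and it holds whenever the norm is less than \<open>N\<close>.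
It provides a definite multiple of \<open>h\<close> on each ball, so that the multiples on different balls can be compared.\<close>

definition osc_le :: "real \<Rightarrow> ('a \<Rightarrow> complex) \<Rightarrow> bool" where
  "osc_le N g \<longleftrightarrow> g \<in> borel_measurable M \<and>
     (\<forall>z r. 0 < r \<longrightarrow> (\<exists>c. osc g c z r \<le> ennreal (N\<^sup>2 * moment 1 z r)))"

lemma osc_mono_ball: "ball z r \<subseteq> ball z' r' \<Longrightarrow> osc g c z r \<le> osc g c z' r'"
  unfolding osc_def by (intro nn_integral_mono) (auto simp: indicator_def)

text \<open>On the smaller ball \<open>|c - c'|\<^sup>2 h\<^sup>3\<close> is dominated by the two oscillations, and \<open>\<integral>\<^sub>B h\<^sup>3 d\<mu>\<close> is bounded below
by a multiple of \<open>K(B)\<^sup>2 \<sigma>(B)\<close>.\<close>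

lemma const_diff_le:
  assumes [measurable]: "g \<in> borel_measurable M" and r: "0 < r"
    and sub: "ball z r \<subseteq> ball z' r'"
    and o1: "osc g c z r \<le> ennreal (N\<^sup>2 * moment 1 z r)"
    and o2: "osc g c' z' r' \<le> ennreal (N\<^sup>2 * moment 1 z' r')"
    and S: "moment 1 z' r' \<le> S * moment 1 z r" and N: "0 \<le> N"
  shows "norm (c - c') * sup_ball z r \<le> sqrt (2 * (1 + S)) * A * N"
proof -
  let ?t = "(norm (c - c'))\<^sup>2"
  have m1: "0 < moment 1 z r" by (rule moment_1_pos[OF r])
  have m1': "0 \<le> moment 1 z' r'" by (rule moment_nonneg)
  have S_nonneg: "0 \<le> S"
    using order_trans[OF m1' S] m1 by (simp add: zero_le_mult_iff)
  have pw: "?t * h x ^ 3 \<le> 2 * ((norm (g x - c * of_real (h x)))\<^sup>2 * h x)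
      + 2 * ((norm (g x - c' * of_real (h x)))\<^sup>2 * h x)" for x
  proof -
    have "(g x - c' * of_real (h x)) + (- (g x - c * of_real (h x))) = (c - c') * of_real (h x)"
      by (simp add: algebra_simps)
    then have "?t * (h x)\<^sup>2 = (norm ((g x - c' * of_real (h x)) + (- (g x - c * of_real (h x)))))\<^sup>2"
      by (simp only: norm_mult power_mult_distrib norm_of_real power2_abs)
    also have "\<dots> \<le> 2 * (norm (g x - c' * of_real (h x)))\<^sup>2 + 2 * (norm (- (g x - c * of_real (h x))))\<^sup>2"
      by (rule norm_add_power2_le)
    finally have "?t * (h x)\<^sup>2 * h x \<le> (2 * (norm (g x - c' * of_real (h x)))\<^sup>2
        + 2 * (norm (- (g x - c * of_real (h x))))\<^sup>2) * h x"
      using h_pos[of x] by (intro mult_right_mono) auto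
    then show ?thesis
      unfolding norm_minus_cancel by (simp only: power3_eq_cube power2_eq_square distrib_right mult.assoc)
  qed
  have "ennreal (?t * moment 3 z r) = (\<integral>\<^sup>+x\<in>ball z r. ennreal (?t * h x ^ 3) \<partial>M)"
    by (rule nn_integral_h_power[symmetric]) simp
  also have "\<dots> \<le> (\<integral>\<^sup>+x. 2 * (ennreal ((norm (g x - c * of_real (h x)))\<^sup>2 * h x) * indicator (ball z r) x)
      + 2 * (ennreal ((norm (g x - c' * of_real (h x)))\<^sup>2 * h x) * indicator (ball z r) x) \<partial>M)"
  proof (rule nn_integral_mono)
    fix x
    have x_nn: "0 \<le> (norm (g x - b * of_real (h x)))\<^sup>2 * h x" for b
      using h_pos[of x] by simp
    have "ennreal (?t * h x ^ 3) \<le> ennreal (2 * ((norm (g x - c * of_real (h x)))\<^sup>2 * h x)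
      + 2 * ((norm (g x - c' * of_real (h x)))\<^sup>2 * h x))"
      by (intro ennreal_leI pw)
    also have "\<dots> = 2 * ennreal ((norm (g x - c * of_real (h x)))\<^sup>2 * h x)
      + 2 * ennreal ((norm (g x - c' * of_real (h x)))\<^sup>2 * h x)"
      using x_nn by (subst ennreal_plus) (simp_all only: ennreal_mult zero_le_mult_iff zero_le_numeral ennreal_numeral HOL.simp_thms)
    finally show "ennreal (?t * h x ^ 3) * indicator (ball z r) x
      \<le> 2 * (ennreal ((norm (g x - c * of_real (h x)))\<^sup>2 * h x) * indicator (ball z r) x)
      + 2 * (ennreal ((norm (g x - c' * of_real (h x)))\<^sup>2 * h x) * indicator (ball z r) x)"
      by (simp add: indicator_def)
  qed
  also have "\<dots> = 2 * osc g c z r + 2 * osc g c' z r"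
    unfolding osc_def by (simp add: nn_integral_add nn_integral_cmult)
  also have "\<dots> \<le> 2 * ennreal (N\<^sup>2 * moment 1 z r) + 2 * ennreal (N\<^sup>2 * moment 1 z' r')"
    using o1 order_trans[OF osc_mono_ball[OF sub] o2] by (intro add_mono mult_left_mono) auto
  also have "\<dots> = ennreal (2 * (N\<^sup>2 * moment 1 z r) + 2 * (N\<^sup>2 * moment 1 z' r'))"
    using m1 m1' by (simp add: ennreal_plus ennreal_mult)
  finally have "?t * moment 3 z r \<le> 2 * (N\<^sup>2 * moment 1 z r) + 2 * (N\<^sup>2 * moment 1 z' r')"
    using m1 m1' by (subst (asm) ennreal_le_iff) auto
  also have "\<dots> \<le> 2 * (N\<^sup>2 * moment 1 z r) + 2 * (N\<^sup>2 * (S * moment 1 z r))"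
    using S by (intro add_mono mult_left_mono) auto
  also have "\<dots> = 2 * (1 + S) * N\<^sup>2 * moment 1 z r" by (simp add: algebra_simps)
  finally have t3: "?t * moment 3 z r \<le> 2 * (1 + S) * N\<^sup>2 * moment 1 z r" .
  have "?t * (sup_ball z r)\<^sup>2 * moment 1 z r \<le> ?t * (A\<^sup>2 * moment 3 z r)"
    using sup_ball_square_moment_1_le[OF r, of z] by (simp add: mult.assoc mult_left_mono)
  also have "\<dots> = A\<^sup>2 * (?t * moment 3 z r)" by simp
  also have "\<dots> \<le> A\<^sup>2 * (2 * (1 + S) * N\<^sup>2 * moment 1 z r)"
    using t3 by (intro mult_left_mono) auto
  finally have "?t * (sup_ball z r)\<^sup>2 * moment 1 z r \<le> (A\<^sup>2 * (2 * (1 + S) * N\<^sup>2)) * moment 1 z r"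
    by (simp add: mult.assoc)
  then have "?t * (sup_ball z r)\<^sup>2 \<le> A\<^sup>2 * (2 * (1 + S) * N\<^sup>2)" using m1 by simp
  also have "\<dots> = (sqrt (2 * (1 + S)) * A * N)\<^sup>2"
    using S_nonneg by (simp add: power_mult_distrib)
  finally have "(norm (c - c') * sup_ball z r)\<^sup>2 \<le> (sqrt (2 * (1 + S)) * A * N)\<^sup>2"
    by (simp add: power_mult_distrib)
  then show ?thesis
    by (rule power2_le_imp_le) (use A_pos N S_nonneg in auto)
qed

definition step_const :: real where "step_const = sqrt (2 * (1 + mass_const)) * A"

lemma step_const_nonneg: "0 \<le> step_const"
  using A_pos mass_const_ge_1 by (simp add: step_const_def)

text \<open>A telescoping argument along the radii \<open>r, 2r, 4r, \<dots>\<close>. The bound could be made logarithmic in \<open>R/r\<close>, but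
the linear one has the simpler induction and suffices for a Lipschitz cutoff.\<close>

lemma const_diff_concentric:
  assumes g: "g \<in> borel_measurable M" and N: "0 \<le> N"
    and c: "\<And>s. 0 < s \<Longrightarrow> osc g (c s) z s \<le> ennreal (N\<^sup>2 * moment 1 z s)"
    and "0 < r" "r \<le> R" "R \<le> 2 ^ n * r"
  shows "norm (c r - c R) * sup_ball z r \<le> 2 * step_const * N * (R / r)"
  using assms(4-)
proof (induction n arbitrary: r)
  case 0
  then show ?case using step_const_nonneg N by simp
next
  case (Suc n)
  note Q = mult_nonneg_nonneg[OF step_const_nonneg N]
  have near: "norm (c r - c s) * sup_ball z r \<le> step_const * N" if "r \<le> s" "s \<le> 2 * r" for s
    unfolding step_const_def
  proof (rule const_diff_le[OF g Suc.prems(1) _ c c _ N])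
    show "moment 1 z s \<le> mass_const * moment 1 z r"
      using moment_mono[OF subset_ball[OF that(2)]] moment_1_double[OF Suc.prems(1)]
      by (rule order_trans)
  qed (use that Suc.prems(1) in \<open>auto intro: subset_ball\<close>)
  show ?case
  proof (cases "R \<le> 2 * r")
    case True
    have "step_const * N * 1 \<le> step_const * N * (2 * (R / r))"
      using Q Suc.prems by (intro mult_left_mono) (auto simp: field_simps)
    with near[OF Suc.prems(2) True] have "norm (c r - c R) * sup_ball z r \<le> step_const * N * (2 * (R / r))"
      by linarith
    then show ?thesis by (simp only: mult_ac)
  next
    case False
    \<comment> \<open>One doubling costs \<open>step_const * N\<close>, the remaining ones at most twice that times \<open>R / (2 r)\<close>; as
      \<open>R \<ge> r\<close> the sum is again at most twice that times \<open>R / r\<close>.\<close>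
    have "norm (c r - c R) * sup_ball z r
        \<le> (norm (c r - c (2 * r)) + norm (c (2 * r) - c R)) * sup_ball z r"
      using sup_ball_pos[OF Suc.prems(1), of z] norm_triangle_ineq[of "c r - c (2 * r)" "c (2 * r) - c R"]
      by (intro mult_right_mono) auto
    also have "\<dots> \<le> step_const * N + norm (c (2 * r) - c R) * sup_ball z (2 * r)"
      using near[of "2 * r"] Suc.prems(1)
      by (auto simp: distrib_right intro!: add_mono mult_left_mono sup_ball_mono subset_ball)
    also have "\<dots> \<le> step_const * N + 2 * step_const * N * (R / (2 * r))"
      using Suc.IH[of "2 * r"] Suc.prems False by (simp add: mult_ac)
    also have "\<dots> = step_const * N * (1 + R / r)" by (simp add: algebra_simps)
    also have "\<dots> \<le> step_const * N * (2 * (R / r))"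
      using Q Suc.prems by (intro mult_left_mono) (auto simp: field_simps)
    finally show ?thesis by (simp only: mult_ac)
  qed
qed

section \<open>Cutoffs, truncations and bounded approximation\<close>

definition cutoff :: "'a \<Rightarrow> real \<Rightarrow> 'a \<Rightarrow> real" where
  "cutoff y R x = max 0 (min 1 (2 - dist x y / R))"

lemma cutoff_meas [measurable]: "cutoff y R \<in> borel_measurable M"
proof -
  have "cutoff y R \<in> borel_measurable borel"
    unfolding cutoff_def
    by (cases "R = 0") (auto intro!: borel_measurable_continuous_onI continuous_intros)
  then show ?thesis by (simp cong: measurable_cong_sets add: sets_M)
qed

lemma cutoff_range: "0 \<le> cutoff y R x" "cutoff y R x \<le> 1"
  by (auto simp: cutoff_def)

lemma cutoff_inside: "0 < R \<Longrightarrow> dist x y \<le> R \<Longrightarrow> cutoff y R x = 1"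
  by (auto simp: cutoff_def field_simps)

lemma cutoff_outside: "0 < R \<Longrightarrow> x \<notin> ball y (2 * R) \<Longrightarrow> cutoff y R x = 0"
  by (auto simp: cutoff_def field_simps dist_commute)

lemma cutoff_lipschitz:
  assumes "0 < R"
  shows "\<bar>cutoff y R x - cutoff y R x'\<bar> \<le> dist x x' / R"
proof -
  have "\<bar>dist x y - dist x' y\<bar> \<le> dist x x'"
    using dist_triangle[of x y x'] dist_triangle[of x' y x] by (simp add: dist_commute abs_le_iff)
  then have "\<bar>dist x y / R - dist x' y / R\<bar> \<le> dist x x' / R"
    using assms by (simp add: diff_divide_distrib[symmetric] divide_right_mono)
  then show ?thesis unfolding cutoff_def by linarith
qed

definition cut_const :: real where
  "cut_const = 16 * step_const + sup_const ^ 3 * (sqrt (2 * (1 + mass_const ^ 3)) * A)"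

definition bmo_const :: real where
  "bmo_const = sqrt (mass_const ^ 3 + 2 + 2 * cut_const\<^sup>2)"

lemma bmo_const_square: "bmo_const\<^sup>2 = mass_const ^ 3 + 2 + 2 * cut_const\<^sup>2"
  using mass_const_ge_1 by (simp add: bmo_const_def)

lemma bmo_const_pos: "0 < bmo_const"
  unfolding bmo_const_def using mass_const_ge_1
  by (intro real_sqrt_gt_zero add_pos_nonneg) auto

text \<open>A ball that meets the support of the cutoff, and whose radius is at least the scale \<open>R\<close>, contains the whole support after
dilation by \<open>8\<close>.\<close>

lemma osc_cutoff_large_ball:
  assumes R: "0 < R" and r: "R \<le> r" and meet: "ball z r \<inter> ball y (2 * R) \<noteq> {}"
    and m: "osc g m y (2 * R) \<le> ennreal (N\<^sup>2 * moment 1 y (2 * R))"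
  shows "osc (\<lambda>x. of_real (cutoff y R x) * (g x - m * of_real (h x))) 0 z r
    \<le> ennreal (N\<^sup>2 * (mass_const ^ 3 * moment 1 z r))"
proof -
  have "osc (\<lambda>x. of_real (cutoff y R x) * (g x - m * of_real (h x))) 0 z r \<le> osc g m y (2 * R)"
    unfolding osc_def
  proof (rule nn_integral_mono)
    fix x
    show "ennreal ((norm (of_real (cutoff y R x) * (g x - m * of_real (h x)) - 0 * of_real (h x)))\<^sup>2 * h x)
        * indicator (ball z r) x
      \<le> ennreal ((norm (g x - m * of_real (h x)))\<^sup>2 * h x) * indicator (ball y (2 * R)) x"
    proof (cases "x \<in> ball y (2 * R)")
      case True
      have "norm (of_real (cutoff y R x) * (g x - m * of_real (h x))) \<le> norm (g x - m * of_real (h x))"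
        using cutoff_range[of y R x] by (auto simp: norm_mult intro: mult_left_le_one_le)
      then have "(norm (of_real (cutoff y R x) * (g x - m * of_real (h x))))\<^sup>2 * h x
          \<le> (norm (g x - m * of_real (h x)))\<^sup>2 * h x"
        using h_pos[of x] by (intro mult_right_mono power_mono) auto
      then show ?thesis using True by (auto simp: indicator_def intro: ennreal_leI)
    qed (simp add: cutoff_outside[OF R])
  qed
  also note m
  also have "moment 1 y (2 * R) \<le> moment 1 z (8 * r)"
  proof (rule moment_mono)
    obtain w where w: "dist z w < r" "dist y w < 2 * R" using meet by auto
    show "ball y (2 * R) \<subseteq> ball z (8 * r)"
    proof
      fix x assume "x \<in> ball y (2 * R)"
      then show "x \<in> ball z (8 * r)"
        using w r R dist_triangle[of z x w] dist_triangle[of w x y] by (simp add: dist_commute)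
    qed
  qed
  also have "moment 1 z (8 * r) \<le> mass_const ^ 3 * moment 1 z r"
    using R r by (intro ball_eight) auto
  finally show ?thesis by (simp add: ennreal_leI mult_left_mono)
qed

text \<open>First compare with the concentric ball of radius \<open>8 R\<close>, which contains the support of the cutoff, and then that
ball with the support.\<close>

lemma const_diff_cutoff:
  assumes g: "g \<in> borel_measurable M" and N: "0 \<le> N"
    and R: "0 < R" and r: "0 < r" "r < R" and meet: "ball z r \<inter> ball y (2 * R) \<noteq> {}"
    and m: "osc g m y (2 * R) \<le> ennreal (N\<^sup>2 * moment 1 y (2 * R))"
    and c: "\<And>s. 0 < s \<Longrightarrow> osc g (c s) z s \<le> ennreal (N\<^sup>2 * moment 1 z s)"
  shows "norm (c r - m) * sup_ball z r \<le> cut_const * N * (R / r)"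
proof -
  obtain w where w: "dist z w < r" "dist y w < 2 * R" using meet by auto
  have sub1: "ball y (2 * R) \<subseteq> ball z (8 * R)"
  proof
    fix x assume "x \<in> ball y (2 * R)"
    then show "x \<in> ball z (8 * R)"
      using w r R dist_triangle[of z x w] dist_triangle[of w x y] by (simp add: dist_commute)
  qed
  have sub2: "ball z (8 * R) \<subseteq> ball y (8 * (2 * R))"
  proof
    fix x assume "x \<in> ball z (8 * R)"
    then show "x \<in> ball y (8 * (2 * R))"
      using w r R dist_triangle[of y x w] dist_triangle[of w x z] by (simp add: dist_commute)
  qed
  have K: "0 < sup_ball z r" by (rule sup_ball_pos[OF r(1)])
  obtain n where "8 * R / r < 2 ^ n" using real_arch_pow[of 2 "8 * R / r"] by auto
  then have "norm (c r - c (8 * R)) * sup_ball z r \<le> 2 * step_const * N * (8 * R / r)"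
    using r R by (intro const_diff_concentric[OF g N c, of r "8 * R" n]) (auto simp: field_simps)
  then have far: "norm (c r - c (8 * R)) * sup_ball z r \<le> 16 * step_const * N * (R / r)"
    by simp
  define Q where "Q = sqrt (2 * (1 + mass_const ^ 3)) * A"
  have Q: "0 \<le> Q" using mass_const_ge_1 A_pos by (simp add: Q_def)
  have "norm (m - c (8 * R)) * sup_ball y (2 * R) \<le> Q * N"
    unfolding Q_def
  proof (rule const_diff_le[OF g _ sub1 m c _ N])
    show "moment 1 z (8 * R) \<le> mass_const ^ 3 * moment 1 y (2 * R)"
      using moment_mono[OF sub2] ball_eight(2)[of "2 * R" y] R by (auto intro: order_trans)
  qed (use R in auto)
  moreover have "sup_ball z r \<le> sup_const ^ 3 * sup_ball y (2 * R)"
  proof -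
    have "sup_ball z r \<le> sup_ball y (8 * (2 * R))"
      using r by (intro sup_ball_mono order_trans[OF subset_ball sub2]) auto
    then show ?thesis using ball_eight(1)[of "2 * R" y] R by simp
  qed
  ultimately have "norm (m - c (8 * R)) * sup_ball z r
      \<le> norm (m - c (8 * R)) * (sup_const ^ 3 * sup_ball y (2 * R))"
    and "sup_const ^ 3 * (norm (m - c (8 * R)) * sup_ball y (2 * R)) \<le> sup_const ^ 3 * (Q * N)"
    using sup_const_ge_1 by (auto intro!: mult_left_mono)
  then have "norm (m - c (8 * R)) * sup_ball z r \<le> sup_const ^ 3 * (Q * N)"
    by (simp only: mult.left_commute)
  also have "\<dots> \<le> sup_const ^ 3 * (Q * N) * (R / r)"
    using mult_left_mono[of 1 "R / r" "sup_const ^ 3 * (Q * N)"] sup_const_ge_1 Q N r by simp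
  finally have mid: "norm (c (8 * R) - m) * sup_ball z r \<le> sup_const ^ 3 * (Q * N) * (R / r)"
    by (simp add: norm_minus_commute)
  have "norm (c r - m) * sup_ball z r
      \<le> (norm (c r - c (8 * R)) + norm (c (8 * R) - m)) * sup_ball z r"
    using K norm_triangle_ineq[of "c r - c (8 * R)" "c (8 * R) - m"]
    by (intro mult_right_mono) auto
  also have "\<dots> \<le> 16 * step_const * N * (R / r) + sup_const ^ 3 * (Q * N) * (R / r)"
    using far mid by (simp only: distrib_right)
  also have "\<dots> = cut_const * N * (R / r)"
    by (simp add: cut_const_def Q_def algebra_simps)
  finally show ?thesis .
qed

text \<open>On a small ball the cutoff is almost constant: the product differs from a multiple of \<open>g - c h\<close> by
\<open>(\<eta>(x) - \<eta>(z)) (c - m) h\<close>, in which the factor \<open>r/R\<close> of the first difference cancels the growth \<open>R/r\<close> of the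
second.\<close>

lemma osc_cutoff_small_ball:
  assumes g [measurable]: "g \<in> borel_measurable M" and N: "0 \<le> N"
    and R: "0 < R" and r: "0 < r"
    and c: "osc g c z r \<le> ennreal (N\<^sup>2 * moment 1 z r)"
    and diff: "norm (c - m) * sup_ball z r \<le> cut_const * N * (R / r)"
  shows "osc (\<lambda>x. of_real (cutoff y R x) * (g x - m * of_real (h x))) (of_real (cutoff y R z) * (c - m)) z r
    \<le> ennreal (N\<^sup>2 * ((2 + 2 * cut_const\<^sup>2) * moment 1 z r))"
proof -
  let ?e = "cutoff y R"
  have K: "0 < sup_ball z r" by (rule sup_ball_pos[OF r])
  have pw: "(norm (of_real (?e x) * (g x - m * of_real (h x)) - of_real (?e z) * (c - m) * of_real (h x)))\<^sup>2 * h x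
      \<le> 2 * ((norm (g x - c * of_real (h x)))\<^sup>2 * h x) + 2 * (cut_const\<^sup>2 * N\<^sup>2) * h x ^ 1"
    if x: "x \<in> ball z r" for x
  proof -
    let ?a = "of_real (?e x) * (g x - c * of_real (h x))"
    let ?b = "of_real (?e x - ?e z) * (c - m) * of_real (h x)"
    have hx: "0 < h x" "h x \<le> sup_ball z r" using h_pos h_le_sup_ball[OF x] by auto
    have a: "norm ?a \<le> norm (g x - c * of_real (h x))"
      using cutoff_range[of y R x] by (auto simp: norm_mult intro: mult_left_le_one_le)
    have "norm ?b \<le> (r / R) * norm (c - m) * sup_ball z r"
    proof -
      have "\<bar>?e x - ?e z\<bar> \<le> r / R"
        using cutoff_lipschitz[OF R, of y x z] x R by (auto simp: dist_commute divide_right_mono elim!: order_trans)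
      then show ?thesis
        using hx r R unfolding norm_mult norm_of_real by (intro mult_mono) auto
    qed
    also have "\<dots> = (r / R) * (norm (c - m) * sup_ball z r)" by simp
    also have "\<dots> \<le> (r / R) * (cut_const * N * (R / r))"
      using diff r R by (intro mult_left_mono) auto
    also have "\<dots> = cut_const * N" using r R by simp
    finally have b: "norm ?b \<le> cut_const * N" .
    have "of_real (?e x) * (g x - m * of_real (h x)) - of_real (?e z) * (c - m) * of_real (h x) = ?a + ?b"
      by (simp add: algebra_simps)
    then have "(norm (of_real (?e x) * (g x - m * of_real (h x)) - of_real (?e z) * (c - m) * of_real (h x)))\<^sup>2
        \<le> 2 * (norm ?a)\<^sup>2 + 2 * (norm ?b)\<^sup>2"
      by (simp only: norm_add_power2_le)
    also have "\<dots> \<le> 2 * (norm (g x - c * of_real (h x)))\<^sup>2 + 2 * (cut_const * N)\<^sup>2"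
      by (intro add_mono mult_left_mono power_mono a b) auto
    finally have "(norm (of_real (?e x) * (g x - m * of_real (h x)) - of_real (?e z) * (c - m) * of_real (h x)))\<^sup>2 * h x
        \<le> (2 * (norm (g x - c * of_real (h x)))\<^sup>2 + 2 * (cut_const * N)\<^sup>2) * h x"
      using hx(1) by (intro mult_right_mono) auto
    then show ?thesis
      by (simp only: distrib_right mult.assoc power_one_right power_mult_distrib)
  qed
  have "osc (\<lambda>x. of_real (?e x) * (g x - m * of_real (h x))) (of_real (?e z) * (c - m)) z r
      \<le> (\<integral>\<^sup>+x. 2 * (ennreal ((norm (g x - c * of_real (h x)))\<^sup>2 * h x) * indicator (ball z r) x)
          + ennreal (2 * (cut_const\<^sup>2 * N\<^sup>2) * h x ^ 1) * indicator (ball z r) x \<partial>M)"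
    unfolding osc_def
  proof (rule nn_integral_mono)
    fix x
    show "ennreal ((norm (of_real (?e x) * (g x - m * of_real (h x)) - of_real (?e z) * (c - m) * of_real (h x)))\<^sup>2 * h x)
        * indicator (ball z r) x
      \<le> 2 * (ennreal ((norm (g x - c * of_real (h x)))\<^sup>2 * h x) * indicator (ball z r) x)
        + ennreal (2 * (cut_const\<^sup>2 * N\<^sup>2) * h x ^ 1) * indicator (ball z r) x"
    proof (cases "x \<in> ball z r")
      case True
      have nn1: "0 \<le> (norm (g x - c * of_real (h x)))\<^sup>2 * h x"
        and nn2: "0 \<le> 2 * (cut_const\<^sup>2 * N\<^sup>2) * h x ^ 1" using h_pos[of x] by auto
      have "ennreal (2 * ((norm (g x - c * of_real (h x)))\<^sup>2 * h x) + 2 * (cut_const\<^sup>2 * N\<^sup>2) * h x ^ 1)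
        = 2 * ennreal ((norm (g x - c * of_real (h x)))\<^sup>2 * h x) + ennreal (2 * (cut_const\<^sup>2 * N\<^sup>2) * h x ^ 1)"
        using ennreal_plus[OF mult_nonneg_nonneg[OF zero_le_numeral nn1] nn2]
          ennreal_mult[OF zero_le_numeral nn1] by (simp only: ennreal_numeral)
      then show ?thesis using ennreal_leI[OF pw[OF True]] True by (simp only: indicator_simps mult_1_right)
    qed simp
  qed
  also have "\<dots> = 2 * osc g c z r + (\<integral>\<^sup>+x\<in>ball z r. ennreal (2 * (cut_const\<^sup>2 * N\<^sup>2) * h x ^ 1) \<partial>M)"
    unfolding osc_def by (simp add: nn_integral_add nn_integral_cmult)
  also have "\<dots> \<le> 2 * ennreal (N\<^sup>2 * moment 1 z r) + ennreal (2 * (cut_const\<^sup>2 * N\<^sup>2) * moment 1 z r)"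
    by (intro add_mono mult_left_mono c eq_refl[OF nn_integral_h_power]) auto
  also have "\<dots> = ennreal (2 * (N\<^sup>2 * moment 1 z r) + 2 * (cut_const\<^sup>2 * N\<^sup>2) * moment 1 z r)"
    using moment_nonneg[of 1 z r] by (simp add: ennreal_mult)
  also have "2 * (N\<^sup>2 * moment 1 z r) + 2 * (cut_const\<^sup>2 * N\<^sup>2) * moment 1 z r
      = N\<^sup>2 * ((2 + 2 * cut_const\<^sup>2) * moment 1 z r)"
    by (simp add: algebra_simps)
  finally show ?thesis .
qed

lemma osc_le_cutoff:
  assumes g: "osc_le N g" and N: "0 \<le> N" and R: "0 < R"
    and m: "osc g m y (2 * R) \<le> ennreal (N\<^sup>2 * moment 1 y (2 * R))"
  shows "osc_le (bmo_const * N) (\<lambda>x. of_real (cutoff y R x) * (g x - m * of_real (h x)))"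
    (is "osc_le _ ?f")
proof -
  have [measurable]: "g \<in> borel_measurable M" using g by (simp add: osc_le_def)
  have "\<exists>c. osc ?f c z r \<le> ennreal ((bmo_const * N)\<^sup>2 * moment 1 z r)" if r: "0 < r" for z r
  proof -
    have up: "ennreal (N\<^sup>2 * (b * moment 1 z r)) \<le> ennreal ((bmo_const * N)\<^sup>2 * moment 1 z r)"
      if "b \<le> bmo_const\<^sup>2" for b
    proof -
      have "N\<^sup>2 * (b * moment 1 z r) \<le> N\<^sup>2 * (bmo_const\<^sup>2 * moment 1 z r)"
        using that moment_nonneg[of 1 z r] by (intro mult_left_mono mult_right_mono) auto
      then show ?thesis by (intro ennreal_leI) (simp add: power_mult_distrib mult_ac)
    qed
    show ?thesis
    proof (cases "ball z r \<inter> ball y (2 * R) = {}")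
      case True
      have "osc ?f 0 z r = (\<integral>\<^sup>+x. 0 \<partial>M)"
        unfolding osc_def
      proof (rule nn_integral_cong)
        fix x
        have "cutoff y R x = 0" if "x \<in> ball z r"
          using True that by (intro cutoff_outside[OF R]) blast
        then show "ennreal ((norm (?f x - 0 * of_real (h x)))\<^sup>2 * h x) * indicator (ball z r) x = 0"
          by (cases "x \<in> ball z r") simp_all
      qed
      then show ?thesis by (intro exI[of _ 0]) simp
    next
      case meet: False
      show ?thesis
      proof (cases "R \<le> r")
        case True
        have "mass_const ^ 3 \<le> bmo_const\<^sup>2" unfolding bmo_const_square by simp
        from order_trans[OF osc_cutoff_large_ball[OF R True meet m] up[OF this]]
        show ?thesis by blast
      next
        case False
        obtain c where c: "\<And>s. 0 < s \<Longrightarrow> osc g (c s) z s \<le> ennreal (N\<^sup>2 * moment 1 z s)"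
          using g unfolding osc_le_def by metis
        have "norm (c r - m) * sup_ball z r \<le> cut_const * N * (R / r)"
          using False by (intro const_diff_cutoff[OF _ N R r _ meet m c]) auto
        then have "osc ?f (of_real (cutoff y R z) * (c r - m)) z r
            \<le> ennreal (N\<^sup>2 * ((2 + 2 * cut_const\<^sup>2) * moment 1 z r))"
          by (intro osc_cutoff_small_ball[OF _ N R r c[OF r]]) auto
        also have "\<dots> \<le> ennreal ((bmo_const * N)\<^sup>2 * moment 1 z r)"
          by (rule up) (use mass_const_ge_1 in \<open>simp add: bmo_const_square\<close>)
        finally show ?thesis by blast
      qed
    qed
  qed
  then show ?thesis unfolding osc_le_def by simp
qed

abbreviation truncation :: "real \<Rightarrow> complex \<Rightarrow> complex" where
  "truncation n \<equiv> closest_point (cball 0 n)"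

lemma truncation_lipschitz: "0 \<le> n \<Longrightarrow> norm (truncation n u - truncation n v) \<le> norm (u - v)"
  using closest_point_lipschitz[of "cball 0 n" u v] by (simp add: dist_norm)

lemma norm_truncation_le: "0 \<le> n \<Longrightarrow> norm (truncation n u) \<le> n"
  using closest_point_in_set[of "cball 0 n" u] by simp

lemma truncation_id: "norm u \<le> n \<Longrightarrow> truncation n u = u"
  by (intro closest_point_self) simp

lemma truncation_meas [measurable]: "0 \<le> n \<Longrightarrow> truncation n \<in> borel_measurable borel"
  by (intro borel_measurable_continuous_onI continuous_on_closest_point) auto

text \<open>The radial projection is a contraction, so that replacing both \<open>g/h\<close> and the number \<open>c\<close> by their
projections does not increase the oscillation.\<close>

lemma osc_le_truncation:
  assumes g: "osc_le N g" and n: "0 \<le> n"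
  shows "osc_le N (\<lambda>x. of_real (h x) * truncation n (g x / of_real (h x)))"
proof -
  have [measurable]: "g \<in> borel_measurable M" using g by (simp add: osc_le_def)
  note [measurable] = truncation_meas[OF n]
  have le: "osc (\<lambda>x. of_real (h x) * truncation n (g x / of_real (h x))) (truncation n c) z r \<le> osc g c z r"
    for c z r
    unfolding osc_def
  proof (intro nn_integral_mono mult_right_mono ennreal_leI power_mono)
    fix x
    have h: "0 < h x" by (rule h_pos)
    have "norm (of_real (h x) * truncation n (g x / of_real (h x)) - truncation n c * of_real (h x))
        = h x * norm (truncation n (g x / of_real (h x)) - truncation n c)"
    proof -
      have "of_real (h x) * truncation n (g x / of_real (h x)) - truncation n c * of_real (h x)
          = of_real (h x) * (truncation n (g x / of_real (h x)) - truncation n c)"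
        by (simp add: algebra_simps)
      then show ?thesis using h by (simp only: norm_mult norm_of_real abs_of_pos)
    qed
    also have "\<dots> \<le> h x * norm (g x / of_real (h x) - c)"
      using h truncation_lipschitz[OF n] by (intro mult_left_mono) auto
    also have "\<dots> = norm (of_real (h x) * (g x / of_real (h x) - c))"
      using h by (simp only: norm_mult norm_of_real abs_of_pos)
    also have "of_real (h x) * (g x / of_real (h x) - c) = g x - c * of_real (h x)"
      using h by (simp add: right_diff_distrib)
    finally show "norm (of_real (h x) * truncation n (g x / of_real (h x)) - truncation n c * of_real (h x))
      \<le> norm (g x - c * of_real (h x))" .
  qed (use h_pos in \<open>auto simp: less_imp_le\<close>)
  show ?thesis
    unfolding osc_le_def
  proof (intro conjI allI impI)
    fix z and r :: real assume "0 < r"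
    then obtain c where "osc g c z r \<le> ennreal (N\<^sup>2 * moment 1 z r)" using g unfolding osc_le_def by blast
    with le[of c z r] show "\<exists>c. osc (\<lambda>x. of_real (h x) * truncation n (g x / of_real (h x))) c z r
        \<le> ennreal (N\<^sup>2 * moment 1 z r)"
      by (meson order_trans)
  qed measurable
qed

text \<open>Truncation comes before the cutoff so that the multiple \<open>m\<close> of \<open>h\<close> that has to be subtracted does not interfere with the
truncation level. On the ball where the cutoff is \<open>1\<close> this multiple is invisible to atoms.\<close>

lemma bounded_approximation:
  assumes g: "osc_le N g" and N: "0 \<le> N" and n: "0 \<le> n" and R: "0 < R"
  obtains f m C where "f \<in> borel_measurable M" "osc_le (bmo_const * N) f" "\<And>x. norm (f x) \<le> C"
    "\<And>x. x \<in> ball y R \<Longrightarrow> f x = of_real (h x) * truncation n (g x / of_real (h x)) - m * of_real (h x)"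
proof -
  let ?g = "\<lambda>x. of_real (h x) * truncation n (g x / of_real (h x))"
  have tr: "osc_le N ?g" by (rule osc_le_truncation[OF g n])
  then obtain m where m: "osc ?g m y (2 * R) \<le> ennreal (N\<^sup>2 * moment 1 y (2 * R))"
    using R unfolding osc_le_def by (meson mult_pos_pos zero_less_numeral)
  let ?f = "\<lambda>x. of_real (cutoff y R x) * (?g x - m * of_real (h x))"
  have f: "osc_le (bmo_const * N) ?f" by (rule osc_le_cutoff[OF tr N R m])
  have "norm (?f x) \<le> sup_ball y (2 * R) * (n + norm m)" for x
  proof (cases "x \<in> ball y (2 * R)")
    case True
    have "?f x = of_real (cutoff y R x * h x) * (truncation n (g x / of_real (h x)) - m)"
      by (simp add: algebra_simps)
    then have "norm (?f x) = (cutoff y R x * h x) * norm (truncation n (g x / of_real (h x)) - m)"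
      using h_pos[of x] cutoff_range[of y R x] by (simp only: norm_mult norm_of_real) simp
    also have "\<dots> \<le> (1 * sup_ball y (2 * R)) * (n + norm m)"
      using h_pos[of x] cutoff_range[of y R x] h_le_sup_ball[OF True] norm_truncation_le[OF n]
        norm_triangle_ineq4[of "truncation n (g x / of_real (h x))" m] n
      by (intro mult_mono) (auto intro: order_trans)
    finally show ?thesis by simp
  next
    case False
    then show ?thesis using sup_ball_pos[of "2 * R" y] R n by (simp add: cutoff_outside)
  qed
  moreover have "?f x = ?g x - m * of_real (h x)" if "x \<in> ball y R" for x
    using that R by (simp add: cutoff_inside dist_commute)
  ultimately show ?thesis using that f unfolding osc_le_def by blast
qed

section \<open>Atoms and their pairing with functions of bounded mean oscillation\<close>

lemma emeasure_weighted: "emeasure (weighted M h) (ball z r) = ennreal (moment 1 z r)"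
proof -
  have "emeasure (weighted M h) (ball z r) = (\<integral>\<^sup>+x\<in>ball z r. ennreal (1 * h x ^ 1) \<partial>M)"
    unfolding weighted_def by (subst emeasure_density) auto
  also have "\<dots> = ennreal (moment 1 z r)" by (subst nn_integral_h_power) auto
  finally show ?thesis .
qed

lemma measure_weighted: "measure (weighted M h) (ball z r) = moment 1 z r"
  using moment_nonneg[of 1 z r] by (simp add: measure_def emeasure_weighted)

lemma osc_le_if_bmo_norm_less:
  assumes g: "g \<in> borel_measurable M" and less: "bmo_norm M h g < ennreal N"
  shows "osc_le N g"
  unfolding osc_le_def
proof (intro conjI g allI impI)
  fix z and r :: real assume r: "0 < r"
  let ?m = "ennreal (moment 1 z r)"
  have m: "0 < moment 1 z r" by (rule moment_1_pos[OF r])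
  have "(INF c. ennsqrt (osc g c z r / ?m)) \<le> bmo_norm M h g"
    unfolding bmo_norm_def osc_def emeasure_weighted[symmetric]
    by (rule SUP_upper2[of "(z, r)"]) (use r in auto)
  then have "(INF c. ennsqrt (osc g c z r / ?m)) < ennreal N" using less by (rule le_less_trans)
  then obtain c where c: "ennsqrt (osc g c z r / ?m) < ennreal N" by (auto simp: INF_less_iff)
  define q where "q = osc g c z r / ?m"
  have c: "ennsqrt q < ennreal N" using c by (simp only: q_def)
  then have fin: "q \<noteq> \<infinity>" by (auto simp: ennsqrt_def)
  then have "sqrt (enn2real q) < N"
    using c by (simp add: ennsqrt_def ennreal_less_iff)
  then have "(sqrt (enn2real q))\<^sup>2 \<le> N\<^sup>2" by (intro power_mono) auto
  then have "ennreal (enn2real q) \<le> ennreal (N\<^sup>2)" by (intro ennreal_leI) simp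
  moreover have "q = ennreal (enn2real q)" using fin by (simp add: less_top)
  ultimately have "q \<le> ennreal (N\<^sup>2)" by (metis (no_types))
  then have "q * ?m \<le> ennreal (N\<^sup>2) * ?m" by (intro mult_right_mono) auto
  also have "q * ?m = osc g c z r"
    using m by (simp add: q_def ennreal_divide_times)
  also have "ennreal (N\<^sup>2) * ?m = ennreal (N\<^sup>2 * moment 1 z r)" using m by (simp add: ennreal_mult)
  finally show "\<exists>c. osc g c z r \<le> ennreal (N\<^sup>2 * moment 1 z r)" by blast
qed

lemma bmo_norm_le_if_osc_le:
  assumes g: "osc_le N g" and N: "0 \<le> N"
  shows "bmo_norm M h g \<le> ennreal N"
  unfolding bmo_norm_def
proof (rule SUP_least, clarsimp)
  fix z and r :: real assume r: "0 < r"
  let ?m = "ennreal (moment 1 z r)"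
  have m: "0 < moment 1 z r" by (rule moment_1_pos[OF r])
  obtain c where c: "osc g c z r \<le> ennreal (N\<^sup>2 * moment 1 z r)"
    using g r unfolding osc_le_def by blast
  have "osc g c z r / ?m \<le> ennreal (N\<^sup>2)"
    using c m by (intro divide_le_posI_ennreal) (auto simp: ennreal_mult mult.commute)
  then have "osc g c z r / ?m \<noteq> \<infinity>" and "enn2real (osc g c z r / ?m) \<le> N\<^sup>2"
    using enn2real_mono[of "osc g c z r / ?m" "ennreal (N\<^sup>2)"]
    by (auto simp: top_unique)
  then have "ennsqrt (osc g c z r / ?m) \<le> ennreal N"
    using real_sqrt_le_mono[of "enn2real (osc g c z r / ?m)" "N\<^sup>2"] N
    by (simp add: ennsqrt_def ennreal_leI)
  then show "(INF c. ennsqrt ((\<integral>\<^sup>+x\<in>ball z r. ennreal ((norm (g x - c * of_real (h x)))\<^sup>2 * h x) \<partial>M)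
      / emeasure (weighted M h) (ball z r))) \<le> ennreal N"
    unfolding emeasure_weighted osc_def by (rule INF_lower2[OF UNIV_I])
qed

text \<open>The multiples of atoms with a prescribed ball.\<close>

definition ball_function :: "'a \<Rightarrow> real \<Rightarrow> ('a \<Rightarrow> complex) \<Rightarrow> bool" where
  "ball_function z r b \<longleftrightarrow> b \<in> borel_measurable M \<and> (AE x in M. x \<notin> ball z r \<longrightarrow> b x = 0) \<and>
     integrable M (\<lambda>x. (norm (b x))\<^sup>2 / h x) \<and> has_bochner_integral M (\<lambda>x. b x * of_real (h x)) 0"

lemma atom_iff:
  "atom M h a \<longleftrightarrow> (\<exists>z r. 0 < r \<and> ball_function z r a \<and> (LINT x|M. (norm (a x))\<^sup>2 / h x) \<le> 1 / moment 1 z r)"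
proof -
  have "sqrt I \<le> moment 1 z r powr (- 1 / 2) \<longleftrightarrow> I \<le> 1 / moment 1 z r"
    if "0 < r" "0 \<le> I" for z r and I :: real
  proof -
    have m: "0 < moment 1 z r" by (rule moment_1_pos[OF that(1)])
    have "moment 1 z r powr (- 1 / 2) = sqrt (1 / moment 1 z r)"
      using m powr_half_sqrt[of "moment 1 z r"] powr_minus[of "moment 1 z r" "1/2"]
      by (simp add: real_sqrt_divide inverse_eq_divide)
    then show ?thesis by simp
  qed
  moreover have "0 \<le> (LINT x|M. (norm (a x))\<^sup>2 / h x)"
    using h_pos by (intro integral_nonneg_AE AE_I2) (simp add: less_imp_le)
  ultimately show ?thesis
    unfolding atom_def ball_function_def measure_weighted by blast
qed

text \<open>The Cauchy-Schwarz inequality for \<open>b / sqrt h\<close> and \<open>u sqrt h\<close>, in the form of Young's inequality; the parameter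
\<open>s\<close> is optimised where the lemma is used.\<close>

lemma pairing_bound:
  fixes b u :: "'a \<Rightarrow> complex"
  assumes b [measurable]: "b \<in> borel_measurable M" and supp: "AE x in M. x \<notin> ball z r \<longrightarrow> b x = 0"
    and int: "integrable M (\<lambda>x. (norm (b x))\<^sup>2 / h x)"
    and u [measurable]: "u \<in> borel_measurable M"
    and bnd: "(\<integral>\<^sup>+x\<in>ball z r. ennreal ((norm (u x))\<^sup>2 * h x) \<partial>M) \<le> ennreal U" and s: "0 < s" and U: "0 \<le> U"
  shows "integrable M (\<lambda>x. b x * u x)"
    and "(LINT x|M. norm (b x * u x)) \<le> s / 2 * (LINT x|M. (norm (b x))\<^sup>2 / h x) + U / (2 * s)"
    and "norm (LINT x|M. b x * u x) \<le> s / 2 * (LINT x|M. (norm (b x))\<^sup>2 / h x) + U / (2 * s)"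
proof -
  define v where "v x = indicator (ball z r) x * ((norm (u x))\<^sup>2 * h x)" for x
  have [measurable]: "v \<in> borel_measurable M" unfolding v_def by measurable
  have v_nonneg: "0 \<le> v x" for x using h_pos[of x] by (simp add: v_def)
  have nnv: "(\<integral>\<^sup>+x. ennreal (v x) \<partial>M) \<le> ennreal U"
  proof -
    have "(\<integral>\<^sup>+x. ennreal (v x) \<partial>M) = (\<integral>\<^sup>+x\<in>ball z r. ennreal ((norm (u x))\<^sup>2 * h x) \<partial>M)"
      by (intro nn_integral_cong) (auto simp: v_def indicator_def)
    then show ?thesis using bnd by simp
  qed
  have intv: "integrable M v"
    using nnv v_nonneg by (intro integrableI_bounded) (auto simp: le_less_trans[OF _ ennreal_less_top])
  have lev: "(LINT x|M. v x) \<le> U"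
    using nnv nn_integral_eq_integral[OF intv] v_nonneg U by simp
  have pw: "AE x in M. norm (b x * u x) \<le> s / 2 * ((norm (b x))\<^sup>2 / h x) + v x / (2 * s)"
    using supp
  proof eventually_elim
    case (elim x)
    show ?case
    proof (cases "x \<in> ball z r")
      case True
      define k where "k = sqrt (h x)"
      have k: "0 < k" "h x = k\<^sup>2" using h_pos[of x] by (auto simp: k_def)
      have "norm (b x * u x) = (norm (b x) / k) * (norm (u x) * k)"
        using k by (simp add: norm_mult)
      also have "\<dots> \<le> s / 2 * (norm (b x) / k)\<^sup>2 + (norm (u x) * k)\<^sup>2 / (2 * s)"
        by (rule young_ineq[OF s])
      finally show ?thesis using True by (simp add: v_def k power_mult_distrib power_divide)
    next
      case False
      then show ?thesis using elim s h_pos[of x] v_nonneg[of x] by simp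
    qed
  qed
  have dom: "integrable M (\<lambda>x. s / 2 * ((norm (b x))\<^sup>2 / h x) + v x / (2 * s))"
    by (intro Bochner_Integration.integrable_add integrable_mult_right integrable_divide impI int intv)
  show bu: "integrable M (\<lambda>x. b x * u x)"
    by (rule Bochner_Integration.integrable_bound[OF dom])
      (use pw in \<open>auto elim!: eventually_mono\<close>)
  have "(LINT x|M. norm (b x * u x)) \<le> (LINT x|M. s / 2 * ((norm (b x))\<^sup>2 / h x) + v x / (2 * s))"
    using bu dom pw by (intro integral_mono_AE) auto
  also have "\<dots> = s / 2 * (LINT x|M. (norm (b x))\<^sup>2 / h x) + (LINT x|M. v x) / (2 * s)"
  proof -
    define w where "w x = (norm (b x))\<^sup>2 / h x" for x
    have "(LINT x|M. s / 2 * w x + v x / (2 * s)) = s / 2 * (LINT x|M. w x) + (LINT x|M. v x) / (2 * s)"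
      using int[folded w_def] intv by simp
    then show ?thesis by (simp only: w_def)
  qed
  also have "\<dots> \<le> s / 2 * (LINT x|M. (norm (b x))\<^sup>2 / h x) + U / (2 * s)"
    using lev s by (simp add: divide_right_mono)
  finally show "(LINT x|M. norm (b x * u x)) \<le> s / 2 * (LINT x|M. (norm (b x))\<^sup>2 / h x) + U / (2 * s)" .
  with integral_norm_bound[of M "\<lambda>x. b x * u x"]
  show "norm (LINT x|M. b x * u x) \<le> s / 2 * (LINT x|M. (norm (b x))\<^sup>2 / h x) + U / (2 * s)"
    by linarith
qed

lemma atom_integrable:
  assumes "atom M h a"
  shows "integrable M a"
proof -
  obtain z r where r: "0 < r" and a: "ball_function z r a" using assms unfolding atom_iff by blast
  have "integrable M (\<lambda>x. a x * 1)"
  proof (rule pairing_bound(1))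
    have "(\<integral>\<^sup>+x\<in>ball z r. ennreal (1 * h x ^ 1) \<partial>M) = ennreal (1 * moment 1 z r)"
      by (rule nn_integral_h_power) simp
    then show "(\<integral>\<^sup>+x\<in>ball z r. ennreal ((norm (1::complex))\<^sup>2 * h x) \<partial>M) \<le> ennreal (moment 1 z r)"
      by simp
    show "(0::real) < 1" by simp
  qed (use a moment_nonneg in \<open>auto simp: ball_function_def\<close>)
  then show ?thesis by simp
qed

lemma ball_function_pairing:
  assumes a: "ball_function z r a" and g [measurable]: "g \<in> borel_measurable M"
    and osc: "osc g c z r \<le> ennreal U" and U: "0 \<le> U" and s: "0 < s"
  shows "integrable M (\<lambda>x. a x * g x)"
    and "norm (LINT x|M. a x * g x) \<le> s / 2 * (LINT x|M. (norm (a x))\<^sup>2 / h x) + U / (2 * s)"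
proof -
  let ?u = "\<lambda>x. g x - c * of_real (h x)"
  have ah: "has_bochner_integral M (\<lambda>x. a x * of_real (h x)) 0"
    using a by (simp add: ball_function_def)
  have um: "?u \<in> borel_measurable M" by measurable
  have "a \<in> borel_measurable M" "AE x in M. x \<notin> ball z r \<longrightarrow> a x = 0"
    "integrable M (\<lambda>x. (norm (a x))\<^sup>2 / h x)"
    using a by (auto simp: ball_function_def)
  note pb = pairing_bound[OF this um osc[unfolded osc_def] s U]
  have ch: "has_bochner_integral M (\<lambda>x. c * (a x * of_real (h x))) (c * 0)"
    by (intro has_bochner_integral_mult_right impI ah)
  have "has_bochner_integral M (\<lambda>x. a x * ?u x + c * (a x * of_real (h x)))
      ((LINT x|M. a x * ?u x) + c * 0)"
    by (intro has_bochner_integral_add has_bochner_integral_integrable pb(1) ch)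
  moreover have "a x * ?u x + c * (a x * of_real (h x)) = a x * g x" for x
    by (simp add: algebra_simps)
  ultimately have "has_bochner_integral M (\<lambda>x. a x * g x) (LINT x|M. a x * ?u x)" by simp
  then show "integrable M (\<lambda>x. a x * g x)"
    and "norm (LINT x|M. a x * g x) \<le> s / 2 * (LINT x|M. (norm (a x))\<^sup>2 / h x) + U / (2 * s)"
    using pb(3) by (auto simp: has_bochner_integral_iff)
qed

lemma atom_pairing:
  assumes a: "atom M h a" and g: "osc_le N g" and N: "0 < N"
  shows "integrable M (\<lambda>x. a x * g x)" and "norm (LINT x|M. a x * g x) \<le> N"
proof -
  obtain z r where r: "0 < r" and ar: "ball_function z r a"
    and I: "(LINT x|M. (norm (a x))\<^sup>2 / h x) \<le> 1 / moment 1 z r" using a unfolding atom_iff by blast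
  define m where "m = moment 1 z r"
  have m: "0 < m" using moment_1_pos[OF r] by (simp add: m_def)
  obtain c where c: "osc g c z r \<le> ennreal (N\<^sup>2 * m)" and gm: "g \<in> borel_measurable M"
    using g r unfolding osc_le_def m_def by blast
  \<comment> \<open>The parameter \<open>N * m\<close> makes both terms of the bound at most \<open>N / 2\<close>.\<close>
  note pb = ball_function_pairing[OF ar gm c, of "N * m"]
  show "integrable M (\<lambda>x. a x * g x)" using pb(1) m N by simp
  have "norm (LINT x|M. a x * g x)
      \<le> N * m / 2 * (LINT x|M. (norm (a x))\<^sup>2 / h x) + N\<^sup>2 * m / (2 * (N * m))"
    using pb(2) m N by simp
  also have "\<dots> \<le> N * m / 2 * (1 / m) + N\<^sup>2 * m / (2 * (N * m))"
    using I m N by (intro add_mono mult_left_mono) (auto simp: m_def)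
  also have "\<dots> = N" using m N by (simp add: power2_eq_square)
  finally show "norm (LINT x|M. a x * g x) \<le> N" .
qed

lemma zero_atom: "atom M h (\<lambda>x. 0)"
  unfolding atom_iff ball_function_def
  using moment_1_pos[of 1 undefined]
  by (intro exI[of _ undefined] exI[of _ 1]) (auto simp: has_bochner_integral_zero)

section \<open>The atomic norm\<close>

text \<open>A finite sum is a series whose remaining coefficients are \<open>0\<close>; the zero function is an atom for any ball.\<close>

lemma finite_sum_representation:
  assumes atoms: "\<And>k. k < n \<Longrightarrow> atom M h (a k)"
  shows "atomic_representation M h (\<lambda>x. \<Sum>k<n. lam k * a k x)
    (\<lambda>k. if k < n then lam k else 0) (\<lambda>k. if k < n then a k else (\<lambda>x. 0))"
proof -
  let ?l = "\<lambda>k. if k < n then lam k else 0" and ?a = "\<lambda>k. if k < n then a k else (\<lambda>x. 0)"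
  have part: "(\<Sum>k<m. ?l k * ?a k x) = (\<Sum>k<n. lam k * a k x)" if "n \<le> m" for m x
    using that by (intro sum.mono_neutral_cong_right) auto
  have "integrable M (\<lambda>x. \<Sum>k<n. lam k * a k x)"
    by (intro Bochner_Integration.integrable_sum integrable_mult_right impI atom_integrable atoms) auto
  moreover have "\<forall>k. atom M h (?a k)" using atoms zero_atom by auto
  moreover have "summable (\<lambda>k. norm (?l k))"
    by (rule summable_finite[of "{..<n}"]) auto
  moreover have "(\<lambda>m. \<integral>\<^sup>+x. ennreal (norm ((\<Sum>k<n. lam k * a k x) - (\<Sum>k<m. ?l k * ?a k x))) \<partial>M) \<longlonglongrightarrow> 0"
    by (rule tendsto_eventually, rule eventually_sequentiallyI[of n]) (subst part, auto)
  moreover have "(\<lambda>k. ?l k * ?a k x) sums (\<Sum>k<n. lam k * a k x)" for x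
    using sums_finite[of "{..<n}" "\<lambda>k. ?l k * ?a k x"] part[of n x] by auto
  ultimately show ?thesis unfolding atomic_representation_def by simp
qed

lemma H1_norm_le:
  assumes "atomic_representation M h f lam a"
  shows "H1_norm M h f \<le> (\<Sum>k. norm (lam k))"
  unfolding H1_norm_def
proof (rule cInf_lower)
  show "bdd_below {\<Sum>k. norm (lam k) |lam a. atomic_representation M h f lam a}"
    by (rule bdd_belowI[of _ 0]) (auto simp: atomic_representation_def intro!: suminf_nonneg)
qed (use assms in blast)

lemma le_H1_norm:
  assumes f: "f \<in> H1_at M h"
    and le: "\<And>lam a. atomic_representation M h f lam a \<Longrightarrow> x \<le> N * (\<Sum>k. norm (lam k))" and N: "0 < N"
  shows "x \<le> N * H1_norm M h f"
proof -
  have "x / N \<le> H1_norm M h f"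
    unfolding H1_norm_def
  proof (rule cInf_greatest)
    show "{\<Sum>k. norm (lam k) |lam a. atomic_representation M h f lam a} \<noteq> {}"
      using f unfolding H1_at_def by blast
    fix y assume "y \<in> {\<Sum>k. norm (lam k) |lam a. atomic_representation M h f lam a}"
    then obtain lam a where "atomic_representation M h f lam a" "y = (\<Sum>k. norm (lam k))" by blast
    then show "x / N \<le> y" using le N by (simp add: divide_le_eq mult.commute)
  qed
  then show ?thesis using N by (simp add: divide_le_eq mult.commute)
qed

lemma H1_norm_nonneg:
  assumes "f \<in> H1_at M h"
  shows "0 \<le> H1_norm M h f"
proof -
  have "0 \<le> 1 * H1_norm M h f"
    by (rule le_H1_norm[OF assms]) (auto simp: atomic_representation_def intro!: suminf_nonneg)
  then show ?thesis by simp
qed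

lemma atom_in_H1:
  assumes "atom M h a"
  shows "a \<in> H1_at M h" "H1_norm M h a \<le> 1"
proof -
  have rep: "atomic_representation M h a (\<lambda>k. if k < 1 then 1 else 0) (\<lambda>k. if k < 1 then a else (\<lambda>x. 0))"
    using finite_sum_representation[of 1 "\<lambda>_. a" "\<lambda>_. 1"] assms by simp
  then show "a \<in> H1_at M h" unfolding H1_at_def by blast
  have "(\<Sum>k. norm (if k < (1::nat) then 1 else 0 :: complex)) = 1"
    by (subst suminf_finite[of "{..<1}"]) auto
  then show "H1_norm M h a \<le> 1" using H1_norm_le[OF rep] by simp
qed

lemma finite_atomic_in_H1: "f \<in> finite_atomic M h \<Longrightarrow> f \<in> H1_at M h"
  unfolding finite_atomic_def H1_at_def using finite_sum_representation by blast

text \<open>This is where convergence in \<open>L\<^sup>1(\<mu>)\<close> enters: it suffices for pairing with a bounded function.\<close>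

lemma bounded_pairing_sums:
  assumes rep: "atomic_representation M h f lam a"
    and [measurable]: "u \<in> borel_measurable M" and C: "\<And>x. norm (u x) \<le> C"
  shows "integrable M (\<lambda>x. f x * u x)"
    and "(\<lambda>k. lam k * (LINT x|M. a k x * u x)) sums (LINT x|M. f x * u x)"
proof -
  have int_u: "integrable M (\<lambda>x. v x * u x)" if v: "integrable M v" for v :: "'a \<Rightarrow> complex"
  proof (rule Bochner_Integration.integrable_bound)
    show "integrable M (\<lambda>x. C * norm (v x))" using v by simp
    have "norm (v x * u x) \<le> norm (C * norm (v x))" for x
      using mult_right_mono[OF C[of x], of "norm (v x)"] by (simp add: norm_mult mult.commute)
    then show "AE x in M. norm (v x * u x) \<le> norm (C * norm (v x))" by simp
  qed (use v in measurable)
  have C0: "0 \<le> C" using order_trans[OF norm_ge_zero C] .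
  have f: "integrable M f" and a: "\<And>k. integrable M (a k)"
    using rep atom_integrable by (auto simp: atomic_representation_def)
  show "integrable M (\<lambda>x. f x * u x)" by (rule int_u[OF f])
  let ?S = "\<lambda>n x. \<Sum>k<n. lam k * a k x"
  have S: "integrable M (?S n)" for n using a by auto
  have eq: "(\<Sum>k<n. lam k * (LINT x|M. a k x * u x)) = (LINT x|M. ?S n x * u x)" for n
    using int_u[OF a] by (simp add: sum_distrib_right mult.assoc)
  define e where "e n = (\<integral>\<^sup>+x. ennreal (norm (f x - ?S n x)) \<partial>M)" for n
  have e: "e \<longlonglongrightarrow> 0" using rep unfolding e_def atomic_representation_def by blast
  have e_eq: "e n = ennreal (LINT x|M. norm (f x - ?S n x))" for n
    unfolding e_def using f S[of n] by (intro nn_integral_eq_integral) auto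
  have lim: "(\<lambda>n. LINT x|M. norm (f x - ?S n x)) \<longlonglongrightarrow> 0"
  proof -
    have "e \<longlonglongrightarrow> ennreal 0" using e by simp
    from tendsto_enn2real[OF this] show ?thesis unfolding e_eq by simp
  qed
  have bound: "norm ((LINT x|M. ?S n x * u x) - (LINT x|M. f x * u x))
      \<le> C * (LINT x|M. norm (f x - ?S n x))" for n
  proof -
    have fS: "integrable M (\<lambda>x. f x - ?S n x)" using f S by simp
    have "(LINT x|M. f x * u x) - (LINT x|M. ?S n x * u x) = (LINT x|M. (f x - ?S n x) * u x)"
      using int_u[OF f] int_u[OF S[of n]] by (simp add: left_diff_distrib)
    also have "norm \<dots> \<le> (LINT x|M. norm ((f x - ?S n x) * u x))"
      by (rule integral_norm_bound)
    also have "\<dots> \<le> (LINT x|M. C * norm (f x - ?S n x))"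
    proof (rule integral_mono)
      show "integrable M (\<lambda>x. norm ((f x - ?S n x) * u x))" using int_u[OF fS] by simp
      show "integrable M (\<lambda>x. C * norm (f x - ?S n x))" using fS by simp
      show "norm ((f x - ?S n x) * u x) \<le> C * norm (f x - ?S n x)" for x
        using mult_right_mono[OF C[of x], of "norm (f x - ?S n x)"] by (simp add: norm_mult mult.commute)
    qed
    also have "\<dots> = C * (LINT x|M. norm (f x - ?S n x))" by simp
    finally show ?thesis by (simp add: norm_minus_commute)
  qed
  have "(\<lambda>n. LINT x|M. ?S n x * u x) \<longlonglongrightarrow> (LINT x|M. f x * u x)"
    by (rule Lim_null_comparison[THEN LIM_zero_cancel, OF always_eventually])
      (use bound tendsto_mult_right_zero[OF lim, of C] in \<open>auto\<close>)
  then show "(\<lambda>k. lam k * (LINT x|M. a k x * u x)) sums (LINT x|M. f x * u x)"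
    unfolding sums_def eq .
qed

section \<open>Functionals defined by functions of bounded mean oscillation\<close>

text \<open>Once the cutoff is \<open>1\<close> on the ball of the atom, the term \<open>m\<^sub>j h\<close> integrates to \<open>0\<close> against the atom. The truncations converge
pointwise and are dominated by \<open>|a g|\<close>, which is integrable.\<close>

lemma atom_approximation_limit:
  assumes a: "atom M h a" and g: "osc_le N g" and N: "0 < N"
    and F: "\<And>j x. x \<in> ball y (real (Suc j)) \<Longrightarrow>
      F j x = of_real (h x) * truncation (real j) (g x / of_real (h x)) - m j * of_real (h x)"
    and F_meas [measurable]: "\<And>j. F j \<in> borel_measurable M"
  shows "(\<lambda>j. LINT x|M. a x * F j x) \<longlonglongrightarrow> (LINT x|M. a x * g x)"
proof -
  have gm [measurable]: "g \<in> borel_measurable M" using g by (simp add: osc_le_def)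
  have am [measurable]: "a \<in> borel_measurable M" using a by (simp add: atom_def)
  have ah: "has_bochner_integral M (\<lambda>x. a x * of_real (h x)) 0" using a by (simp add: atom_def)
  obtain z r where r: "0 < r" and supp: "AE x in M. x \<notin> ball z r \<longrightarrow> a x = 0"
    using a unfolding atom_def by blast
  define S where "S j x = a x * (of_real (h x) * truncation (real j) (g x / of_real (h x)))" for j x
  have [measurable]: "S j \<in> borel_measurable M" for j
    using truncation_meas[of "real j"] unfolding S_def by measurable
  have ag: "integrable M (\<lambda>x. a x * g x)" by (rule atom_pairing(1)[OF a g N])
  have S_le: "norm (S j x) \<le> norm (a x * g x)" for j x
  proof -
    have "norm (truncation (real j) (g x / of_real (h x))) \<le> norm (g x / of_real (h x))"
      using truncation_lipschitz[of "real j" "g x / of_real (h x)" 0] truncation_id[of 0 "real j"] by simp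
    then have "norm (a x) * (h x * norm (truncation (real j) (g x / of_real (h x))))
        \<le> norm (a x) * (h x * norm (g x / of_real (h x)))"
      using h_pos[of x] by (intro mult_left_mono) auto
    also have "h x * norm (g x / of_real (h x)) = norm (g x)"
      using h_pos[of x] by (simp add: norm_divide)
    finally show ?thesis using h_pos[of x] by (simp add: S_def norm_mult)
  qed
  have S_lim: "(\<lambda>j. S j x) \<longlonglongrightarrow> a x * g x" for x
  proof (rule tendsto_eventually, rule eventually_sequentiallyI)
    fix j assume "nat \<lceil>norm (g x / of_real (h x))\<rceil> \<le> j"
    then have "norm (g x / of_real (h x)) \<le> real j" by linarith
    then show "S j x = a x * g x" using h_pos[of x] by (simp add: S_def truncation_id)
  qed
  have S_int: "integrable M (S j)" for j
    by (rule Bochner_Integration.integrable_bound[OF ag]) (use S_le in auto)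
  have "(\<lambda>j. integral\<^sup>L M (S j)) \<longlonglongrightarrow> (LINT x|M. a x * g x)"
  proof (rule integral_dominated_convergence)
    show "integrable M (\<lambda>x. norm (a x * g x))" using ag by simp
  qed (use S_lim S_le in auto)
  moreover have "eventually (\<lambda>j. integral\<^sup>L M (S j) = (LINT x|M. a x * F j x)) sequentially"
  proof (rule eventually_sequentiallyI)
    fix j assume "nat \<lceil>dist y z + r\<rceil> \<le> j"
    then have j: "dist y z + r \<le> real j" by linarith
    have sub: "x \<in> ball y (real (Suc j))" if "x \<in> ball z r" for x
      using that j dist_triangle[of y x z] by simp
    have mh: "has_bochner_integral M (\<lambda>x. m j * (a x * of_real (h x))) (m j * 0)"
      by (intro has_bochner_integral_mult_right impI ah)
    have "(LINT x|M. a x * F j x) = (LINT x|M. S j x - m j * (a x * of_real (h x)))"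
    proof (rule integral_cong_AE)
      show "AE x in M. a x * F j x = S j x - m j * (a x * of_real (h x))"
        using supp
      proof eventually_elim
        case (elim x)
        show ?case
        proof (cases "x \<in> ball z r")
          case True
          show ?thesis unfolding F[OF sub[OF True]] S_def by (simp add: algebra_simps)
        next
          case False
          then show ?thesis using elim by (simp add: S_def)
        qed
      qed
    qed measurable
    also have "\<dots> = integral\<^sup>L M (S j) - m j * 0"
      using S_int[of j] mh by (simp add: has_bochner_integral_iff)
    finally show "integral\<^sup>L M (S j) = (LINT x|M. a x * F j x)" by simp
  qed
  ultimately show ?thesis by (rule Lim_transform_eventually)
qed

text \<open>The functional is defined as a limit of pairings with bounded functions, which manifestly depends on \<open>f\<close> only and not on
its representation. Tannery's theorem identifies it with the series: the terms are dominated by \<open>|\<lambda>\<^sub>k|\<close> times the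
uniform bound for the approximations.\<close>

lemma functional_of_osc_le:
  assumes g: "osc_le N g" and N: "0 < N"
  obtains l where
    "\<And>f lam a. atomic_representation M h f lam a \<Longrightarrow> (\<lambda>k. lam k * (LINT x|M. a k x * g x)) sums l f"
    "\<And>f f'. f \<in> H1_at M h \<Longrightarrow> f' \<in> H1_at M h \<Longrightarrow> l (\<lambda>x. f x + f' x) = l f + l f'"
    "\<And>f c. f \<in> H1_at M h \<Longrightarrow> l (\<lambda>x. c * f x) = c * l f"
proof -
  fix y :: 'a
  have "\<forall>j. \<exists>f m C. f \<in> borel_measurable M \<and> osc_le (bmo_const * N) f \<and> (\<forall>x. norm (f x) \<le> C) \<and>
      (\<forall>x\<in>ball y (real (Suc j)).
        f x = of_real (h x) * truncation (real j) (g x / of_real (h x)) - m * of_real (h x))"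
  proof
    fix j
    obtain f m C where "f \<in> borel_measurable M" "osc_le (bmo_const * N) f" "\<And>x. norm (f x) \<le> C"
      "\<And>x. x \<in> ball y (real (Suc j)) \<Longrightarrow>
        f x = of_real (h x) * truncation (real j) (g x / of_real (h x)) - m * of_real (h x)"
      by (rule bounded_approximation[OF g less_imp_le[OF N], of "real j" "real (Suc j)" y]) auto
    then show "\<exists>f m C. f \<in> borel_measurable M \<and> osc_le (bmo_const * N) f \<and> (\<forall>x. norm (f x) \<le> C) \<and>
      (\<forall>x\<in>ball y (real (Suc j)).
        f x = of_real (h x) * truncation (real j) (g x / of_real (h x)) - m * of_real (h x))"
      by blast
  qed
  then obtain F m C where F_meas [measurable]: "\<And>j. F j \<in> borel_measurable M"
    and F_osc: "\<And>j. osc_le (bmo_const * N) (F j)" and F_bound: "\<And>j x. norm (F j x) \<le> C j"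
    and F_eq: "\<And>j x. x \<in> ball y (real (Suc j)) \<Longrightarrow>
        F j x = of_real (h x) * truncation (real j) (g x / of_real (h x)) - m j * of_real (h x)"
    by metis
  define l where "l f = lim (\<lambda>j. LINT x|M. f x * F j x)" for f
  have int: "integrable M (\<lambda>x. f x * F j x)" if "f \<in> H1_at M h" for f j
    using that bounded_pairing_sums(1)[OF _ F_meas F_bound] unfolding H1_at_def by blast
  have key: "(\<lambda>k. lam k * (LINT x|M. a k x * g x)) sums l f \<and> (\<lambda>j. LINT x|M. f x * F j x) \<longlonglongrightarrow> l f"
    if rep: "atomic_representation M h f lam a" for f lam a
  proof -
    have atoms: "atom M h (a k)" for k using rep by (simp add: atomic_representation_def)
    have sm: "summable (\<lambda>k. norm (lam k))" using rep by (simp add: atomic_representation_def)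
    have bN: "0 < bmo_const * N" using N bmo_const_pos by simp
    have *: "eventually (\<lambda>j. summable (\<lambda>k. norm (lam k * (LINT x|M. a k x * F j x)))) sequentially \<and>
      summable (\<lambda>k. norm (lam k * (LINT x|M. a k x * g x))) \<and>
      ((\<lambda>j. \<Sum>k. lam k * (LINT x|M. a k x * F j x)) \<longlonglongrightarrow> (\<Sum>k. lam k * (LINT x|M. a k x * g x)))"
    proof (rule tannerys_theorem)
      show "(\<lambda>j. lam k * (LINT x|M. a k x * F j x)) \<longlonglongrightarrow> lam k * (LINT x|M. a k x * g x)" for k
        by (intro tendsto_mult_left atom_approximation_limit[OF atoms g N F_eq F_meas])
      show "\<forall>\<^sub>F (k, j) in sequentially \<times>\<^sub>F sequentially.
          norm (lam k * (LINT x|M. a k x * F j x)) \<le> norm (lam k) * (bmo_const * N)"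
        by (rule always_eventually)
          (auto simp: norm_mult intro!: mult_left_mono atom_pairing(2)[OF atoms F_osc bN])
      show "summable (\<lambda>k. norm (lam k) * (bmo_const * N))" by (rule summable_mult2[OF sm])
    qed simp
    have "(\<Sum>k. lam k * (LINT x|M. a k x * F j x)) = (LINT x|M. f x * F j x)" for j
      using bounded_pairing_sums(2)[OF rep F_meas F_bound] by (rule sums_unique[symmetric])
    with * have lim: "(\<lambda>j. LINT x|M. f x * F j x) \<longlonglongrightarrow> (\<Sum>k. lam k * (LINT x|M. a k x * g x))"
      by simp
    then have l: "l f = (\<Sum>k. lam k * (LINT x|M. a k x * g x))" unfolding l_def by (rule limI)
    have "summable (\<lambda>k. lam k * (LINT x|M. a k x * g x))" using * by (blast intro: summable_norm_cancel)
    then show ?thesis using lim unfolding l by (auto intro: summable_sums)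
  qed
  have lim: "(\<lambda>j. LINT x|M. f x * F j x) \<longlonglongrightarrow> l f" if "f \<in> H1_at M h" for f
    using that key unfolding H1_at_def by blast
  show thesis
  proof (rule that)
    show "(\<lambda>k. lam k * (LINT x|M. a k x * g x)) sums l f" if "atomic_representation M h f lam a" for f lam a
      using key[OF that] by blast
    show "l (\<lambda>x. f x + f' x) = l f + l f'" if "f \<in> H1_at M h" "f' \<in> H1_at M h" for f f'
      unfolding l_def[of "\<lambda>x. f x + f' x"]
      using tendsto_add[OF lim[OF that(1)] lim[OF that(2)]] int[OF that(1)] int[OF that(2)]
      by (intro limI) (simp add: distrib_right)
    show "l (\<lambda>x. c * f x) = c * l f" if "f \<in> H1_at M h" for f c
      unfolding l_def[of "\<lambda>x. c * f x"]
      using tendsto_mult_left[OF lim[OF that], of c] int[OF that]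
      by (intro limI) (simp add: mult.assoc)
  qed
qed

lemma functional_bound:
  assumes sums: "\<And>f lam a. atomic_representation M h f lam a \<Longrightarrow> (\<lambda>k. lam k * (LINT x|M. a k x * g x)) sums l f"
    and g: "osc_le N g" and N: "0 < N" and f: "f \<in> H1_at M h"
  shows "norm (l f) \<le> N * H1_norm M h f"
proof (rule le_H1_norm[OF f _ N])
  fix lam a assume rep: "atomic_representation M h f lam a"
  have atoms: "atom M h (a k)" for k using rep by (simp add: atomic_representation_def)
  have sm: "summable (\<lambda>k. norm (lam k) * N)"
    using rep by (intro summable_mult2) (simp add: atomic_representation_def)
  have le: "norm (lam k * (LINT x|M. a k x * g x)) \<le> norm (lam k) * N" for k
    unfolding norm_mult by (intro mult_left_mono atom_pairing(2)[OF atoms g N]) simp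
  have "norm (l f) \<le> (\<Sum>k. norm (lam k) * N)"
    using sums_unique[OF sums[OF rep]] norm_suminf_le[OF le sm] by simp
  also have "\<dots> = N * (\<Sum>k. norm (lam k))"
    using rep by (subst suminf_mult2[symmetric]) (auto simp: atomic_representation_def mult.commute)
  finally show "norm (l f) \<le> N * (\<Sum>k. norm (lam k))" .
qed

lemma represents_if_sums:
  assumes sums: "\<And>f lam a. atomic_representation M h f lam a \<Longrightarrow> (\<lambda>k. lam k * (LINT x|M. a k x * g x)) sums l f"
    and g: "osc_le N g" and N: "0 < N"
  shows "represents M h g l"
  unfolding represents_def
proof
  fix f assume "f \<in> finite_atomic M h"
  then obtain n :: nat and lam a where f: "f = (\<lambda>x. \<Sum>k<n. lam k * a k x)" and a: "\<And>k. k < n \<Longrightarrow> atom M h (a k)"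
    unfolding finite_atomic_def by blast
  let ?t = "\<lambda>k. (if k < n then lam k else 0) * (LINT x|M. (if k < n then a k else (\<lambda>x. 0)) x * g x)"
  have "?t sums l f"
    using sums[OF finite_sum_representation[where n = n and lam = lam and a = a, OF a]] unfolding f by blast
  moreover have "?t sums (\<Sum>k<n. ?t k)" by (rule sums_finite) auto
  ultimately have l: "l f = (\<Sum>k<n. lam k * (LINT x|M. a k x * g x))"
    by (auto dest: sums_unique2)
  have "has_bochner_integral M (\<lambda>x. \<Sum>k<n. lam k * (a k x * g x)) (\<Sum>k<n. lam k * (LINT x|M. a k x * g x))"
    by (intro has_bochner_integral_sum has_bochner_integral_mult_right impI has_bochner_integral_integrable
        atom_pairing(1)[OF a g N]) auto
  then show "has_bochner_integral M (\<lambda>x. f x * g x) (l f)"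
    unfolding l by (simp add: f sum_distrib_right mult.assoc)
qed

lemma zero_in_H1: "(\<lambda>x. 0) \<in> H1_at M h" "H1_norm M h (\<lambda>x. 0) \<le> 1"
  using atom_in_H1[OF zero_atom] by auto

lemma BMO_functional:
  assumes "g \<in> BMO M h"
  shows "\<exists>l. H1_functional M h l \<and> represents M h g l \<and>
    H1_functional_norm M h l \<le> enn2real (bmo_norm M h g)"
proof -
  define \<beta> where "\<beta> = enn2real (bmo_norm M h g)"
  have g: "g \<in> borel_measurable M" and fin: "bmo_norm M h g < \<infinity>" using assms by (auto simp: BMO_def)
  have beta: "bmo_norm M h g = ennreal \<beta>" "0 \<le> \<beta>" using fin by (auto simp: \<beta>_def)
  have osc: "osc_le N g" if "\<beta> < N" for N
    using that beta by (intro osc_le_if_bmo_norm_less[OF g]) (auto simp: ennreal_less_iff)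
  have pos: "0 < \<beta> + 1" using beta(2) by simp
  have osc1: "osc_le (\<beta> + 1) g" by (rule osc) simp
  obtain l where sums: "\<And>f lam a. atomic_representation M h f lam a \<Longrightarrow>
        (\<lambda>k. lam k * (LINT x|M. a k x * g x)) sums l f"
    and add: "\<And>f f'. f \<in> H1_at M h \<Longrightarrow> f' \<in> H1_at M h \<Longrightarrow> l (\<lambda>x. f x + f' x) = l f + l f'"
    and scale: "\<And>f c. f \<in> H1_at M h \<Longrightarrow> l (\<lambda>x. c * f x) = c * l f"
    using functional_of_osc_le[OF osc1 pos] by auto
  have bound: "norm (l f) \<le> N * H1_norm M h f" if "\<beta> < N" "f \<in> H1_at M h" for N f
    using functional_bound[OF sums osc[OF that(1)] _ that(2)] that beta by auto
  have "H1_functional M h l"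
    unfolding H1_functional_def
    by (intro conjI exI[of _ "\<beta> + 1"]) (auto simp: add scale bound)
  moreover have "represents M h g l"
    by (rule represents_if_sums[OF sums osc1 pos])
  moreover have "H1_functional_norm M h l \<le> \<beta>"
    unfolding H1_functional_norm_def
  proof (rule cSup_least)
    show "{norm (l f) |f. f \<in> H1_at M h \<and> H1_norm M h f \<le> 1} \<noteq> {}" using zero_in_H1 by blast
    fix y assume "y \<in> {norm (l f) |f. f \<in> H1_at M h \<and> H1_norm M h f \<le> 1}"
    then obtain f where f: "f \<in> H1_at M h" "H1_norm M h f \<le> 1" "y = norm (l f)" by blast
    show "y \<le> \<beta>"
    proof (rule dense_ge)
      fix N assume N: "\<beta> < N"
      have "N * H1_norm M h f \<le> N * 1" using f N beta by (intro mult_left_mono) auto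
      then show "y \<le> N" using bound[OF N f(1)] f by simp
    qed
  qed
  ultimately show ?thesis by (auto simp: \<beta>_def)
qed

section \<open>Duality on a single ball\<close>

lemma ball_weight_meas [measurable]: "(\<lambda>x. indicator (ball z r) x * h x) \<in> borel_measurable M"
  by measurable

lemma ball_weight_nonneg: "0 \<le> indicator (ball z r) x * h x"
  using h_pos[of x] by (simp add: indicator_def)

text \<open>The measure \<open>\<sigma>\<close> restricted to a ball. Its space \<open>L\<^sup>2\<close> consists of all functions whose restriction to the ball is square-integrable,
with no bound outside.\<close>

definition ball_measure :: "'a \<Rightarrow> real \<Rightarrow> 'a measure" where
  "ball_measure z r = density M (\<lambda>x. ennreal (indicator (ball z r) x * h x))"

lemma sets_ball_measure [measurable_cong, simp]: "sets (ball_measure z r) = sets M"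
  by (simp add: ball_measure_def)

lemma measurable_ball_measure [simp]: "borel_measurable (ball_measure z r) = borel_measurable M"
  by (rule measurable_cong_sets) simp_all

lemma integrable_ball_measure:
  fixes f :: "'a \<Rightarrow> 'b::{banach, second_countable_topology}"
  assumes "f \<in> borel_measurable M"
  shows "integrable (ball_measure z r) f \<longleftrightarrow> integrable M (\<lambda>x. (indicator (ball z r) x * h x) *\<^sub>R f x)"
  unfolding ball_measure_def
  by (intro integrable_density assms AE_I2 ball_weight_meas ball_weight_nonneg)

lemma integral_ball_measure:
  fixes f :: "'a \<Rightarrow> 'b::{banach, second_countable_topology}"
  assumes "f \<in> borel_measurable M"
  shows "integral\<^sup>L (ball_measure z r) f = (LINT x|M. (indicator (ball z r) x * h x) *\<^sub>R f x)"
  unfolding ball_measure_def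
  by (intro integral_density assms AE_I2 ball_weight_meas ball_weight_nonneg)

lemma AE_ball_measure: "(AE x in ball_measure z r. P x) \<longleftrightarrow> (AE x in M. x \<in> ball z r \<longrightarrow> P x)"
  unfolding ball_measure_def
proof (subst AE_density)
  show "(\<lambda>x. ennreal (indicator (ball z r) x * h x)) \<in> borel_measurable M" by measurable
  show "(AE x in M. 0 < ennreal (indicator (ball z r) x * h x) \<longrightarrow> P x) \<longleftrightarrow> (AE x in M. x \<in> ball z r \<longrightarrow> P x)"
    using h_pos by (intro AE_cong) (auto simp: indicator_def)
qed

lemma h_in_L2_ball: "(\<lambda>x. of_real (h x)) \<in> L2 (ball_measure z r)"
proof -
  have "integrable (ball_measure z r) (\<lambda>x. (h x)\<^sup>2)"
    using integrable_h_power[of z r 3]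
    by (subst integrable_ball_measure)
      (auto simp: set_integrable_def power2_eq_square power3_eq_cube mult.assoc)
  then show ?thesis by (simp add: L2_def)
qed

lemma inner_h_h: "L2_inner (ball_measure z r) (\<lambda>x. of_real (h x)) (\<lambda>x. of_real (h x)) = of_real (moment 3 z r)"
proof -
  have "L2_inner (ball_measure z r) (\<lambda>x. of_real (h x)) (\<lambda>x. of_real (h x))
      = (LINT x|M. of_real (indicator (ball z r) x *\<^sub>R h x ^ 3))"
    unfolding L2_inner_def
    by (subst integral_ball_measure)
      (auto intro!: Bochner_Integration.integral_cong simp: scaleR_conv_of_real power3_eq_cube indicator_def)
  then show ?thesis by (simp only: integral_complex_of_real moment_def set_lebesgue_integral_def)
qed

lemma moment_3_pos:
  assumes "0 < r"
  shows "0 < moment 3 z r"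
proof -
  have "0 < (sup_ball z r)\<^sup>2 * moment 1 z r"
    using sup_ball_pos[OF assms, of z] moment_1_pos[OF assms, of z] by (intro mult_pos_pos) simp_all
  then have "0 < A\<^sup>2 * moment 3 z r" using sup_ball_square_moment_1_le[OF assms, of z] by linarith
  then show ?thesis using A_pos by (simp add: zero_less_mult_iff)
qed

lemma nn_integral_ball_measure:
  assumes [measurable]: "u \<in> borel_measurable M"
  shows "(\<integral>\<^sup>+x\<in>ball z r. ennreal ((norm (u x))\<^sup>2 * h x) \<partial>M) = (\<integral>\<^sup>+x. ennreal ((norm (u x))\<^sup>2) \<partial>ball_measure z r)"
proof -
  have "(\<integral>\<^sup>+x. ennreal ((norm (u x))\<^sup>2) \<partial>ball_measure z r)
      = (\<integral>\<^sup>+x. ennreal (indicator (ball z r) x * h x) * ennreal ((norm (u x))\<^sup>2) \<partial>M)"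
    unfolding ball_measure_def by (rule nn_integral_density) measurable
  also have "\<dots> = (\<integral>\<^sup>+x\<in>ball z r. ennreal ((norm (u x))\<^sup>2 * h x) \<partial>M)"
    using h_pos
    by (intro nn_integral_cong) (auto simp: indicator_def ennreal_mult[symmetric] less_imp_le mult.commute)
  finally show ?thesis by simp
qed

lemma osc_eq_L2:
  assumes g: "g \<in> L2 (ball_measure z r)"
  shows "osc g c z r = ennreal (LINT x|ball_measure z r. (norm (g x - c * of_real (h x)))\<^sup>2)"
proof -
  have gc: "(\<lambda>x. g x - c * of_real (h x)) \<in> L2 (ball_measure z r)"
    by (intro L2_diff g L2_scale h_in_L2_ball)
  have "osc g c z r = (\<integral>\<^sup>+x. ennreal ((norm (g x - c * of_real (h x)))\<^sup>2) \<partial>ball_measure z r)"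
    unfolding osc_def using L2_D(1)[OF gc] by (intro nn_integral_ball_measure) simp
  also have "\<dots> = ennreal (LINT x|ball_measure z r. (norm (g x - c * of_real (h x)))\<^sup>2)"
    using L2_D(2)[OF gc] by (intro nn_integral_eq_integral) auto
  finally show ?thesis .
qed

lemma osc_le_in_L2:
  assumes g: "osc_le N g" and r: "0 < r"
  shows "g \<in> L2 (ball_measure z r)"
proof -
  have [measurable]: "g \<in> borel_measurable M" using g by (simp add: osc_le_def)
  obtain c where c: "osc g c z r \<le> ennreal (N\<^sup>2 * moment 1 z r)" using g r unfolding osc_le_def by blast
  let ?u = "\<lambda>x. g x - c * of_real (h x)"
  have "?u \<in> borel_measurable M" by measurable
  then have "(\<integral>\<^sup>+x. ennreal ((norm (?u x))\<^sup>2) \<partial>ball_measure z r) \<le> ennreal (N\<^sup>2 * moment 1 z r)"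
    using c nn_integral_ball_measure[of ?u z r] by (simp add: osc_def)
  then have "integrable (ball_measure z r) (\<lambda>x. (norm (?u x))\<^sup>2)"
    by (intro integrableI_bounded) (auto simp: le_less_trans[OF _ ennreal_less_top])
  then have "?u \<in> L2 (ball_measure z r)" by (simp add: L2_def)
  from L2_add[OF this L2_scale[OF h_in_L2_ball, of c]] show ?thesis by simp
qed

lemma L2_ball_mono:
  assumes u: "u \<in> L2 (ball_measure z' r')" and sub: "ball z r \<subseteq> ball z' r'"
  shows "u \<in> L2 (ball_measure z r)"
proof -
  have um [measurable]: "u \<in> borel_measurable M" using u by (simp add: L2_def)
  have i: "integrable M (\<lambda>x. (indicator (ball z' r') x * h x) *\<^sub>R (norm (u x))\<^sup>2)"
    using u by (simp add: L2_def integrable_ball_measure)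
  have "integrable M (\<lambda>x. (indicator (ball z r) x * h x) *\<^sub>R (norm (u x))\<^sup>2)"
  proof (rule Bochner_Integration.integrable_bound[OF i])
    show "AE x in M. norm ((indicator (ball z r) x * h x) *\<^sub>R (norm (u x))\<^sup>2)
        \<le> norm ((indicator (ball z' r') x * h x) *\<^sub>R (norm (u x))\<^sup>2)"
      using sub by (intro AE_I2) (auto simp: indicator_def)
  qed measurable
  then show ?thesis using um by (simp add: L2_def integrable_ball_measure)
qed

lemma ball_function_mono:
  "ball_function z r b \<Longrightarrow> ball z r \<subseteq> ball z' r' \<Longrightarrow> ball_function z' r' b"
  unfolding ball_function_def by (auto elim!: eventually_mono)

text \<open>Multiplication by \<open>h\<close> is an isometry from the orthogonal complement of \<open>h\<close> in \<open>L\<^sup>2(\<sigma>|B)\<close> onto the multiples of atoms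
on \<open>B\<close> with the norm of \<open>L\<^sup>2(h\<^sup>-\<^sup>1 \<mu>)\<close>.\<close>

lemma ball_function_of_L2:
  assumes v: "v \<in> L2 (ball_measure z r)"
    and orth: "L2_inner (ball_measure z r) v (\<lambda>x. of_real (h x)) = 0"
  shows "ball_function z r (\<lambda>x. indicator (ball z r) x * (of_real (h x) * v x))"
    and "(LINT x|M. (norm (indicator (ball z r) x * (of_real (h x) * v x)))\<^sup>2 / h x)
      = (LINT x|ball_measure z r. (norm (v x))\<^sup>2)"
proof -
  let ?b = "\<lambda>x. indicator (ball z r) x * (of_real (h x) * v x)"
  have vm [measurable]: "v \<in> borel_measurable M" using v by (simp add: L2_def)
  have eq: "(norm (?b x))\<^sup>2 / h x = (indicator (ball z r) x * h x) *\<^sub>R (norm (v x))\<^sup>2" for x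
    using h_pos[of x] by (simp add: norm_mult indicator_def power2_eq_square)
  have "integrable M (\<lambda>x. (norm (?b x))\<^sup>2 / h x)"
    unfolding eq using v by (simp add: L2_def integrable_ball_measure)
  moreover have "has_bochner_integral M (\<lambda>x. ?b x * of_real (h x)) 0"
  proof -
    have vh: "(\<lambda>x. v x * cnj (of_real (h x))) \<in> borel_measurable M" by simp
    have "?b x * of_real (h x) = (indicator (ball z r) x * h x) *\<^sub>R (v x * cnj (of_real (h x)))" for x
      by (simp add: indicator_def scaleR_conv_of_real)
    then show ?thesis
      using integrable_mult_L2[OF v L2_cnj[OF h_in_L2_ball]] orth
      by (simp only: has_bochner_integral_iff L2_inner_def integrable_ball_measure[OF vh] integral_ball_measure[OF vh])
  qed
  ultimately show "ball_function z r ?b"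
    unfolding ball_function_def by auto
  show "(LINT x|M. (norm (?b x))\<^sup>2 / h x) = (LINT x|ball_measure z r. (norm (v x))\<^sup>2)"
    unfolding eq by (subst integral_ball_measure) auto
qed

lemma L2_of_ball_function:
  assumes b: "ball_function z r b"
  shows "(\<lambda>x. b x / of_real (h x)) \<in> L2 (ball_measure z r)"
    and "L2_inner (ball_measure z r) (\<lambda>x. b x / of_real (h x)) (\<lambda>x. of_real (h x)) = 0"
    and "AE x in M. indicator (ball z r) x * (of_real (h x) * (b x / of_real (h x))) = b x"
proof -
  have bm [measurable]: "b \<in> borel_measurable M" and supp: "AE x in M. x \<notin> ball z r \<longrightarrow> b x = 0"
    and bi: "integrable M (\<lambda>x. (norm (b x))\<^sup>2 / h x)"
    and bh: "has_bochner_integral M (\<lambda>x. b x * of_real (h x)) 0"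
    using b by (auto simp: ball_function_def)
  have "integrable M (\<lambda>x. (indicator (ball z r) x * h x) *\<^sub>R (norm (b x / of_real (h x)))\<^sup>2)"
  proof (rule Bochner_Integration.integrable_bound[OF bi])
    show "AE x in M. norm ((indicator (ball z r) x * h x) *\<^sub>R (norm (b x / of_real (h x)))\<^sup>2)
        \<le> norm ((norm (b x))\<^sup>2 / h x)"
      using h_pos by (intro AE_I2) (auto simp: indicator_def norm_divide power2_eq_square abs_mult)
  qed measurable
  then show "(\<lambda>x. b x / of_real (h x)) \<in> L2 (ball_measure z r)"
    by (simp add: L2_def integrable_ball_measure)
  have bbm: "(\<lambda>x. b x / complex_of_real (h x) * of_real (h x)) \<in> borel_measurable M"
    by measurable
  have "L2_inner (ball_measure z r) (\<lambda>x. b x / of_real (h x)) (\<lambda>x. of_real (h x))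
      = (LINT x|M. b x * of_real (h x))"
    unfolding L2_inner_def integral_ball_measure[OF bbm] complex_cnj_complex_of_real
  proof (rule integral_cong_AE)
    show "AE x in M. (indicator (ball z r) x * h x) *\<^sub>R (b x / of_real (h x) * of_real (h x))
        = b x * of_real (h x)"
      using supp
    proof eventually_elim
      case (elim x)
      then show ?case using h_pos[of x] by (cases "x \<in> ball z r") (simp_all add: scaleR_conv_of_real)
    qed
  qed measurable
  then show "L2_inner (ball_measure z r) (\<lambda>x. b x / of_real (h x)) (\<lambda>x. of_real (h x)) = 0"
    using bh by (simp add: has_bochner_integral_iff)
  show "AE x in M. indicator (ball z r) x * (of_real (h x) * (b x / of_real (h x))) = b x"
    using supp
  proof eventually_elim
    case (elim x)
    then show ?case using h_pos[of x] by (cases "x \<in> ball z r") simp_all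
  qed
qed

lemma ball_function_integrable:
  assumes b: "ball_function z r b" and g: "g \<in> L2 (ball_measure z r)"
  shows "integrable M (\<lambda>x. b x * g x)"
proof (rule ball_function_pairing(1)[OF b, of g 0 "LINT x|ball_measure z r. (norm (g x))\<^sup>2" 1])
  show "g \<in> borel_measurable M" using L2_D(1)[OF g] by simp
  show "osc g 0 z r \<le> ennreal (LINT x|ball_measure z r. (norm (g x))\<^sup>2)"
    using osc_eq_L2[OF g, of 0] by simp
qed auto

text \<open>The multiple \<open>c\<close> makes \<open>w - c h\<close> the orthogonal projection onto the complement of \<open>h\<close>. The complex conjugate
is what has to be orthogonal to \<open>h\<close> for the test functions below; as \<open>h\<close> is real this is the same condition.\<close>

lemma L2_project:
  assumes w: "w \<in> L2 (ball_measure z r)" and r: "0 < r"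
  obtains c where "(\<lambda>x. w x - c * of_real (h x)) \<in> L2 (ball_measure z r)"
    "L2_inner (ball_measure z r) (\<lambda>x. cnj (w x - c * of_real (h x))) (\<lambda>x. of_real (h x)) = 0"
proof -
  let ?N = "ball_measure z r" and ?h = "\<lambda>x. complex_of_real (h x)"
  define c where "c = L2_inner ?N w ?h / of_real (moment 3 z r)"
  have p: "(\<lambda>x. w x - c * ?h x) \<in> L2 ?N" by (intro L2_diff w L2_scale h_in_L2_ball)
  have i1: "integrable ?N (\<lambda>x. w x * cnj (?h x))" and i2: "integrable ?N (\<lambda>x. ?h x * cnj (?h x))"
    by (intro integrable_mult_L2 L2_cnj w h_in_L2_ball)+
  have "L2_inner ?N (\<lambda>x. w x - c * ?h x) ?h = L2_inner ?N w ?h - c * L2_inner ?N ?h ?h"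
    unfolding L2_inner_def using i1 i2 by (simp add: left_diff_distrib mult.assoc)
  also have "\<dots> = 0" using moment_3_pos[OF r, of z] by (simp add: inner_h_h c_def)
  finally have 0: "L2_inner ?N (\<lambda>x. w x - c * ?h x) ?h = 0" .
  have "L2_inner ?N (\<lambda>x. cnj (w x - c * ?h x)) ?h = (LINT x|?N. cnj ((w x - c * ?h x) * cnj (?h x)))"
    unfolding L2_inner_def by simp
  also have "\<dots> = cnj (L2_inner ?N (\<lambda>x. w x - c * ?h x) ?h)"
    unfolding L2_inner_def by (rule Bochner_Integration.integral_cnj)
  finally show thesis using that[OF p] 0 by simp
qed

text \<open>The test function \<open>h cnj p\<close> recovers the norm of \<open>p\<close> and does not see multiples of \<open>h\<close>. It is used both for uniqueness and
for the bound of the \<open>BMO\<close> norm by the norm of a functional.\<close>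

lemma pairing_with_projection:
  assumes p: "p \<in> L2 (ball_measure z r)"
    and orth: "L2_inner (ball_measure z r) (\<lambda>x. cnj (p x)) (\<lambda>x. of_real (h x)) = 0"
  shows "has_bochner_integral M (\<lambda>x. (indicator (ball z r) x * (of_real (h x) * cnj (p x))) * (p x + c * of_real (h x)))
    (of_real (LINT x|ball_measure z r. (norm (p x))\<^sup>2))"
proof -
  let ?b = "\<lambda>x. indicator (ball z r) x * (of_real (h x) * cnj (p x))"
  have pm [measurable]: "p \<in> borel_measurable M" using L2_D(1)[OF p] by simp
  have b: "ball_function z r ?b" by (rule ball_function_of_L2(1)[OF L2_cnj[OF p] orth])
  have "has_bochner_integral M (\<lambda>x. c * (?b x * of_real (h x))) (c * 0)"
    using b by (intro has_bochner_integral_mult_right impI) (simp add: ball_function_def)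
  moreover have "has_bochner_integral M (\<lambda>x. ?b x * p x) (of_real (LINT x|ball_measure z r. (norm (p x))\<^sup>2))"
  proof -
    have "?b x * p x = of_real ((indicator (ball z r) x * h x) *\<^sub>R (norm (p x))\<^sup>2)" for x
      by (simp add: indicator_def complex_norm_square mult.commute del: of_real_power)
    moreover have "has_bochner_integral M (\<lambda>x. (indicator (ball z r) x * h x) *\<^sub>R (norm (p x))\<^sup>2)
        (LINT x|ball_measure z r. (norm (p x))\<^sup>2)"
      using L2_D(2)[OF p] by (simp add: has_bochner_integral_iff integrable_ball_measure integral_ball_measure)
    ultimately show ?thesis by (simp only: has_bochner_integral_of_real)
  qed
  ultimately have "has_bochner_integral M (\<lambda>x. ?b x * p x + c * (?b x * of_real (h x)))
      (of_real (LINT x|ball_measure z r. (norm (p x))\<^sup>2) + c * 0)"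
    by (intro has_bochner_integral_add)
  moreover have "?b x * p x + c * (?b x * of_real (h x)) = ?b x * (p x + c * of_real (h x))" for x
    by (simp add: algebra_simps)
  ultimately show ?thesis by simp
qed

lemma unique_modulo_h:
  assumes g: "g \<in> L2 (ball_measure z r)" and g': "g' \<in> L2 (ball_measure z r)" and r: "0 < r"
    and same: "\<And>b. ball_function z r b \<Longrightarrow> (LINT x|M. b x * g' x) = (LINT x|M. b x * g x)"
  shows "\<exists>c. AE x in M. x \<in> ball z r \<longrightarrow> g' x = g x + c * of_real (h x)"
proof -
  obtain c where p: "(\<lambda>x. (g' x - g x) - c * of_real (h x)) \<in> L2 (ball_measure z r)"
    and orth: "L2_inner (ball_measure z r) (\<lambda>x. cnj ((g' x - g x) - c * of_real (h x))) (\<lambda>x. of_real (h x)) = 0"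
    by (rule L2_project[OF L2_diff[OF g' g] r])
  let ?p = "\<lambda>x. (g' x - g x) - c * of_real (h x)"
  let ?b = "\<lambda>x. indicator (ball z r) x * (of_real (h x) * cnj (?p x))"
  have b: "ball_function z r ?b" by (rule ball_function_of_L2(1)[OF L2_cnj[OF p] orth])
  have "of_real (LINT x|ball_measure z r. (norm (?p x))\<^sup>2) = (LINT x|M. ?b x * (?p x + c * of_real (h x)))"
    using pairing_with_projection[OF p orth, of c] by (simp add: has_bochner_integral_iff)
  also have "\<dots> = (LINT x|M. ?b x * g' x - ?b x * g x)"
    by (intro Bochner_Integration.integral_cong) (auto simp: algebra_simps)
  also have "\<dots> = 0"
    using same[OF b] ball_function_integrable[OF b g] ball_function_integrable[OF b g'] by simp
  finally have "(LINT x|ball_measure z r. (norm (?p x))\<^sup>2) = 0" by simp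
  then have "AE x in ball_measure z r. (norm (?p x))\<^sup>2 = 0"
    using integral_nonneg_eq_0_iff_AE[OF L2_D(2)[OF p]] by simp
  then show ?thesis unfolding AE_ball_measure
    by (intro exI[of _ c]) (auto elim!: eventually_mono simp: algebra_simps)
qed

lemma ball_function_scale:
  assumes "ball_function z r b"
  shows "ball_function z r (\<lambda>x. c * b x)"
proof -
  have b: "b \<in> borel_measurable M" "AE x in M. x \<notin> ball z r \<longrightarrow> b x = 0"
    "integrable M (\<lambda>x. (norm (b x))\<^sup>2 / h x)" "has_bochner_integral M (\<lambda>x. b x * of_real (h x)) 0"
    using assms by (auto simp: ball_function_def)
  have "has_bochner_integral M (\<lambda>x. c * (b x * of_real (h x))) (c * 0)"
    by (intro has_bochner_integral_mult_right impI b(4))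
  moreover have "integrable M (\<lambda>x. (norm c)\<^sup>2 * ((norm (b x))\<^sup>2 / h x))"
    by (intro integrable_mult_right impI b(3))
  moreover have "AE x in M. x \<notin> ball z r \<longrightarrow> c * b x = 0"
    using b(2) by eventually_elim simp
  ultimately show ?thesis
    using b(1) unfolding ball_function_def by (simp add: norm_mult power_mult_distrib mult.assoc)
qed

lemma H1_functional_add:
  "H1_functional M h l \<Longrightarrow> f \<in> H1_at M h \<Longrightarrow> g \<in> H1_at M h \<Longrightarrow> l (\<lambda>x. f x + g x) = l f + l g"
  by (simp add: H1_functional_def)

lemma H1_functional_scale:
  "H1_functional M h l \<Longrightarrow> f \<in> H1_at M h \<Longrightarrow> l (\<lambda>x. c * f x) = c * l f"
  by (simp add: H1_functional_def)

lemma ball_function_energy_nonneg: "0 \<le> (LINT x|M. (norm (b x))\<^sup>2 / h x)"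
  using h_pos by (intro integral_nonneg_AE AE_I2) (simp add: less_imp_le)

lemma scaled_ball_function_atom:
  assumes b: "ball_function z r b" and r: "0 < r"
    and t: "(norm t)\<^sup>2 * (LINT x|M. (norm (b x))\<^sup>2 / h x) \<le> 1 / moment 1 z r"
  shows "atom M h (\<lambda>x. t * b x)"
  unfolding atom_iff
proof (intro exI[of _ z] exI[of _ r] conjI r ball_function_scale b)
  have "(LINT x|M. (norm (t * b x))\<^sup>2 / h x) = (LINT x|M. (norm t)\<^sup>2 * ((norm (b x))\<^sup>2 / h x))"
    by (simp add: norm_mult power_mult_distrib)
  also have "\<dots> = (norm t)\<^sup>2 * (LINT x|M. (norm (b x))\<^sup>2 / h x)" by (rule integral_mult_right_zero)
  finally show "(LINT x|M. (norm (t * b x))\<^sup>2 / h x) \<le> 1 / moment 1 z r" using t by simp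
qed

lemma ball_function_finite_atomic:
  assumes b: "ball_function z r b" and r: "0 < r"
  shows "b \<in> finite_atomic M h"
proof -
  let ?I = "LINT x|M. (norm (b x))\<^sup>2 / h x"
  define m where "m = moment 1 z r"
  have m: "0 < m" using moment_1_pos[OF r] by (simp add: m_def)
  \<comment> \<open>The summand \<open>1\<close> allows \<open>?I = 0\<close>.\<close>
  define t where "t = 1 / sqrt (m * (?I + 1))"
  have t0: "t \<noteq> 0" using m ball_function_energy_nonneg[of b] by (simp add: t_def)
  have "t\<^sup>2 * ?I = ?I / (m * (?I + 1))"
    using m ball_function_energy_nonneg[of b] by (simp add: t_def power_divide)
  also have "\<dots> \<le> (?I + 1) / (m * (?I + 1))"
    using m ball_function_energy_nonneg[of b] by (intro divide_right_mono) auto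
  also have "\<dots> = 1 / m" using ball_function_energy_nonneg[of b] by simp
  finally have "atom M h (\<lambda>x. of_real t * b x)"
    by (intro scaled_ball_function_atom[OF b r]) (simp add: m_def)
  moreover have "b = (\<lambda>x. \<Sum>k<(1::nat). of_real (1 / t) * (of_real t * b x))"
    using t0 by (simp add: fun_eq_iff)
  ultimately show ?thesis
    unfolding finite_atomic_def
    by (intro CollectI exI[of _ "1::nat"] exI[of _ "\<lambda>_. of_real (1 / t)"]
        exI[of _ "\<lambda>_ x. of_real t * b x"] conjI) simp_all
qed

lemma ball_function_in_H1: "ball_function z r b \<Longrightarrow> 0 < r \<Longrightarrow> b \<in> H1_at M h"
  by (intro finite_atomic_in_H1 ball_function_finite_atomic)

lemma H1_functional_le_norm:
  assumes l: "H1_functional M h l" and f: "f \<in> H1_at M h" "H1_norm M h f \<le> 1"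
  shows "norm (l f) \<le> H1_functional_norm M h l"
  unfolding H1_functional_norm_def
proof (rule cSup_upper)
  obtain K where K: "\<And>f. f \<in> H1_at M h \<Longrightarrow> norm (l f) \<le> K * H1_norm M h f"
    using l unfolding H1_functional_def by blast
  have "norm (l f) \<le> \<bar>K\<bar>" if "f \<in> H1_at M h" "H1_norm M h f \<le> 1" for f
  proof -
    have "K * H1_norm M h f \<le> \<bar>K\<bar> * H1_norm M h f"
      using H1_norm_nonneg[OF that(1)] by (intro mult_right_mono) auto
    also have "\<dots> \<le> \<bar>K\<bar> * 1" using that by (intro mult_left_mono) auto
    finally show ?thesis using K[OF that(1)] by simp
  qed
  then show "bdd_above {norm (l f) |f. f \<in> H1_at M h \<and> H1_norm M h f \<le> 1}"
    by (auto simp: bdd_above_def)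
qed (use f in blast)

lemma H1_functional_norm_nonneg: "H1_functional M h l \<Longrightarrow> 0 \<le> H1_functional_norm M h l"
  using H1_functional_le_norm[OF _ zero_in_H1] by (meson norm_ge_zero order_trans)

text \<open>A functional is bounded by its norm on atoms, and every function of the class considered is a multiple of an atom, the
multiple being given by its norm.\<close>

lemma functional_ball_function_bound:
  assumes l: "H1_functional M h l" and b: "ball_function z r b" and r: "0 < r"
  shows "(norm (l b))\<^sup>2 \<le> (H1_functional_norm M h l)\<^sup>2 * moment 1 z r * (LINT x|M. (norm (b x))\<^sup>2 / h x)"
proof -
  let ?I = "LINT x|M. (norm (b x))\<^sup>2 / h x"
  define \<Lambda> where "\<Lambda> = H1_functional_norm M h l"
  define m where "m = moment 1 z r"
  have m: "0 < m" using moment_1_pos[OF r] by (simp add: m_def)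
  have I: "0 \<le> ?I" by (rule ball_function_energy_nonneg)
  have scaled: "t * norm (l b) \<le> \<Lambda>" if t: "0 \<le> t" "t\<^sup>2 * ?I \<le> 1 / m" for t
  proof -
    have "atom M h (\<lambda>x. of_real t * b x)"
      using t by (intro scaled_ball_function_atom[OF b r]) (simp add: m_def)
    then have "norm (l (\<lambda>x. of_real t * b x)) \<le> \<Lambda>"
      unfolding \<Lambda>_def by (intro H1_functional_le_norm[OF l] atom_in_H1)
    moreover have "l (\<lambda>x. of_real t * b x) = of_real t * l b"
      by (rule H1_functional_scale[OF l ball_function_in_H1[OF b r]])
    ultimately show ?thesis using t by (simp add: norm_mult)
  qed
  show ?thesis
  proof (cases "?I = 0")
    case True
    have "norm (l b) = 0"
    proof (rule ccontr)
      assume ne: "norm (l b) \<noteq> 0"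
      then have "(\<bar>\<Lambda>\<bar> + 1) / norm (l b) * norm (l b) \<le> \<Lambda>"
        using True m by (intro scaled) auto
      then show False using ne by simp
    qed
    then show ?thesis using True by simp
  next
    case False
    then have I: "0 < ?I" using I by simp
    have "1 / sqrt (m * ?I) * norm (l b) \<le> \<Lambda>"
      using m I by (intro scaled) (auto simp: power_divide)
    then have "norm (l b) \<le> \<Lambda> * sqrt (m * ?I)" using m I by (simp add: field_simps)
    then have "(norm (l b))\<^sup>2 \<le> (\<Lambda> * sqrt (m * ?I))\<^sup>2" by (intro power_mono) auto
    also have "\<dots> = \<Lambda>\<^sup>2 * m * ?I" using m I by (simp add: power_mult_distrib)
    finally show ?thesis by (simp add: \<Lambda>_def m_def)
  qed
qed

text \<open>The difference has vanishing norm, so that arbitrarily large multiples of it are atoms.\<close>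

lemma functional_AE_cong:
  assumes l: "H1_functional M h l" and b: "ball_function z r b" and b': "ball_function z r b'" and r: "0 < r"
    and eq: "AE x in M. b x = b' x"
  shows "l b = l b'"
proof -
  have meas [measurable]: "b \<in> borel_measurable M" "b' \<in> borel_measurable M"
    using b b' by (auto simp: ball_function_def)
  let ?d = "\<lambda>x. b x + (-1) * b' x"
  have d0: "AE x in M. ?d x = 0" using eq by eventually_elim simp
  have d_supp: "AE x in M. x \<notin> ball z r \<longrightarrow> ?d x = 0" using d0 by eventually_elim simp
  have d_sq: "AE x in M. 0 = (norm (?d x))\<^sup>2 / h x" using d0 by eventually_elim simp
  have d_h: "AE x in M. 0 = ?d x * of_real (h x)" using d0 by eventually_elim simp
  have "integrable M (\<lambda>x. (norm (?d x))\<^sup>2 / h x)"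
    by (rule integrable_cong_AE_imp[OF integrable_zero _ d_sq]) measurable
  moreover have "has_bochner_integral M (\<lambda>x. ?d x * of_real (h x)) 0"
    by (rule iffD1[OF has_bochner_integral_cong_AE[OF _ _ d_h] has_bochner_integral_zero]) measurable
  moreover have "?d \<in> borel_measurable M" by measurable
  ultimately have d: "ball_function z r ?d"
    unfolding ball_function_def using d_supp by blast
  have "(LINT x|M. (norm (?d x))\<^sup>2 / h x) = (LINT x|M. 0)"
    by (rule integral_cong_AE[OF _ _ d_sq[THEN AE_symmetric]]) measurable
  then have "l ?d = 0" using functional_ball_function_bound[OF l d r] by simp
  moreover have "l ?d = l b + l (\<lambda>x. (-1) * b' x)"
    by (rule H1_functional_add[OF l ball_function_in_H1[OF b r]
          ball_function_in_H1[OF ball_function_scale[OF b'] r]])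
  moreover have "l (\<lambda>x. (-1) * b' x) = (-1) * l b'"
    by (rule H1_functional_scale[OF l ball_function_in_H1[OF b' r]])
  ultimately show ?thesis by simp
qed

text \<open>The functional, transported to the orthogonal complement of \<open>h\<close> in \<open>L\<^sup>2(\<sigma>|B)\<close>, is an inner product.\<close>

lemma local_representation:
  assumes l: "H1_functional M h l" and r: "0 < r"
  shows "\<exists>g\<in>L2 (ball_measure z r). \<forall>b. ball_function z r b \<longrightarrow> l b = (LINT x|M. b x * g x)"
proof -
  let ?N = "ball_measure z r" and ?h = "\<lambda>x. complex_of_real (h x)"
  define E where "E v x = indicator (ball z r) x * (of_real (h x) * v x)" for v :: "'a \<Rightarrow> complex" and x
  note bf = ball_function_of_L2[where z = z and r = r, folded E_def]
  define \<Lambda> where "\<Lambda> = H1_functional_norm M h l"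
  have "\<exists>u\<in>L2 ?N. \<forall>v\<in>L2 ?N. L2_inner ?N v ?h = 0 \<longrightarrow> l (E v) = L2_inner ?N v u"
  proof (rule riesz_L2_orthogonal[OF h_in_L2_ball])
    fix v v' assume v: "v \<in> L2 ?N" "L2_inner ?N v ?h = 0" "v' \<in> L2 ?N" "L2_inner ?N v' ?h = 0"
    have "E (\<lambda>x. v x + v' x) = (\<lambda>x. E v x + E v' x)" by (auto simp: E_def algebra_simps)
    moreover have "l (\<lambda>x. E v x + E v' x) = l (E v) + l (E v')"
      by (rule H1_functional_add[OF l ball_function_in_H1[OF bf(1)[OF v(1,2)] r]
            ball_function_in_H1[OF bf(1)[OF v(3,4)] r]])
    ultimately show "l (E (\<lambda>x. v x + v' x)) = l (E v) + l (E v')" by simp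
  next
    fix v c assume v: "v \<in> L2 ?N" "L2_inner ?N v ?h = 0"
    have "E (\<lambda>x. c * v x) = (\<lambda>x. c * E v x)" by (auto simp: E_def algebra_simps)
    moreover have "l (\<lambda>x. c * E v x) = c * l (E v)"
      by (rule H1_functional_scale[OF l ball_function_in_H1[OF bf(1)[OF v] r]])
    ultimately show "l (E (\<lambda>x. c * v x)) = c * l (E v)" by simp
  next
    fix v assume v: "v \<in> L2 ?N" "L2_inner ?N v ?h = 0"
    have "(norm (l (E v)))\<^sup>2 \<le> \<Lambda>\<^sup>2 * moment 1 z r * (LINT x|?N. (norm (v x))\<^sup>2)"
      using functional_ball_function_bound[OF l bf(1)[OF v] r] bf(2)[OF v] by (simp add: \<Lambda>_def)
    then show "(norm (l (E v)))\<^sup>2 \<le> (\<Lambda> * sqrt (moment 1 z r))\<^sup>2 * (LINT x|?N. (norm (v x))\<^sup>2)"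
      using moment_nonneg[of 1 z r] by (simp add: power_mult_distrib)
  qed
  then obtain u where u: "u \<in> L2 ?N"
    and lu: "\<And>v. v \<in> L2 ?N \<Longrightarrow> L2_inner ?N v ?h = 0 \<Longrightarrow> l (E v) = L2_inner ?N v u" by blast
  define w where "w x = cnj (u x)" for x
  have w: "w \<in> L2 ?N" using L2_cnj[OF u] by (simp add: w_def[abs_def])
  have wm: "w \<in> borel_measurable M" using L2_D(1)[OF w] by simp
  have "l b = (LINT x|M. b x * w x)" if b: "ball_function z r b" for b
  proof -
    let ?v = "\<lambda>x. b x / ?h x"
    have bm: "b \<in> borel_measurable M" using b by (simp add: ball_function_def)
    have hm: "?h \<in> borel_measurable M" by measurable
    have vw: "(\<lambda>x. ?v x * w x) \<in> borel_measurable M"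
      by (intro borel_measurable_times borel_measurable_divide bm hm wm)
    have v: "?v \<in> L2 ?N" "L2_inner ?N ?v ?h = 0" and Ev: "AE x in M. E ?v x = b x"
      unfolding E_def by (rule L2_of_ball_function[OF b])+
    have Ev': "AE x in M. b x = E ?v x" using Ev by eventually_elim simp
    have "l b = l (E ?v)"
      by (rule functional_AE_cong[OF l b bf(1)[OF v] r Ev'])
    also have "\<dots> = L2_inner ?N ?v u" by (rule lu[OF v])
    also have "\<dots> = (LINT x|?N. ?v x * w x)" unfolding L2_inner_def w_def by (rule refl)
    also have "\<dots> = (LINT x|M. (indicator (ball z r) x * h x) *\<^sub>R (?v x * w x))"
      by (rule integral_ball_measure[OF vw])
    also have "\<dots> = (LINT x|M. b x * w x)"
    proof (rule integral_cong_AE)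
      show "(\<lambda>x. (indicator (ball z r) x * h x) *\<^sub>R (?v x * w x)) \<in> borel_measurable M"
        by (intro borel_measurable_scaleR ball_weight_meas vw)
      show "(\<lambda>x. b x * w x) \<in> borel_measurable M"
        by (intro borel_measurable_times bm wm)
      show "AE x in M. (indicator (ball z r) x * h x) *\<^sub>R (?v x * w x) = b x * w x"
        using Ev
      proof eventually_elim
        case (elim x)
        have "(indicator (ball z r) x * h x) *\<^sub>R (?v x * w x) = E ?v x * w x"
          by (simp add: E_def indicator_def scaleR_conv_of_real)
        then show ?case using elim by simp
      qed
    qed
    finally show ?thesis .
  qed
  then show ?thesis using w by blast
qed

lemma ball_not_null:
  assumes "0 < r" "AE x in M. x \<notin> ball z r"
  shows False
proof -
  have "{x \<in> space M. \<not> x \<notin> ball z r} = ball z r" by (auto simp: space_M)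
  from AE_iff_measurable[OF ball_meas this] have "emeasure M (ball z r) = 0"
    using assms(2) by (rule iffD1)
  then show False using ball_pos[OF assms(1), of z] by (simp add: measure_def)
qed

lemma multiple_of_h_zero:
  fixes c :: complex
  assumes "0 < r" "AE x in M. x \<in> ball z r \<longrightarrow> c * of_real (h x) = 0"
  shows "c = 0"
proof (rule ccontr)
  assume c: "c \<noteq> 0"
  have "AE x in M. x \<notin> ball z r"
    using assms(2)
  proof eventually_elim
    case (elim x)
    then show ?case using c h_pos[of x] by auto
  qed
  then show False by (rule ball_not_null[OF assms(1)])
qed

lemma ball_subset_nat: "\<exists>n. ball z r \<subseteq> ball y (real (Suc n))"
proof -
  obtain n where n: "dist y z + r \<le> real n" using real_arch_simple by blast
  have "ball z r \<subseteq> ball y (real (Suc n))"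
  proof
    fix x assume "x \<in> ball z r"
    then show "x \<in> ball y (real (Suc n))" using n dist_triangle[of y x z] by simp
  qed
  then show ?thesis by blast
qed

section \<open>From bounded functionals to functions of bounded mean oscillation\<close>

text \<open>The multiples found on an increasing sequence of balls agree, as \<open>h\<close> does not vanish on the smallest ball.\<close>

lemma unique_modulo_h_global:
  assumes g: "\<And>z r. 0 < r \<Longrightarrow> g \<in> L2 (ball_measure z r)"
    and g': "\<And>z r. 0 < r \<Longrightarrow> g' \<in> L2 (ball_measure z r)"
    and same: "\<And>z r b. 0 < r \<Longrightarrow> ball_function z r b \<Longrightarrow> (LINT x|M. b x * g' x) = (LINT x|M. b x * g x)"
  shows "\<exists>c. AE x in M. g' x = g x + c * of_real (h x)"
proof -
  fix y :: 'a
  have "\<exists>c. AE x in M. x \<in> ball y (real (Suc n)) \<longrightarrow> g' x = g x + c * of_real (h x)" for n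
    by (rule unique_modulo_h) (auto intro: g g' same[of "real (Suc n)"])
  then obtain c where c: "\<And>n. AE x in M. x \<in> ball y (real (Suc n)) \<longrightarrow> g' x = g x + c n * of_real (h x)"
    by metis
  have c_eq: "c n = c 0" for n
  proof -
    have "AE x in M. x \<in> ball y (real (Suc 0)) \<longrightarrow> (c n - c 0) * of_real (h x) = 0"
      using c[of n] c[of 0]
    proof eventually_elim
      case (elim x)
      then show ?case by (auto simp: left_diff_distrib)
    qed
    then have "c n - c 0 = 0" by (rule multiple_of_h_zero[rotated]) simp
    then show ?thesis by simp
  qed
  have "AE x in M. \<forall>n. x \<in> ball y (real (Suc n)) \<longrightarrow> g' x = g x + c 0 * of_real (h x)"
    unfolding AE_all_countable
  proof
    fix n show "AE x in M. x \<in> ball y (real (Suc n)) \<longrightarrow> g' x = g x + c 0 * of_real (h x)"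
      using c[of n] unfolding c_eq[of n] .
  qed
  then have "AE x in M. g' x = g x + c 0 * of_real (h x)"
  proof eventually_elim
    case (elim x)
    obtain n where "dist y x \<le> real n" using real_arch_simple by blast
    then have "x \<in> ball y (real (Suc n))" by simp
    then show ?case using elim by blast
  qed
  then show ?thesis by blast
qed

text \<open>The representatives on an increasing sequence of balls are normalised to agree on the smallest of them. Two of them differ by
a multiple of \<open>h\<close> on their common domain, and this multiple vanishes on the smallest ball, hence everywhere.\<close>

lemma functional_global_representative:
  assumes l: "H1_functional M h l"
  obtains g where "\<And>z r. 0 < r \<Longrightarrow> g \<in> L2 (ball_measure z r)"
    "\<And>z r b. 0 < r \<Longrightarrow> ball_function z r b \<Longrightarrow> l b = (LINT x|M. b x * g x)"
proof -
  fix y :: 'a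
  define B where "B n = ball y (real (Suc n))" for n
  have B_mono: "B n \<subseteq> B m" if "n \<le> m" for n m using that by (auto simp: B_def)
  have "\<forall>n. \<exists>g\<in>L2 (ball_measure y (real (Suc n))).
      \<forall>b. ball_function y (real (Suc n)) b \<longrightarrow> l b = (LINT x|M. b x * g x)"
    by (intro allI local_representation[OF l]) simp
  then obtain G where G: "\<And>n. G n \<in> L2 (ball_measure y (real (Suc n)))"
    and lG: "\<And>n b. ball_function y (real (Suc n)) b \<Longrightarrow> l b = (LINT x|M. b x * G n x)" by metis
  have compare: "\<exists>c. AE x in M. x \<in> B n \<longrightarrow> G m x = G n x + c * of_real (h x)" if "n \<le> m" for n m
    unfolding B_def
  proof (rule unique_modulo_h[OF G])
    have sub: "ball y (real (Suc n)) \<subseteq> ball y (real (Suc m))" using B_mono[OF that] by (simp add: B_def)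
    show "G m \<in> L2 (ball_measure y (real (Suc n)))" by (rule L2_ball_mono[OF G sub])
    show "(LINT x|M. b x * G m x) = (LINT x|M. b x * G n x)" if "ball_function y (real (Suc n)) b" for b
      using lG[OF that] lG[OF ball_function_mono[OF that sub]] by simp
  qed simp
  have "\<forall>m. \<exists>c. AE x in M. x \<in> B 0 \<longrightarrow> G m x = G 0 x + c * of_real (h x)"
    using compare[of 0] by blast
  from choice[OF this] obtain c
    where c: "\<And>m. AE x in M. x \<in> B 0 \<longrightarrow> G m x = G 0 x + c m * of_real (h x)"
    by blast
  define G' where "G' m x = G m x - c m * of_real (h x)" for m x
  have G'_L2: "G' m \<in> L2 (ball_measure y (real (Suc m)))" for m
    unfolding G'_def[abs_def] by (intro L2_diff G L2_scale h_in_L2_ball)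
  have G'_meas [measurable]: "G' m \<in> borel_measurable M" for m using L2_D(1)[OF G'_L2[of m]] by simp
  have lG': "l b = (LINT x|M. b x * G' m x)" if b: "ball_function y (real (Suc m)) b" for b m
  proof -
    have bh: "has_bochner_integral M (\<lambda>x. c m * (b x * of_real (h x))) (c m * 0)"
      using b by (intro has_bochner_integral_mult_right impI) (simp add: ball_function_def)
    have "(LINT x|M. b x * G' m x) = (LINT x|M. b x * G m x - c m * (b x * of_real (h x)))"
      by (simp add: G'_def algebra_simps)
    also have "\<dots> = (LINT x|M. b x * G m x) - c m * 0"
      using ball_function_integrable[OF b G] bh by (simp add: has_bochner_integral_iff)
    finally show ?thesis using lG[OF b] by simp
  qed
  have agree: "AE x in M. x \<in> B n \<longrightarrow> G' m x = G' n x" if nm: "n \<le> m" for n m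
  proof -
    obtain d where d: "AE x in M. x \<in> B n \<longrightarrow> G m x = G n x + d * of_real (h x)"
      using compare[OF nm] by blast
    have "AE x in M. x \<in> ball y (real (Suc 0)) \<longrightarrow> (d - c m + c n) * of_real (h x) = 0"
      using d c[of m] c[of n]
    proof eventually_elim
      case (elim x)
      then show ?case using B_mono[of 0 n] by (auto simp: B_def algebra_simps)
    qed
    then have "d - c m + c n = 0" by (rule multiple_of_h_zero[rotated]) simp
    then have d_eq: "d = c m - c n" by (simp add: algebra_simps)
    show ?thesis using d
    proof eventually_elim
      case (elim x)
      then show ?case by (auto simp: G'_def d_eq algebra_simps)
    qed
  qed
  \<comment> \<open>At each point use the representative on the first ball of the sequence that contains it.\<close>
  define index where "index x = nat \<lfloor>dist y x\<rfloor>" for x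
  define g where "g x = G' (index x) x" for x
  have in_B: "x \<in> B (index x)" for x
    unfolding B_def index_def by simp linarith
  have index_le: "index x \<le> n" if "x \<in> B n" for x n
    using that unfolding B_def index_def by simp linarith
  have "dist y \<in> borel_measurable borel"
    by (intro borel_measurable_continuous_onI continuous_intros)
  then have [measurable]: "dist y \<in> borel_measurable M"
    by (simp cong: measurable_cong_sets add: sets_M)
  have [measurable]: "index \<in> measurable M (count_space UNIV)" unfolding index_def by measurable
  have g_meas [measurable]: "g \<in> borel_measurable M"
    unfolding g_def by (rule measurable_compose_countable) measurable
  have "AE x in M. n \<le> m \<longrightarrow> x \<in> B n \<longrightarrow> G' m x = G' n x" for m n
  proof (cases "n \<le> m")
    case True
    show ?thesis using agree[OF True] by eventually_elim simp
  qed simp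
  then have "AE x in M. \<forall>m n. n \<le> m \<longrightarrow> x \<in> B n \<longrightarrow> G' m x = G' n x"
    unfolding AE_all_countable by (intro allI)
  then have gG': "AE x in M. \<forall>n. x \<in> B n \<longrightarrow> g x = G' n x"
  proof eventually_elim
    case (elim x)
    show ?case
    proof (intro allI impI)
      fix n assume "x \<in> B n"
      then have "G' n x = G' (index x) x" using elim index_le[of x n] in_B[of x] by blast
      then show "g x = G' n x" by (simp add: g_def)
    qed
  qed
  show thesis
  proof (rule that)
    fix z and r :: real assume r: "0 < r"
    obtain n where sub: "ball z r \<subseteq> ball y (real (Suc n))" using ball_subset_nat by blast
    have eq: "AE x in M. x \<in> ball z r \<longrightarrow> g x = G' n x"
      using gG' by eventually_elim (use sub in \<open>auto simp: B_def\<close>)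
    have G'L: "G' n \<in> L2 (ball_measure z r)" by (rule L2_ball_mono[OF G'_L2 sub])
    have "integrable (ball_measure z r) (\<lambda>x. (norm (g x))\<^sup>2)"
    proof (subst integrable_cong_AE)
      show "AE x in ball_measure z r. (norm (g x))\<^sup>2 = (norm (G' n x))\<^sup>2"
        unfolding AE_ball_measure using eq by eventually_elim simp
      show "integrable (ball_measure z r) (\<lambda>x. (norm (G' n x))\<^sup>2)" by (rule L2_D(2)[OF G'L])
    qed simp_all
    then show "g \<in> L2 (ball_measure z r)" by (simp add: L2_def)
    fix b assume b: "ball_function z r b"
    have bm [measurable]: "b \<in> borel_measurable M" and supp: "AE x in M. x \<notin> ball z r \<longrightarrow> b x = 0"
      using b by (auto simp: ball_function_def)
    have "l b = (LINT x|M. b x * G' n x)" by (rule lG'[OF ball_function_mono[OF b sub]])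
    also have "\<dots> = (LINT x|M. b x * g x)"
    proof (rule integral_cong_AE)
      show "AE x in M. b x * G' n x = b x * g x"
        using supp eq by eventually_elim auto
    qed measurable
    finally show "l b = (LINT x|M. b x * g x)" .
  qed
qed

text \<open>Test the functional on \<open>h cnj (g - c h)\<close>, where \<open>c h\<close> is the projection of \<open>g\<close>: the value is the squared distance \<open>J\<close>
of \<open>g\<close> from the line spanned by \<open>h\<close>, and the norm of the test function is the square root of \<open>J\<close>.\<close>

lemma osc_le_of_functional:
  assumes l: "H1_functional M h l"
    and g: "\<And>z r. 0 < r \<Longrightarrow> g \<in> L2 (ball_measure z r)"
    and lg: "\<And>z r b. 0 < r \<Longrightarrow> ball_function z r b \<Longrightarrow> l b = (LINT x|M. b x * g x)"
  shows "osc_le (H1_functional_norm M h l) g"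
  unfolding osc_le_def
proof (intro conjI allI impI)
  show "g \<in> borel_measurable M" using L2_D(1)[OF g[of 1 undefined]] by simp
  fix z and r :: real assume r: "0 < r"
  let ?\<Lambda> = "H1_functional_norm M h l" and ?N = "ball_measure z r"
  obtain c where p: "(\<lambda>x. g x - c * of_real (h x)) \<in> L2 ?N"
    and orth: "L2_inner ?N (\<lambda>x. cnj (g x - c * of_real (h x))) (\<lambda>x. of_real (h x)) = 0"
    by (rule L2_project[OF g[OF r] r])
  let ?p = "\<lambda>x. g x - c * of_real (h x)"
  let ?b = "\<lambda>x. indicator (ball z r) x * (of_real (h x) * cnj (?p x))"
  define J where "J = (LINT x|?N. (norm (?p x))\<^sup>2)"
  have J: "0 \<le> J" by (simp add: J_def)
  have b: "ball_function z r ?b" by (rule ball_function_of_L2(1)[OF L2_cnj[OF p] orth])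
  have energy: "(LINT x|M. (norm (?b x))\<^sup>2 / h x) = J"
    unfolding ball_function_of_L2(2)[OF L2_cnj[OF p] orth] complex_mod_cnj J_def ..
  have "l ?b = of_real J"
    using pairing_with_projection[OF p orth, of c] lg[OF r b]
    by (simp add: has_bochner_integral_iff J_def)
  then have "J\<^sup>2 \<le> ?\<Lambda>\<^sup>2 * moment 1 z r * J"
    using functional_ball_function_bound[OF l b r] J unfolding energy by simp
  then have "J \<le> ?\<Lambda>\<^sup>2 * moment 1 z r"
    using J moment_nonneg[of 1 z r] by (cases "J = 0") (auto simp: power2_eq_square)
  then show "\<exists>c. osc g c z r \<le> ennreal (?\<Lambda>\<^sup>2 * moment 1 z r)"
    using osc_eq_L2[OF g[OF r, of z], of c] by (intro exI[of _ c]) (auto simp: J_def intro: ennreal_leI)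
qed

lemma represents_of_local:
  assumes l: "H1_functional M h l"
    and g: "\<And>z r. 0 < r \<Longrightarrow> g \<in> L2 (ball_measure z r)"
    and lg: "\<And>z r b. 0 < r \<Longrightarrow> ball_function z r b \<Longrightarrow> l b = (LINT x|M. b x * g x)"
  shows "represents M h g l"
  unfolding represents_def
proof
  fix f assume "f \<in> finite_atomic M h"
  then obtain n :: nat and lam a where f: "f = (\<lambda>x. \<Sum>k<n. lam k * a k x)" and a: "\<forall>k<n. atom M h (a k)"
    unfolding finite_atomic_def by blast
  have "has_bochner_integral M (\<lambda>x. (\<Sum>k<n. lam k * a k x) * g x) (l (\<lambda>x. \<Sum>k<n. lam k * a k x))"
    using a
  proof (induction n)
    case 0
    have "l (\<lambda>x. 0 * (0::complex)) = 0 * l (\<lambda>x. 0)"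
      by (rule H1_functional_scale[OF l zero_in_H1(1)])
    then show ?case by (simp add: has_bochner_integral_zero)
  next
    case (Suc n)
    have an: "atom M h (a n)" using Suc.prems by simp
    obtain z r where r: "0 < r" and b: "ball_function z r (a n)"
      using an unfolding atom_iff by blast
    have "has_bochner_integral M (\<lambda>x. a n x * g x) (l (a n))"
      using ball_function_integrable[OF b g[OF r]] lg[OF r b] by (simp add: has_bochner_integral_iff)
    then have "has_bochner_integral M (\<lambda>x. lam n * (a n x * g x)) (lam n * l (a n))"
      by (intro has_bochner_integral_mult_right impI)
    moreover have "l (\<lambda>x. lam n * a n x) = lam n * l (a n)"
      by (rule H1_functional_scale[OF l atom_in_H1(1)[OF an]])
    moreover have "l (\<lambda>x. (\<Sum>k<n. lam k * a k x) + lam n * a n x)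
        = l (\<lambda>x. \<Sum>k<n. lam k * a k x) + l (\<lambda>x. lam n * a n x)"
    proof -
      have "(\<lambda>x. \<Sum>k<n. lam k * a k x) \<in> H1_at M h"
        unfolding H1_at_def
        using finite_sum_representation[where n = n and a = a and lam = lam] Suc.prems by auto
      moreover have "(\<lambda>x. lam n * a n x) \<in> H1_at M h"
        by (rule ball_function_in_H1[OF ball_function_scale[OF b] r])
      ultimately show ?thesis by (rule H1_functional_add[OF l])
    qed
    ultimately have "has_bochner_integral M (\<lambda>x. (\<Sum>k<n. lam k * a k x) * g x + lam n * (a n x * g x))
        (l (\<lambda>x. (\<Sum>k<n. lam k * a k x) + lam n * a n x))"
      using Suc by (simp add: has_bochner_integral_add)
    then show ?case by (simp add: distrib_right mult.assoc)
  qed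
  then show "has_bochner_integral M (\<lambda>x. f x * g x) (l f)" unfolding f .
qed

lemma functional_BMO:
  assumes l: "H1_functional M h l"
  shows "\<exists>g\<in>BMO M h. represents M h g l \<and> enn2real (bmo_norm M h g) \<le> H1_functional_norm M h l \<and>
    (\<forall>g'\<in>BMO M h. represents M h g' l \<longrightarrow> (\<exists>c. AE x in M. g' x = g x + c * of_real (h x)))"
proof -
  obtain g where g: "\<And>z r. 0 < r \<Longrightarrow> g \<in> L2 (ball_measure z r)"
    and lg: "\<And>z r b. 0 < r \<Longrightarrow> ball_function z r b \<Longrightarrow> l b = (LINT x|M. b x * g x)"
    by (rule functional_global_representative[OF l]) blast
  have nn: "0 \<le> H1_functional_norm M h l" by (rule H1_functional_norm_nonneg[OF l])
  have osc: "osc_le (H1_functional_norm M h l) g" by (rule osc_le_of_functional[OF l g lg])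
  have le: "bmo_norm M h g \<le> ennreal (H1_functional_norm M h l)" by (rule bmo_norm_le_if_osc_le[OF osc nn])
  have "g \<in> BMO M h"
    using le osc by (auto simp: BMO_def osc_le_def intro: le_less_trans)
  moreover have "enn2real (bmo_norm M h g) \<le> H1_functional_norm M h l"
    using enn2real_mono[OF le] nn by simp
  moreover have "\<exists>c. AE x in M. g' x = g x + c * of_real (h x)"
    if g': "g' \<in> BMO M h" "represents M h g' l" for g'
  proof (rule unique_modulo_h_global[OF g])
    have g'm: "g' \<in> borel_measurable M" and fin: "bmo_norm M h g' < \<infinity>" using g'(1) by (auto simp: BMO_def)
    then obtain N where "bmo_norm M h g' < ennreal N"
      by (metis ennreal_Ex_less_of_nat ennreal_of_nat_eq_real_of_nat infinity_ennreal_def)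
    then have "osc_le N g'" by (rule osc_le_if_bmo_norm_less[OF g'm])
    then show "g' \<in> L2 (ball_measure z r)" if "0 < r" for z r by (rule osc_le_in_L2[OF _ that])
    show "(LINT x|M. b x * g' x) = (LINT x|M. b x * g x)" if "0 < r" "ball_function z r b" for z r b
      using g'(2) ball_function_finite_atomic[OF that(2,1)] lg[OF that]
      by (auto simp: represents_def has_bochner_integral_iff)
  qed
  moreover have "represents M h g l" by (rule represents_of_local[OF l g lg])
  ultimately show ?thesis by (intro bexI[of _ g] conjI ballI impI)
qed

lemma BMO_is_dual: "BMO_is_dual_of_H1 M h"
  unfolding BMO_is_dual_of_H1_def
  using BMO_functional functional_BMO by (intro exI[of _ 1]) simp

end

section \<open>Heat kernel bounds\<close>

lemma measure_weighted_square:
  assumes "sets M = sets borel" "h \<in> borel_measurable M"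
  shows "measure (weighted M (\<lambda>x. (h x)\<^sup>2)) (ball z r) = (LINT x:ball z r|M. (h x)\<^sup>2)"
proof -
  have [measurable]: "ball z r \<in> sets M" "h \<in> borel_measurable M" using assms by auto
  have "(LINT x:ball z r|M. (h x)\<^sup>2) = enn2real (\<integral>\<^sup>+x. ennreal (indicator (ball z r) x *\<^sub>R (h x)\<^sup>2) \<partial>M)"
    unfolding set_lebesgue_integral_def by (rule integral_eq_nn_integral) auto
  also have "(\<integral>\<^sup>+x. ennreal (indicator (ball z r) x *\<^sub>R (h x)\<^sup>2) \<partial>M)
      = (\<integral>\<^sup>+x\<in>ball z r. ennreal ((h x)\<^sup>2) \<partial>M)"
    by (intro nn_integral_cong) (auto simp: indicator_def)
  also have "\<dots> = emeasure (weighted M (\<lambda>x. (h x)\<^sup>2)) (ball z r)"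
    unfolding weighted_def by (rule emeasure_density[symmetric]) measurable
  finally show ?thesis by (simp add: measure_def)
qed

text \<open>On the diagonal the Gaussian factors are \<open>1\<close>. With \<open>t = s\<^sup>2\<close> the bounds of \<open>k t x x\<close> from below and above give
\<open>h(x)\<^sup>2 \<mu>(B(x,s)) \<le> C \<nu>(B(x,s))\<close>. To pass to a ball \<open>B(z,r)\<close> containing \<open>x\<close>, take \<open>s = 2r\<close>, so that
\<open>B(z,r) \<subseteq> B(x,2r) \<subseteq> B(z,4r)\<close>.\<close>

lemma reverse_holder_weight_of_kernel_bounds:
  fixes M :: "'a::metric_space measure" and k :: "real \<Rightarrow> 'a \<Rightarrow> 'a \<Rightarrow> real"
  assumes M: "doubling_measure M"
    and upper: "\<exists>c>0. \<exists>C>0. \<forall>x y. \<forall>t>0.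
           0 \<le> k t x y \<and>
           k t x y \<le> C / measure M (ball x (sqrt t)) * exp (- (dist x y)\<^sup>2 / (c * t))"
    and h: "h \<in> borel_measurable M" and h_pos: "\<And>x. 0 < h x"
    and nu: "doubling_measure (weighted M (\<lambda>x. (h x)\<^sup>2))"
    and lower: "\<exists>c1>0. \<exists>c2>0. \<exists>C>0. \<forall>x y. \<forall>t>0.
           inverse C / measure (weighted M (\<lambda>x. (h x)\<^sup>2)) (ball x (sqrt t))
               * exp (- (dist x y)\<^sup>2 / (c1 * t))
             \<le> k t x y / (h x * h y) \<and>
           k t x y / (h x * h y)
             \<le> C / measure (weighted M (\<lambda>x. (h x)\<^sup>2)) (ball x (sqrt t))
               * exp (- (dist x y)\<^sup>2 / (c2 * t))"
  shows "\<exists>A D. reverse_holder_weight M h A D"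
proof -
  define \<nu> where "\<nu> = weighted M (\<lambda>x. (h x)\<^sup>2)"
  obtain D1 where D1: "0 < D1" "\<And>x r. 0 < r \<Longrightarrow> measure M (ball x (2 * r)) \<le> D1 * measure M (ball x r)"
    using M unfolding doubling_measure_def by blast
  obtain D2 where D2: "0 < D2" "\<And>x r. 0 < r \<Longrightarrow> measure \<nu> (ball x (2 * r)) \<le> D2 * measure \<nu> (ball x r)"
    using nu unfolding doubling_measure_def \<nu>_def by blast
  have sets: "sets M = sets borel" using M by (simp add: doubling_measure_def)
  have sets_nu: "sets \<nu> = sets M" by (simp add: \<nu>_def weighted_def)
  have fin: "emeasure M (ball x r) < \<infinity>" for x r
    using M by (cases "0 < r") (auto simp: doubling_measure_def ball_empty)
  have fin_nu: "emeasure \<nu> (ball x r) < \<infinity>" for x r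
    using nu by (cases "0 < r") (auto simp: doubling_measure_def ball_empty \<nu>_def)
  have pos: "0 < measure M (ball x r)" if "0 < r" for x r
    using M that by (auto simp: doubling_measure_def measure_def enn2real_positive_iff)
  have pos_nu: "0 < measure \<nu> (ball x r)" if "0 < r" for x r
    using nu that by (auto simp: doubling_measure_def measure_def enn2real_positive_iff \<nu>_def)
  have mono: "measure M (ball x r) \<le> measure M (ball x' r')" if "ball x r \<subseteq> ball x' r'" for x x' r r'
    using that fin[of x' r'] sets by (intro measure_mono_fmeasurable) (auto simp: fmeasurable_def)
  have mono_nu: "measure \<nu> (ball x r) \<le> measure \<nu> (ball x' r')" if "ball x r \<subseteq> ball x' r'" for x x' r r'
    using that fin_nu[of x' r'] sets sets_nu by (intro measure_mono_fmeasurable) (auto simp: fmeasurable_def)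
  obtain C1 where C1: "0 < C1"
    "\<And>x t. 0 < t \<Longrightarrow> k t x x \<le> C1 / measure M (ball x (sqrt t))"
  proof -
    obtain c C where "0 < C" and *: "\<And>x y t. 0 < t \<Longrightarrow>
        k t x y \<le> C / measure M (ball x (sqrt t)) * exp (- (dist x y)\<^sup>2 / (c * t))"
      using upper by blast
    then show thesis using that[of C] *[of _ x x for x] by simp
  qed
  obtain C2 where C2: "0 < C2"
    "\<And>x t. 0 < t \<Longrightarrow> inverse C2 / measure \<nu> (ball x (sqrt t)) \<le> k t x x / (h x * h x)"
  proof -
    obtain c C where "0 < C" and *: "\<And>x y t. 0 < t \<Longrightarrow>
        inverse C / measure \<nu> (ball x (sqrt t)) * exp (- (dist x y)\<^sup>2 / (c * t)) \<le> k t x y / (h x * h y)"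
      using lower unfolding \<nu>_def by blast
    then show thesis using that[of C] *[of _ x x for x] by simp
  qed
  have diag: "(h x)\<^sup>2 * measure M (ball x s) \<le> C1 * C2 * measure \<nu> (ball x s)" if s: "0 < s" for x s
  proof -
    have t: "0 < s\<^sup>2" "sqrt (s\<^sup>2) = s" using s by auto
    have "inverse C2 / measure \<nu> (ball x s) \<le> k (s\<^sup>2) x x / (h x)\<^sup>2"
      using C2(2)[OF t(1), of x] t by (simp add: power2_eq_square)
    also have "\<dots> \<le> C1 / measure M (ball x s) / (h x)\<^sup>2"
      using C1(2)[OF t(1), of x] t by (intro divide_right_mono) auto
    finally show ?thesis
      using C1(1) C2(1) pos[OF s, of x] pos_nu[OF s, of x] h_pos[of x]
      by (simp add: field_simps)
  qed
  have "(h x)\<^sup>2 * measure M (ball z r) \<le> (C1 * C2 * D2\<^sup>2) * measure \<nu> (ball z r)"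
    if x: "x \<in> ball z r" for x z r
  proof -
    have r: "0 < r" using x by (auto intro: le_less_trans[OF zero_le_dist])
    have sub1: "ball z r \<subseteq> ball x (2 * r)"
    proof
      fix w assume "w \<in> ball z r"
      then show "w \<in> ball x (2 * r)" using x dist_triangle[of x w z] by (simp add: dist_commute)
    qed
    have sub2: "ball x (2 * r) \<subseteq> ball z (2 * (2 * r))"
    proof
      fix w assume "w \<in> ball x (2 * r)"
      then show "w \<in> ball z (2 * (2 * r))" using x r dist_triangle[of z w x] by simp
    qed
    have "(h x)\<^sup>2 * measure M (ball z r) \<le> (h x)\<^sup>2 * measure M (ball x (2 * r))"
      by (intro mult_left_mono mono sub1) simp
    also have "\<dots> \<le> C1 * C2 * measure \<nu> (ball x (2 * r))" using r by (intro diag) simp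
    also have "\<dots> \<le> C1 * C2 * measure \<nu> (ball z (2 * (2 * r)))"
      using C1(1) C2(1) by (intro mult_left_mono mono_nu sub2) simp
    also have "\<dots> \<le> C1 * C2 * (D2 * (D2 * measure \<nu> (ball z r)))"
      using C1(1) C2(1) D2(1) order_trans[OF D2(2)[of "2 * r" z] mult_left_mono[OF D2(2)[of r z], of D2]] r
      by (intro mult_left_mono) simp_all
    finally show ?thesis by (simp add: power2_eq_square mult.assoc)
  qed
  then have "reverse_holder_weight M h (C1 * C2 * D2\<^sup>2) (max D1 D2)"
    unfolding \<nu>_def measure_weighted_square[OF sets h]
  proof (intro reverse_holder_weight.intro sets h h_pos fin pos)
    fix z and r :: real assume r: "0 < r"
    have "D1 * measure M (ball z r) \<le> max D1 D2 * measure M (ball z r)"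
      by (intro mult_right_mono) auto
    then show "measure M (ball z (2 * r)) \<le> max D1 D2 * measure M (ball z r)"
      using D1(2)[OF r, of z] by linarith
    have "D2 * measure \<nu> (ball z r) \<le> max D1 D2 * measure \<nu> (ball z r)"
      by (intro mult_right_mono) auto
    then have "measure \<nu> (ball z (2 * r)) \<le> max D1 D2 * measure \<nu> (ball z r)"
      using D2(2)[OF r, of z] by linarith
    then show "(LINT x:ball z (2 * r)|M. (h x)\<^sup>2) \<le> max D1 D2 * (LINT x:ball z r|M. (h x)\<^sup>2)"
      by (simp add: \<nu>_def measure_weighted_square[OF sets h])
  qed auto
  then show ?thesis by blast
qed

theorem theoremB:
  fixes M :: "'a::metric_space measure"
    and D :: "('a \<Rightarrow> complex) set"
    and L :: "('a \<Rightarrow> complex) \<Rightarrow> ('a \<Rightarrow> complex)"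
    and T :: "real \<Rightarrow> ('a \<Rightarrow> complex) \<Rightarrow> ('a \<Rightarrow> complex)"
    and k :: "real \<Rightarrow> 'a \<Rightarrow> 'a \<Rightarrow> real"
    and h :: "'a \<Rightarrow> real"
  assumes "doubling_measure M"
    and "emeasure M (space M) = \<infinity>"
    and "self_adjoint M D L" and "nonnegative_operator M D L"
    and "exp_semigroup M D L T"
    and "\<And>t. 0 < t \<Longrightarrow> has_integral_kernel M (T t) (k t)"
    and "\<exists>c>0. \<exists>C>0. \<forall>x y. \<forall>t>0.
           0 \<le> k t x y \<and>
           k t x y \<le> C / measure M (ball x (sqrt t)) * exp (- (dist x y)\<^sup>2 / (c * t))"
    and "h \<in> borel_measurable M" and "\<And>x. 0 < h x"
    and "\<And>t. 0 < t \<Longrightarrow> AE x in M. kernel_op M (k t) h x = h x"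
    and "doubling_measure (weighted M (\<lambda>x. (h x)\<^sup>2))"
    and "\<exists>c1>0. \<exists>c2>0. \<exists>C>0. \<forall>x y. \<forall>t>0.
           inverse C / measure (weighted M (\<lambda>x. (h x)\<^sup>2)) (ball x (sqrt t))
               * exp (- (dist x y)\<^sup>2 / (c1 * t))
             \<le> k t x y / (h x * h y) \<and>
           k t x y / (h x * h y)
             \<le> C / measure (weighted M (\<lambda>x. (h x)\<^sup>2)) (ball x (sqrt t))
               * exp (- (dist x y)\<^sup>2 / (c2 * t))"
  shows "\<exists>p0::real. 1 < p0 \<and> p0 \<le> 2 \<and>
           (muckenhoupt p0 (weighted M (\<lambda>x. (h x)\<^sup>2)) (\<lambda>x. inverse (h x)) \<longrightarrow>
            BMO_is_dual_of_H1 M h)"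
proof -
  obtain A D where "reverse_holder_weight M h A D"
    using reverse_holder_weight_of_kernel_bounds[OF assms(1,7,8,9,11,12)] by blast
  then have "BMO_is_dual_of_H1 M h" by (rule reverse_holder_weight.BMO_is_dual)
  then show ?thesis by (intro exI[of _ 2]) simp
qed

end
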